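(* Let $L$ be a link with a strongly reduced almost alternating diagram $D$ with $c$ crossings. With the notation $v,\overline{v},\beta_1,\overline{\beta}_1,P,P_i,\overline{P},\overline{P}_i,Q,\overline{Q},S,\overline{S}$ defined in the context, the Kauffman bracket of $D$ can be expressed as $$\langle D \rangle = \sum_{i=0}^{c-3} \alpha_i A^{c+2v-8-4i}$$ where \begin{align*} \alpha_0 = &\; (-1)^v(P-1),\\ \alpha_1 = & \; (-1)^{v-1}\left(\beta_1(P-1) - \binom{P}{2} + P_2- P_0 + Q - S\right),\\ \alpha_{c-4} = & \; (-1)^{\overline{v}-1}\left(\overline{\beta}_1(\overline{P}-1)-\binom{\overline{P}}{2} + \overline{P}_2-\overline{P}_0+\overline{Q}-\overline{S}\right),\ \text{and}\\ \alpha_{c-3} = & \; (-1)^{\overline{v}}(\overline{P}-1). \end{align*}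
   Context: A link diagram is alternating if crossings alternate over, under, over, under, ... along each component. A link diagram is almost alternating if one crossing can be changed to transform it into an alternating diagram; that crossing (fixed once and for all) is called the dealternator. Diagrams here are connected. Resolutions and Kauffman bracket: of the two smoothings of a crossing, the $A$-resolution is the one that merges the two regions swept out when the overstrand is rotated counterclockwise onto the understrand; the other is the $B$-resolution. The Kauffman bracket $\langle D\rangle\in\mathbb{Z}[A,A^{-1}]$ is defined by $\langle D\rangle = A\langle D_A\rangle + A^{-1}\langle D_B\rangle$, where $D_A$, $D_B$ are the $A$- and $B$-resolutions of $D$ at a crossing, $\langle D\sqcup\bigcirc\rangle=(-A^2-A^{-2})\langle D\rangle$, and $\langle\bigcirc\rangle=1$. Checkerboard graphs: shade the complementary regions of $D$ in checkerboard fashion. One checkerboard graph has the shaded regions as vertices, the other the unshaded regions; in each, there is one edge per crossing, joining the two regions of the given color meeting at that crossing. They are planar duals. An edge is an $A$-edge if the two regions it joins are not the ones merged by the $A$-resolution of the crossing (i.e. they are merged by the $B$-resolution), and a $B$-edge if the two regions it joins are merged by the $A$-resolution. For an almost alternating diagram $D$, let $G$ be the checkerboard graph in which every edge except the one of the dealternator is an $A$-edge, and let $\overline{G}$ be the other, in which every edge except the one of the dealternator is a $B$-edge. Let $u_1,u_2$ be the endpoints in $G$ of the dealternator's edge, and $v_1,v_2$ the endpoints in $\overline{G}$ of the dealternator's edge. $D$ is strongly reduced if $u_1\neq u_2$, $v_1\neq v_2$, the only edge of $G$ joining $u_1$ and $u_2$ is the dealternator's edge, the only edge of $\overline{G}$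 joining $v_1$ and $v_2$ is the dealternator's edge, and neither $G$ nor $\overline{G}$ contains a loop. The simplification $G'$ of $G$ is obtained by deleting all loops and replacing each set of multiple edges with a single edge; $\overline{G}'$ is the simplification of $\overline{G}$. Let $v,e$ be the numbers of vertices and edges of $G'$, and $\beta_1=e-v+1$. Let $P$ be the number of paths of length two between $u_1$ and $u_2$ in $G'$; for $i=0,1,2$ let $P_i$ be the number of these paths exactly $i$ of whose edges come from multiple edges in $G$. Let $Q$ be the number of paths of length three between $u_1$ and $u_2$ in $G'$ such that no interior vertex of the path is adjacent to both $u_1$ and $u_2$. Let $S$ be the number of subgraphs of $G'$ containing $u_1$ and $u_2$ that are isomorphic to the complete graph $K_4$. Define $\overline{v},\overline{e},\overline{\beta}_1=\overline{e}-\overline{v}+1,\overline{P},\overline{P}_i,\overline{Q},\overline{S}$ in the same way using $\overline{G},\overline{G}',v_1,v_2$ in place of $G,G',u_1,u_2$. *)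

theory Defs
  imports "HOL-Library.Poly_Mapping" "HOL-Combinatorics.Orbits"
begin

section \<open>Link diagrams\<close>

text \<open>
  Link diagrams are given by planar diagram (PD) codes. Every arc running from one crossing to
  the next carries a label. The crossing \<open>Crossing a b c d\<close> lists the labels of the four
  arc ends at it in counterclockwise order, starting at an end of the understrand: \<open>a\<close>
  and \<open>c\<close> are the ends of the understrand, \<open>b\<close> and \<open>d\<close> those of the
  overstrand. The second component of a diagram counts the crossingless circles that split off;
  they arise when crossings are smoothed.
\<close>

datatype 'a crossing = Crossing 'a 'a 'a 'a

datatype 'a diagram = Diagram (crossings: "'a crossing list") (circles: nat)

fun arc_ends :: "'a crossing \<Rightarrow> 'a list" where
  "arc_ends (Crossing a b c d) = [a, b, c, d]"

abbreviation num_crossings :: "'a diagram \<Rightarrow> nat" where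
  "num_crossings D \<equiv> length (crossings D)"

definition arc_labels :: "'a crossing list \<Rightarrow> 'a list" where
  "arc_labels xs = concat (map arc_ends xs)"

definition well_formed :: "'a diagram \<Rightarrow> bool" where
  "well_formed D \<longleftrightarrow>
     (\<forall>a \<in> set (arc_labels (crossings D)). count_list (arc_labels (crossings D)) a = 2)"

text \<open>
  The dart \<open>(i, k)\<close> is the \<open>k\<close>-th arc end at the \<open>i\<close>-th crossing, so
  even positions are under and odd ones over. The two darts of an arc are mates.
\<close>

definition darts :: "'a diagram \<Rightarrow> (nat \<times> nat) set" where
  "darts D = {..<num_crossings D} \<times> {..<4}"

definition dart_label :: "'a diagram \<Rightarrow> nat \<times> nat \<Rightarrow> 'a" where
  "dart_label D x = arc_ends (crossings D ! fst x) ! snd x"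

definition mate :: "'a diagram \<Rightarrow> nat \<times> nat \<Rightarrow> nat \<times> nat" where
  "mate D x = (THE y. y \<in> darts D \<and> y \<noteq> x \<and> dart_label D y = dart_label D x)"

text \<open>
  The pair \<open>(i, k)\<close> also names the corner at crossing \<open>i\<close> lying between the
  arc ends \<open>k\<close> and \<open>k + 1\<close> (mod 4). Leaving crossing \<open>i\<close> along its
  end \<open>k\<close>, this corner is on the left; if the arc arrives at end \<open>l\<close> of
  crossing \<open>j\<close>, then the corner on the left there is \<open>(j, l - 1)\<close>. The
  complementary regions of a connected diagram are the orbits of this walk on the corners.
\<close>

definition next_corner :: "'a diagram \<Rightarrow> nat \<times> nat \<Rightarrow> nat \<times> nat" where
  "next_corner D x = (case mate D x of (j, l) \<Rightarrow> (j, (l + 3) mod 4))"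

type_synonym region = "(nat \<times> nat) set"

definition region_at :: "'a diagram \<Rightarrow> nat \<times> nat \<Rightarrow> region" where
  "region_at D x = orbit (next_corner D) x"

definition regions :: "'a diagram \<Rightarrow> region set" where
  "regions D = region_at D ` darts D"

definition adjacent_crossings :: "'a diagram \<Rightarrow> (nat \<times> nat) set" where
  "adjacent_crossings D = {(i, j). i < num_crossings D \<and> j < num_crossings D \<and>
     set (arc_ends (crossings D ! i)) \<inter> set (arc_ends (crossings D ! j)) \<noteq> {}}"

text \<open>
  We only consider connected diagrams with a crossing, which excludes the crossingless circle.
\<close>

definition connected_diagram :: "'a diagram \<Rightarrow> bool" where
  "connected_diagram D \<longleftrightarrow> crossings D \<noteq> [] \<and> circles D = 0 \<and>
     (\<forall>i < num_crossings D. \<forall>j < num_crossings D. (i, j) \<in> (adjacent_crossings D)\<^sup>*)"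

text \<open>
  Planarity of a connected diagram is Euler's formula
  \<open>V - E + F = 2\<close>: the surface obtained by gluing discs to the
  4-valent graph along the region boundaries is then a sphere.
\<close>

definition planar_diagram :: "'a diagram \<Rightarrow> bool" where
  "planar_diagram D \<longleftrightarrow>
     int (num_crossings D) - int (card (set (arc_labels (crossings D))))
       + int (card (regions D)) = 2"

definition connected_link_diagram :: "'a diagram \<Rightarrow> bool" where
  "connected_link_diagram D \<longleftrightarrow>
     well_formed D \<and> connected_diagram D \<and> planar_diagram D"


section \<open>Alternating and almost alternating diagrams\<close>

text \<open>
  Consecutive crossing passages along a component are joined by an arc, so over and under
  alternate along all components iff each arc has one over end and one under end.
\<close>

definition alternating :: "'a diagram \<Rightarrow> bool" where
  "alternating D \<longleftrightarrow>
     (\<forall>x \<in> darts D. \<forall>y \<in> darts D. x \<noteq> y \<longrightarrow> dart_label D x = dart_label D y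
        \<longrightarrow> (even (snd x) \<longleftrightarrow> odd (snd y)))"

fun switch :: "'a crossing \<Rightarrow> 'a crossing" where
  "switch (Crossing a b c d) = Crossing b c d a"

definition change_crossing :: "'a diagram \<Rightarrow> nat \<Rightarrow> 'a diagram" where
  "change_crossing D i =
     Diagram ((crossings D)[i := switch (crossings D ! i)]) (circles D)"

definition almost_alternating :: "'a diagram \<Rightarrow> nat \<Rightarrow> bool" where
  "almost_alternating D d \<longleftrightarrow>
     d < num_crossings D \<and> alternating (change_crossing D d)"


section \<open>Resolutions and the Kauffman bracket\<close>

text \<open>
  \<open>join a b\<close> connects two loose arc ends labelled \<open>a\<close> and \<open>b\<close>;
  if they are the two ends of one arc, the arc closes up to a circle.
\<close>

fun join :: "'a \<Rightarrow> 'a \<Rightarrow> 'a diagram \<Rightarrow> 'a diagram" where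
  "join a b (Diagram xs n) =
     (if a = b then Diagram xs (Suc n)
      else Diagram (map (map_crossing (id(b := a))) xs) n)"

text \<open>
  Joining \<open>a\<close> with \<open>b\<close> may rename the labels \<open>c\<close> and \<open>d\<close>.
\<close>

definition join2 :: "'a \<Rightarrow> 'a \<Rightarrow> 'a \<Rightarrow> 'a \<Rightarrow> 'a diagram \<Rightarrow> 'a diagram" where
  "join2 a b c d D = join ((id(b := a)) c) ((id(b := a)) d) (join a b D)"

definition remove_crossing :: "'a diagram \<Rightarrow> nat \<Rightarrow> 'a diagram" where
  "remove_crossing D i =
     Diagram (take i (crossings D) @ drop (Suc i) (crossings D)) (circles D)"

text \<open>
  Rotating the overstrand (positions 1 and 3) counterclockwise onto the understrand sweeps out
  the corners 1 and 3. The A-resolution merges these two, hence joins position 0 with 1 and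
  position 2 with 3. The B-resolution merges the corners 0 and 2.
\<close>

definition A_resolution :: "'a diagram \<Rightarrow> nat \<Rightarrow> 'a diagram" where
  "A_resolution D i = (case crossings D ! i of
     Crossing a b c d \<Rightarrow> join2 a b c d (remove_crossing D i))"

definition B_resolution :: "'a diagram \<Rightarrow> nat \<Rightarrow> 'a diagram" where
  "B_resolution D i = (case crossings D ! i of
     Crossing a b c d \<Rightarrow> join2 b c d a (remove_crossing D i))"

text \<open>
  The ring \<open>\<int>[A, A\<^sup>-\<^sup>1]\<close> is the group ring of the additive group \<open>\<int>\<close>.
\<close>

type_synonym laurent = "int \<Rightarrow>\<^sub>0 int"

definition A_pow :: "int \<Rightarrow> laurent" where
  "A_pow k = Poly_Mapping.single k 1"

lemma A_pow_add: "A_pow (j + k) = A_pow j * A_pow k"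
  by (simp add: A_pow_def mult_single)

lemma A_pow_0: "A_pow 0 = 1"
  by (simp add: A_pow_def)

lemma num_crossings_join [simp]: "num_crossings (join a b D) = num_crossings D"
  by (cases D) simp

lemma num_crossings_resolution:
  "i < num_crossings D \<Longrightarrow> num_crossings (A_resolution D i) = num_crossings D - 1"
  "i < num_crossings D \<Longrightarrow> num_crossings (B_resolution D i) = num_crossings D - 1"
  by (cases "crossings D ! i";
      simp add: A_resolution_def B_resolution_def join2_def remove_crossing_def)+

text \<open>
  The recursion resolves the first crossing in the list. That the skein relation holds at every
  crossing is \<open>bracket_skein\<close> below; with \<open>bracket_unknot\<close> and
  \<open>bracket_add_circle\<close> these are the defining rules of the Kauffman bracket. The value
  on the empty diagram is irrelevant.
\<close>

function bracket :: "'a diagram \<Rightarrow> laurent" where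
  "bracket D = (if crossings D = []
     then (- A_pow 2 - A_pow (-2)) ^ (circles D - 1)
     else A_pow 1 * bracket (A_resolution D 0) + A_pow (-1) * bracket (B_resolution D 0))"
  by auto
termination
  by (relation "measure num_crossings") (simp_all add: num_crossings_resolution)

declare bracket.simps [simp del]

definition add_circle :: "'a diagram \<Rightarrow> 'a diagram" where
  "add_circle D = Diagram (crossings D) (Suc (circles D))"

lemma bracket_unknot: "bracket (Diagram [] 1) = 1"
  by (simp add: bracket.simps)


subsection \<open>The skein relation at an arbitrary crossing\<close>

text \<open>
  A pair \<open>(f, n)\<close> records the relabelling of the arcs and the number of circles after some
  joins.
\<close>

fun jn :: "'a \<times> 'a \<Rightarrow> ('a \<Rightarrow> 'a) \<times> nat \<Rightarrow> ('a \<Rightarrow> 'a) \<times> nat" where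
  "jn (a, b) (f, n) = (if f a = f b then (f, Suc n) else ((id(f b := f a)) \<circ> f, n))"

fun same_joins :: "('a \<Rightarrow> 'a) \<times> nat \<Rightarrow> ('a \<Rightarrow> 'a) \<times> nat \<Rightarrow> bool" where
  "same_joins (f, n) (g, m) \<longleftrightarrow> n = m \<and> (\<forall>x y. f x = f y \<longleftrightarrow> g x = g y)"

fun apply_joins :: "('a \<Rightarrow> 'a) \<times> nat \<Rightarrow> 'a crossing list \<Rightarrow> 'a diagram" where
  "apply_joins (f, n) xs = Diagram (map (map_crossing f) xs) n"

lemma same_joins_refl: "same_joins s s"
  by (cases s) simp

lemma same_joins_trans: "same_joins s t \<Longrightarrow> same_joins t u \<Longrightarrow> same_joins s u"
  by (cases s; cases t; cases u) simp

lemma same_joins_jn: "same_joins s t \<Longrightarrow> same_joins (jn p s) (jn p t)"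
  by (cases s; cases t; cases p) (auto simp: fun_upd_def)

lemma jn_commute: "same_joins (jn p (jn q s)) (jn q (jn p s))"
  by (cases s; cases q; cases p) (auto simp: fun_upd_def)

lemma join_eq:
  "join a b (Diagram xs n) =
     Diagram (map (map_crossing (id(b := a))) xs) (if a = b then Suc n else n)"
proof -
  have "id(a := a) = id" by (rule ext) simp
  then show ?thesis by (auto simp: crossing.map_id0)
qed

lemma jn_eq: "jn (a, b) (f, n) = (id(f b := f a) \<circ> f, if f a = f b then Suc n else n)"
  by (auto simp: fun_eq_iff)

lemma join2_apply_joins:
  "join2 (f a) (f b) (f c) (f d) (apply_joins (f, n) xs)
     = apply_joins (jn (c, d) (jn (a, b) (f, n))) xs"
  unfolding join2_def apply_joins.simps join_eq jn_eq
  by (simp only: list.map_comp crossing.map_comp o_def)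

definition jnA :: "'a crossing \<Rightarrow> ('a \<Rightarrow> 'a) \<times> nat \<Rightarrow> ('a \<Rightarrow> 'a) \<times> nat" where
  "jnA x s = (case x of Crossing a b c d \<Rightarrow> jn (c, d) (jn (a, b) s))"

definition jnB :: "'a crossing \<Rightarrow> ('a \<Rightarrow> 'a) \<times> nat \<Rightarrow> ('a \<Rightarrow> 'a) \<times> nat" where
  "jnB x s = (case x of Crossing a b c d \<Rightarrow> jn (d, a) (jn (b, c) s))"

lemma resolution_apply_joins:
  assumes "i < length xs"
  shows "A_resolution (apply_joins s xs) i = apply_joins (jnA (xs ! i) s) (take i xs @ drop (Suc i) xs)"
    and "B_resolution (apply_joins s xs) i = apply_joins (jnB (xs ! i) s) (take i xs @ drop (Suc i) xs)"
proof -
  obtain f n where s: "s = (f, n)" by (cases s)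
  obtain a b c d where x: "xs ! i = Crossing a b c d" by (cases "xs ! i")
  have r: "remove_crossing (apply_joins s xs) i = apply_joins (f, n) (take i xs @ drop (Suc i) xs)"
    by (simp add: remove_crossing_def s take_map drop_map)
  have n: "crossings (apply_joins s xs) ! i = Crossing (f a) (f b) (f c) (f d)"
    using assms x by (simp add: s)
  show "A_resolution (apply_joins s xs) i = apply_joins (jnA (xs ! i) s) (take i xs @ drop (Suc i) xs)"
    unfolding A_resolution_def n crossing.case r join2_apply_joins by (simp add: jnA_def x s)
  show "B_resolution (apply_joins s xs) i = apply_joins (jnB (xs ! i) s) (take i xs @ drop (Suc i) xs)"
    unfolding B_resolution_def n crossing.case r join2_apply_joins by (simp add: jnB_def x s)
qed

lemma apply_joins_id: "apply_joins (id, n) xs = Diagram xs n"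
  by (simp add: crossing.map_id0)

lemma bracket_Cons:
  "bracket (apply_joins s (x # xs)) =
     A_pow 1 * bracket (apply_joins (jnA x s) xs) + A_pow (-1) * bracket (apply_joins (jnB x s) xs)"
proof -
  have "crossings (apply_joins s (x # xs)) \<noteq> []" by (cases s) simp
  then show ?thesis
    using resolution_apply_joins[of 0 "x # xs" s]
    by (subst bracket.simps) simp
qed

lemma same_joins_jnAB:
  assumes "same_joins s t"
  shows "same_joins (jnA x s) (jnA x t)" "same_joins (jnB x s) (jnB x t)"
  using assms by (cases x; simp add: jnA_def jnB_def same_joins_jn)+

lemma bracket_same_joins:
  "same_joins s t \<Longrightarrow> bracket (apply_joins s xs) = bracket (apply_joins t xs)"
proof (induction xs arbitrary: s t)
  case Nil
  then show ?case by (cases s; cases t) simp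
next
  case (Cons x xs)
  show ?case
    unfolding bracket_Cons
    using Cons.IH[OF same_joins_jnAB(1)[OF Cons.prems]]
      Cons.IH[OF same_joins_jnAB(2)[OF Cons.prems]] by simp
qed

lemma jn_commute2:
  "same_joins (jn p (jn q (jn p' (jn q' s)))) (jn p' (jn q' (jn p (jn q s))))"
proof -
  have "same_joins (jn p (jn q (jn p' (jn q' s)))) (jn p (jn p' (jn q (jn q' s))))"
    by (intro same_joins_jn jn_commute)
  moreover have "same_joins (jn p (jn p' (jn q (jn q' s)))) (jn p (jn p' (jn q' (jn q s))))"
    by (intro same_joins_jn jn_commute)
  moreover have "same_joins (jn p (jn p' (jn q' (jn q s)))) (jn p' (jn p (jn q' (jn q s))))"
    by (rule jn_commute)
  moreover have "same_joins (jn p' (jn p (jn q' (jn q s)))) (jn p' (jn q' (jn p (jn q s))))"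
    by (intro same_joins_jn jn_commute)
  ultimately show ?thesis by (blast intro: same_joins_trans)
qed

lemma jnAB_commute:
  "same_joins (jnA x (jnA y s)) (jnA y (jnA x s))"
  "same_joins (jnA x (jnB y s)) (jnB y (jnA x s))"
  "same_joins (jnB x (jnA y s)) (jnA y (jnB x s))"
  "same_joins (jnB x (jnB y s)) (jnB y (jnB x s))"
  by (cases x; cases y; simp add: jnA_def jnB_def jn_commute2)+

lemma bracket_skein_joins:
  "i < length xs \<Longrightarrow> bracket (apply_joins s xs) =
     A_pow 1 * bracket (apply_joins (jnA (xs ! i) s) (take i xs @ drop (Suc i) xs)) +
     A_pow (-1) * bracket (apply_joins (jnB (xs ! i) s) (take i xs @ drop (Suc i) xs))"
proof (induction xs arbitrary: i s)
  case Nil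
  then show ?case by simp
next
  case (Cons x xs)
  show ?case
  proof (cases i)
    case 0
    then show ?thesis by (simp add: bracket_Cons)
  next
    case (Suc j)
    with Cons.prems have j: "j < length xs" by simp
    let ?y = "xs ! j" and ?ys = "take j xs @ drop (Suc j) xs"
    have "(x # xs) ! i = ?y" "take i (x # xs) @ drop (Suc i) (x # xs) = x # ?ys"
      by (simp_all add: Suc)
    then show ?thesis
      unfolding bracket_Cons Cons.IH[OF j]
      using jnAB_commute[of x ?y s, THEN bracket_same_joins, of ?ys]
      by (simp only: bracket_Cons distrib_left mult.left_commute mult.assoc) (simp add: algebra_simps)
  qed
qed

theorem bracket_skein:
  assumes "i < num_crossings D"
  shows "bracket D = A_pow 1 * bracket (A_resolution D i) + A_pow (-1) * bracket (B_resolution D i)"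
proof -
  obtain xs n where D: "D = apply_joins (id, n) xs"
    by (cases D) (metis apply_joins_id)
  with assms have i: "i < length xs" by simp
  show ?thesis
    unfolding D resolution_apply_joins[OF i] by (rule bracket_skein_joins[OF i])
qed


subsection \<open>Removing a circle\<close>

definition even_labels :: "'a crossing list \<Rightarrow> bool" where
  "even_labels xs \<longleftrightarrow> (\<forall>a. even (count_list (arc_labels xs) a))"

lemma arc_labels_map: "arc_labels (map (map_crossing f) xs) = map f (arc_labels xs)"
proof -
  have "arc_ends (map_crossing f x) = map f (arc_ends x)" for x
    by (cases x) simp
  then show ?thesis by (simp add: arc_labels_def map_concat o_def)
qed

lemma count_list_rename:
  "count_list (map (id(b := a)) l) y =
     (if a = b then count_list l y else if y = a then count_list l a + count_list l b
      else if y = b then 0 else count_list l y)"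
  by (induction l) auto

lemma join2_even:
  assumes "\<forall>y. even (count_list ([a, b, c, d] @ arc_labels xs) y)"
  shows "even_labels (crossings (join2 a b c d (Diagram xs n)))"
    and "xs = [] \<Longrightarrow> circles (join2 a b c d (Diagram xs n)) > 0"
proof -
  let ?f = "id(b := a)"
  let ?l = "map ?f (arc_labels xs)"
  have step: "\<forall>y. even (count_list (map (id(q := p)) l) y)"
    if "\<forall>y. even (count_list ([p, q] @ l) y)" for p q :: 'a and l
  proof
    fix y
    show "even (count_list (map (id(q := p)) l) y)"
      using spec[OF that, of p] spec[OF that, of q] spec[OF that, of y]
      unfolding count_list_rename by (auto split: if_splits)
  qed
  have 1: "\<forall>y. even (count_list ([?f c, ?f d] @ ?l) y)"
    using step[of a b "[c, d] @ arc_labels xs"] assms by simp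
  have 2: "\<forall>y. even (count_list (map (id(?f d := ?f c)) ?l) y)"
    using step[of "?f c" "?f d" ?l] 1 by blast
  have "join2 a b c d (Diagram xs n) =
    Diagram (map (map_crossing (id(?f d := ?f c))) (map (map_crossing ?f) xs))
      (n + (if a = b then 1 else 0) + (if ?f c = ?f d then 1 else 0))"
    unfolding join2_def join_eq by simp
  note J = this
  show "even_labels (crossings (join2 a b c d (Diagram xs n)))"
    unfolding J even_labels_def diagram.sel arc_labels_map using 2 by simp
  show "circles (join2 a b c d (Diagram xs n)) > 0" if "xs = []"
  proof -
    have "?f c = ?f d"
      using spec[OF 1, of "?f c"] that by (auto simp: arc_labels_def split: if_splits)
    then show ?thesis unfolding J by simp
  qed
qed

lemma join_add_circle: "join a b (add_circle D) = add_circle (join a b D)"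
  by (cases D) (simp add: add_circle_def)

lemma resolution_add_circle:
  "A_resolution (add_circle D) i = add_circle (A_resolution D i)"
  "B_resolution (add_circle D) i = add_circle (B_resolution D i)"
proof -
  have 1: "crossings (add_circle D) = crossings D"
    by (simp add: add_circle_def)
  have 2: "remove_crossing (add_circle D) i = add_circle (remove_crossing D i)"
    by (simp add: add_circle_def remove_crossing_def)
  show "A_resolution (add_circle D) i = add_circle (A_resolution D i)"
    "B_resolution (add_circle D) i = add_circle (B_resolution D i)"
    by (cases "crossings D ! i";
        simp add: A_resolution_def B_resolution_def 1 2 join2_def join_add_circle)+
qed

lemma bracket_add_circle_even:
  "even_labels (crossings D) \<Longrightarrow> crossings D \<noteq> [] \<or> circles D > 0 \<Longrightarrow>
     bracket (add_circle D) = (- A_pow 2 - A_pow (-2)) * bracket D"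
proof (induction "num_crossings D" arbitrary: D)
  case 0
  then have "crossings D = []" "circles D > 0" by auto
  then show ?case
    unfolding bracket.simps[of D] bracket.simps[of "add_circle D"]
    by (simp add: add_circle_def flip: power_Suc)
next
  case (Suc k)
  obtain a b c d xs n where D: "D = Diagram (Crossing a b c d # xs) n"
    using Suc.hyps(2) by (cases D; cases "crossings D"; cases "hd (crossings D)") auto
  have A: "A_resolution D 0 = join2 a b c d (Diagram xs n)"
    and B: "B_resolution D 0 = join2 b c d a (Diagram xs n)"
    by (simp_all add: D A_resolution_def B_resolution_def remove_crossing_def)
  have ev: "\<forall>y. even (count_list ([a, b, c, d] @ arc_labels xs) y)"
    using Suc.prems(1) by (simp add: D even_labels_def arc_labels_def)
  have ev': "\<forall>y. even (count_list ([b, c, d, a] @ arc_labels xs) y)"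
  proof
    fix y
    have "count_list ([b, c, d, a] @ arc_labels xs) y = count_list ([a, b, c, d] @ arc_labels xs) y"
      by simp
    then show "even (count_list ([b, c, d, a] @ arc_labels xs) y)" using ev by metis
  qed
  have k: "num_crossings (A_resolution D 0) = k" "num_crossings (B_resolution D 0) = k" "length xs = k"
    using Suc.hyps(2) by (simp_all add: num_crossings_resolution D)
  have "crossings (A_resolution D 0) \<noteq> [] \<or> circles (A_resolution D 0) > 0"
    using join2_even(2)[OF ev, of n] k unfolding A by (cases "xs = []") auto
  then have IA: "bracket (add_circle (A_resolution D 0)) = (- A_pow 2 - A_pow (-2)) * bracket (A_resolution D 0)"
    using Suc.hyps(1)[of "A_resolution D 0"] join2_even(1)[OF ev, of n] k unfolding A by simp
  have "crossings (B_resolution D 0) \<noteq> [] \<or> circles (B_resolution D 0) > 0"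
    using join2_even(2)[OF ev', of n] k unfolding B by (cases "xs = []") auto
  then have IB: "bracket (add_circle (B_resolution D 0)) = (- A_pow 2 - A_pow (-2)) * bracket (B_resolution D 0)"
    using Suc.hyps(1)[of "B_resolution D 0"] join2_even(1)[OF ev', of n] k unfolding B by simp
  have i: "0 < num_crossings D" "0 < num_crossings (add_circle D)"
    by (simp_all add: D add_circle_def)
  show ?case
    unfolding bracket_skein[OF i(1)] bracket_skein[OF i(2)] resolution_add_circle IA IB
    by (simp only: distrib_left mult.left_commute)
qed

theorem bracket_add_circle:
  assumes "well_formed D" and "crossings D \<noteq> [] \<or> circles D > 0"
  shows "bracket (add_circle D) = (- A_pow 2 - A_pow (-2)) * bracket D"
proof (rule bracket_add_circle_even[OF _ assms(2)])
  show "even_labels (crossings D)"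
    unfolding even_labels_def
  proof
    fix a
    show "even (count_list (arc_labels (crossings D)) a)"
      using assms(1) by (cases "a \<in> set (arc_labels (crossings D))") (auto simp: well_formed_def)
  qed
qed


section \<open>Graphs\<close>

text \<open>Undirected multigraphs; a loop is an edge whose set of endpoints is a singleton.\<close>

record ('v, 'e) multigraph =
  verts :: "'v set"
  edges :: "'e set"
  endpoints :: "'e \<Rightarrow> 'v set"

definition is_loop :: "('v, 'e) multigraph \<Rightarrow> 'e \<Rightarrow> bool" where
  "is_loop G e \<longleftrightarrow> e \<in> edges G \<and> card (endpoints G e) = 1"

type_synonym 'v simple_graph = "'v set \<times> 'v set set"

definition simplification :: "('v, 'e) multigraph \<Rightarrow> 'v simple_graph" where
  "simplification G = (verts G, endpoints G ` {e \<in> edges G. \<not> is_loop G e})"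

definition from_multiple :: "('v, 'e) multigraph \<Rightarrow> 'v set \<Rightarrow> bool" where
  "from_multiple G f \<longleftrightarrow> card {e \<in> edges G. endpoints G e = f} \<ge> 2"

text \<open>Paths of length \<open>n\<close> from \<open>u\<close> to \<open>w\<close>, as lists of their vertices.\<close>

definition paths :: "'v simple_graph \<Rightarrow> nat \<Rightarrow> 'v \<Rightarrow> 'v \<Rightarrow> 'v list set" where
  "paths H n u w = {p. length p = Suc n \<and> distinct p \<and> set p \<subseteq> fst H \<and>
     hd p = u \<and> last p = w \<and> (\<forall>i < n. {p ! i, p ! Suc i} \<in> snd H)}"

definition path_edges :: "'v list \<Rightarrow> 'v set set" where
  "path_edges p = {{p ! i, p ! Suc i} | i. Suc i < length p}"

definition subgraph :: "'v simple_graph \<Rightarrow> 'v simple_graph \<Rightarrow> bool" where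
  "subgraph K H \<longleftrightarrow> fst K \<subseteq> fst H \<and> snd K \<subseteq> snd H \<and> (\<forall>f \<in> snd K. f \<subseteq> fst K)"

definition isomorphic :: "'v simple_graph \<Rightarrow> 'w simple_graph \<Rightarrow> bool" where
  "isomorphic H K \<longleftrightarrow> (\<exists>f. bij_betw f (fst H) (fst K) \<and> snd K = (\<lambda>e. f ` e) ` snd H)"

definition complete_graph :: "nat \<Rightarrow> nat simple_graph" where
  "complete_graph n = ({..<n}, {f. f \<subseteq> {..<n} \<and> card f = 2})"

definition num_v :: "('v, 'e) multigraph \<Rightarrow> nat" where
  "num_v G = card (fst (simplification G))"

definition num_e :: "('v, 'e) multigraph \<Rightarrow> nat" where
  "num_e G = card (snd (simplification G))"

definition beta1 :: "('v, 'e) multigraph \<Rightarrow> int" where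
  "beta1 G = int (num_e G) - int (num_v G) + 1"

definition num_P :: "('v, 'e) multigraph \<Rightarrow> 'v \<Rightarrow> 'v \<Rightarrow> nat" where
  "num_P G u w = card (paths (simplification G) 2 u w)"

definition num_Pi :: "nat \<Rightarrow> ('v, 'e) multigraph \<Rightarrow> 'v \<Rightarrow> 'v \<Rightarrow> nat" where
  "num_Pi i G u w = card {p \<in> paths (simplification G) 2 u w.
     card {f \<in> path_edges p. from_multiple G f} = i}"

definition num_Q :: "('v, 'e) multigraph \<Rightarrow> 'v \<Rightarrow> 'v \<Rightarrow> nat" where
  "num_Q G u w = card {p \<in> paths (simplification G) 3 u w. \<forall>x \<in> set p - {u, w}.
     \<not> ({x, u} \<in> snd (simplification G) \<and> {x, w} \<in> snd (simplification G))}"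

definition num_S :: "('v, 'e) multigraph \<Rightarrow> 'v \<Rightarrow> 'v \<Rightarrow> nat" where
  "num_S G u w = card {K. subgraph K (simplification G) \<and> u \<in> fst K \<and> w \<in> fst K \<and>
     isomorphic K (complete_graph 4)}"


section \<open>Checkerboard graphs\<close>

text \<open>
  A shading is a set of regions such that exactly one of the two regions on the sides of each arc
  is shaded; the sides of an arc at its end \<open>(i, k)\<close> are the corners \<open>(i, k)\<close> and
  \<open>(i, k - 1)\<close>.
\<close>

definition checkerboard_shading :: "'a diagram \<Rightarrow> region set \<Rightarrow> bool" where
  "checkerboard_shading D sh \<longleftrightarrow> sh \<subseteq> regions D \<and>
     (\<forall>(i, k) \<in> darts D. region_at D (i, k) \<in> sh \<longleftrightarrow> region_at D (i, (k + 3) mod 4) \<notin> sh)"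

text \<open>
  For a shading \<open>sh\<close>, the two checkerboard graphs are obtained from the two colour
  classes \<open>sh\<close> and \<open>regions D - sh\<close>. Edges are the indices of the crossings.
\<close>

definition checkerboard_graph :: "'a diagram \<Rightarrow> region set \<Rightarrow> (region, nat) multigraph" where
  "checkerboard_graph D R = \<lparr>verts = R, edges = {..<num_crossings D},
     endpoints = (\<lambda>i. {region_at D (i, k) | k. k < 4} \<inter> R)\<rparr>"

text \<open>
  The A-edges join the regions at corners 0 and 2, which the B-resolution merges; the B-edges
  join those at corners 1 and 3.
\<close>

definition A_edge :: "'a diagram \<Rightarrow> region set \<Rightarrow> nat \<Rightarrow> bool" where
  "A_edge D R i \<longleftrightarrow> region_at D (i, 0) \<in> R \<and> region_at D (i, 2) \<in> R"

definition B_edge :: "'a diagram \<Rightarrow> region set \<Rightarrow> nat \<Rightarrow> bool" where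
  "B_edge D R i \<longleftrightarrow> region_at D (i, 1) \<in> R \<and> region_at D (i, 3) \<in> R"

lemma A_edge_imp_B_edge:
  assumes "checkerboard_shading D sh" "i < num_crossings D" "A_edge D sh i"
  shows "B_edge D (regions D - sh) i"
proof -
  have d: "(i, 0) \<in> darts D" "(i, 1) \<in> darts D" "(i, 3) \<in> darts D"
    using assms(2) by (simp_all add: darts_def)
  have "region_at D (i, k) \<in> sh \<longleftrightarrow> region_at D (i, (k + 3) mod 4) \<notin> sh"
    if "(i, k) \<in> darts D" for k
    using assms(1) that unfolding checkerboard_shading_def by blast
  from this[OF d(1)] this[OF d(2)] d assms(3) show ?thesis
    by (simp add: A_edge_def B_edge_def regions_def)
qed

text \<open>
  An almost alternating diagram has a shading whose checkerboard graph consists of A-edges apart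
  from the edge of the dealternator.
\<close>

lemma finite_darts: "finite (darts D)"
  by (simp add: darts_def)

lemma arc_count: "count_list (arc_labels xs) a = sum_list (map (\<lambda>x. count_list (arc_ends x) a) xs)"
  by (induction xs) (simp_all add: arc_labels_def)

lemma card_darts_label:
  "card {x \<in> darts D. dart_label D x = a} = count_list (arc_labels (crossings D)) a"
proof -
  let ?xs = "crossings D"
  have len: "length (arc_ends x) = 4" for x :: "'a crossing"
    by (cases x) simp
  have "{x \<in> darts D. dart_label D x = a} =
      Sigma {..<length ?xs} (\<lambda>i. {k. k < 4 \<and> arc_ends (?xs ! i) ! k = a})"
    by (auto simp: darts_def dart_label_def)
  then have "card {x \<in> darts D. dart_label D x = a} =
      (\<Sum>i<length ?xs. card {k. k < 4 \<and> arc_ends (?xs ! i) ! k = a})"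
    by simp
  also have "\<dots> = (\<Sum>i<length ?xs. count_list (arc_ends (?xs ! i)) a)"
    by (simp add: count_list_eq_length_filter length_filter_conv_card len eq_commute)
  also have "\<dots> = sum_list (map (\<lambda>x. count_list (arc_ends x) a) ?xs)"
    by (simp add: sum_list_sum_nth atLeast0LessThan)
  also have "\<dots> = count_list (arc_labels ?xs) a"
    by (rule arc_count [symmetric])
  finally show ?thesis .
qed

lemma mate_dart:
  assumes "well_formed D" "x \<in> darts D"
  shows "mate D x \<in> darts D" "mate D x \<noteq> x" "dart_label D (mate D x) = dart_label D x"
proof -
  let ?S = "{y \<in> darts D. dart_label D y = dart_label D x}"
  have xS: "x \<in> ?S" using assms(2) by simp
  moreover have "finite ?S" using finite_darts[of D] by simp
  ultimately have "card ?S \<noteq> 0" by (metis card_0_eq empty_iff)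
  then have "card ?S = 2"
    using assms(1) unfolding card_darts_label well_formed_def by (metis count_list_0_iff)
  then obtain p q where pq: "p \<noteq> q" "?S = {p, q}" by (auto simp: card_2_iff)
  define z where "z = (if x = p then q else p)"
  have z: "z \<in> ?S" "z \<noteq> x" "\<And>y. y \<in> ?S \<Longrightarrow> y \<noteq> x \<Longrightarrow> y = z"
    using xS pq(1) unfolding pq(2) z_def by auto
  have "\<exists>!y. y \<in> darts D \<and> y \<noteq> x \<and> dart_label D y = dart_label D x"
  proof (rule ex1I[of _ z])
    show "z \<in> darts D \<and> z \<noteq> x \<and> dart_label D z = dart_label D x"
      using z(1,2) by blast
  qed (use z(3) in blast)
  from theI'[OF this] show "mate D x \<in> darts D" "mate D x \<noteq> x"
    "dart_label D (mate D x) = dart_label D x"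
    unfolding mate_def by auto
qed

lemma less_4_cases: "k < (4 :: nat) \<longleftrightarrow> k = 0 \<or> k = 1 \<or> k = 2 \<or> k = 3"
  by auto

lemma almost_alternating_mate:
  assumes "well_formed D" "almost_alternating D d" "(i, k) \<in> darts D" "mate D (i, k) = (j, l)"
  shows "(even k = (i = d)) \<longleftrightarrow> (even l \<noteq> (j = d))"
proof -
  define t :: "nat \<times> nat \<Rightarrow> nat \<times> nat" where
    "t x = (if fst x = d then (d, (snd x + 3) mod 4) else x)" for x
  have m: "(j, l) \<in> darts D" "(j, l) \<noteq> (i, k)" "dart_label D (j, l) = dart_label D (i, k)"
    using mate_dart[OF assms(1,3)] assms(4) by auto
  have t1: "t x \<in> darts (change_crossing D d)" if "x \<in> darts D" for x
    using that by (auto simp: t_def darts_def change_crossing_def)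
  have t2: "dart_label (change_crossing D d) (t x) = dart_label D x" if "x \<in> darts D" for x
  proof (cases "fst x = d")
    case True
    obtain a b c e where X: "crossings D ! d = Crossing a b c e" by (cases "crossings D ! d")
    have "d < num_crossings D" "snd x < 4" using that True by (auto simp: darts_def)
    then show ?thesis
      using True X unfolding less_4_cases
      by (auto simp: t_def change_crossing_def dart_label_def)
  next
    case False
    then show ?thesis by (simp add: t_def change_crossing_def dart_label_def)
  qed
  have t3: "t (i, k) \<noteq> t (j, l)"
  proof
    assume "t (i, k) = t (j, l)"
    then have "i = j" "k = l \<or> (k + 3) mod 4 = (l + 3) mod 4"
      by (auto simp: t_def split: if_splits)
    moreover have "k < 4" "l < 4" using m(1) assms(3) by (auto simp: darts_def)
    ultimately show False using m(2) unfolding less_4_cases by auto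
  qed
  have "alternating (change_crossing D d)"
    using assms(2) by (simp add: almost_alternating_def)
  moreover have "dart_label (change_crossing D d) (t (i, k)) = dart_label (change_crossing D d) (t (j, l))"
    by (simp only: t2[OF assms(3)] t2[OF m(1)] m(3))
  ultimately have "even (snd (t (i, k))) \<longleftrightarrow> odd (snd (t (j, l)))"
    using t1[OF assms(3)] t1[OF m(1)] t3 unfolding alternating_def by blast
  moreover have par: "even ((n + 3) mod 4) \<longleftrightarrow> odd n" for n :: nat
    by presburger
  ultimately show ?thesis by (auto simp: t_def par split: if_splits)
qed

theorem exists_checkerboard_shading:
  assumes "well_formed D" "almost_alternating D d"
  shows "\<exists>sh. checkerboard_shading D sh \<and>
    (\<forall>i < num_crossings D. i \<noteq> d \<longrightarrow> A_edge D sh i)"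
proof -
  define col where "col x \<longleftrightarrow> (even (snd x) \<noteq> (fst x = d))" for x :: "nat \<times> nat"
  define sh where "sh = region_at D ` {x \<in> darts D. col x}"
  have par: "even ((n + 3) mod 4) \<longleftrightarrow> odd n" for n :: nat
    by presburger
  have nc: "next_corner D x \<in> darts D \<and> (col (next_corner D x) \<longleftrightarrow> col x)" if "x \<in> darts D" for x
  proof -
    obtain i k where x: "x = (i, k)" by (cases x)
    obtain j l where y: "mate D (i, k) = (j, l)" by (cases "mate D (i, k)")
    have "(j, l) \<in> darts D" using mate_dart(1)[OF assms(1) that] x y by simp
    then have "(j, (l + 3) mod 4) \<in> darts D" by (auto simp: darts_def)
    moreover have "col (j, (l + 3) mod 4) \<longleftrightarrow> col (i, k)"
      using almost_alternating_mate[OF assms, of i k j l] that x y par[of l]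
      unfolding col_def by auto
    ultimately show ?thesis by (simp add: next_corner_def x y)
  qed
  have orb: "y \<in> darts D \<and> (col y \<longleftrightarrow> col x)" if "y \<in> region_at D x" "x \<in> darts D" for x y
    using that(1) unfolding region_at_def
    by (induction rule: orbit.induct) (use nc that(2) in auto)
  have iff: "region_at D x \<in> sh \<longleftrightarrow> col x" if "x \<in> darts D" for x
  proof
    assume "region_at D x \<in> sh"
    then obtain y where "y \<in> darts D" "col y" "region_at D x = region_at D y"
      by (auto simp: sh_def)
    moreover have "next_corner D x \<in> region_at D x"
      by (simp add: region_at_def orbit.base)
    ultimately show "col x" using orb nc[OF that] by metis
  qed (use that in \<open>auto simp: sh_def\<close>)
  have "checkerboard_shading D sh"
    unfolding checkerboard_shading_def
  proof (intro conjI ballI)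
    show "sh \<subseteq> regions D" by (auto simp: sh_def regions_def)
    fix x assume x: "x \<in> darts D"
    obtain i k where ik: "x = (i, k)" by (cases x)
    have "(i, (k + 3) mod 4) \<in> darts D" using x ik by (auto simp: darts_def)
    then show "case x of (i, k) \<Rightarrow>
        (region_at D (i, k) \<in> sh) = (region_at D (i, (k + 3) mod 4) \<notin> sh)"
      using x ik par[of k] by (auto simp: iff col_def)
  qed
  moreover have "A_edge D sh i" if "i < num_crossings D" "i \<noteq> d" for i
  proof -
    have "(i, 0) \<in> darts D" "(i, 2) \<in> darts D" using that by (auto simp: darts_def)
    then show ?thesis unfolding A_edge_def using that(2) by (auto simp: iff col_def)
  qed
  ultimately show ?thesis by blast
qed

text \<open>
  \<open>G\<close> and \<open>H\<close> stand for the two checkerboard graphs, \<open>d\<close> for the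
  dealternator.
\<close>

definition strongly_reduced ::
  "('v, nat) multigraph \<Rightarrow> ('v, nat) multigraph \<Rightarrow> nat \<Rightarrow> 'v \<Rightarrow> 'v \<Rightarrow> 'v \<Rightarrow> 'v \<Rightarrow> bool" where
  "strongly_reduced G H d u1 u2 v1 v2 \<longleftrightarrow>
     u1 \<noteq> u2 \<and> v1 \<noteq> v2 \<and>
     {e \<in> edges G. endpoints G e = {u1, u2}} = {d} \<and>
     {e \<in> edges H. endpoints H e = {v1, v2}} = {d} \<and>
     (\<forall>e. \<not> is_loop G e) \<and> (\<forall>e. \<not> is_loop H e)"

end

theory Submission
  imports Defs
begin

text \<open>
  Let \<open>G\<close> be one of the two checkerboard graphs, with \<open>v\<close> vertices. A state of the
  diagram selects at each crossing whether the two regions joined by its edge are merged, so states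
  correspond to sets \<open>H\<close> of edges of \<open>G\<close>. The bracket is a sum over states of
  \<open>A\<close>-powers times \<open>\<delta>\<close> to the number of circles minus one, where
  \<open>\<delta> = - A\<^sup>2 - A\<^sup>-\<^sup>2\<close>. In a planar diagram the state of \<open>H\<close> has
  \<open>2 k(H) + |H| - v\<close> circles, where \<open>k(H)\<close> is the number of components of the
  spanning subgraph \<open>H\<close> (\<open>circles_of_state\<close>). This expression minus the number of circles never
  decreases when an edge is added to \<open>H\<close>, and it vanishes for the empty set and, by Euler's
  formula, for the set of all edges.

  Now pair \<open>X\<close> with \<open>X \<union> {d}\<close>, where \<open>d\<close> is the dealternator and
  \<open>X\<close> a set of other edges, and let \<open>r(X) = v - k(X)\<close> be the rank. The sum of the two terms is,
  up to sign, a power of \<open>1 + t\<close>, \<open>t = A\<^sup>-\<^sup>4\<close>, times the top power of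
  \<open>A\<close> times \<open>t ^ (r(X) - 2)\<close> or \<open>t ^ r(X)\<close>, depending on whether \<open>X\<close>
  connects the ends \<open>u1\<close>, \<open>u2\<close> of \<open>d\<close> or not (\<open>joined_term\<close>,
  \<open>unjoined_term\<close>). Hence the two extreme coefficients only involve the sums of
  \<open>(-1) ^ |X|\<close>, possibly weighted by \<open>|X|\<close>, over the sets \<open>X\<close> of rank at most 1
  and over the sets of rank 2 or 3 that connect \<open>u1\<close> and \<open>u2\<close>.

  These sums come from the contraction of \<open>G\<close> along \<open>d\<close>: contraction lowers the rank
  of \<open>X\<close> by one precisely if \<open>X\<close> connects \<open>u1\<close> and \<open>u2\<close>, so the sum over the
  connecting sets of rank \<open>k + 1\<close> is obtained from the one of rank \<open>k\<close> and the
  full sums of rank \<open>k\<close> of the contraction and of \<open>G\<close> without \<open>d\<close>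
  (\<open>joined_sum_Suc\<close>). The full sums of rank at most 2 are the leading coefficients of the
  chromatic polynomial, \<open>1\<close>, \<open>- e\<close> and \<open>e choose 2\<close> minus the number of triangles
  (\<open>alt_sum_rank\<close>). Contraction identifies \<open>P\<close> pairs of edges; it creates a triangle for each
  path counted by \<open>Q\<close> and identifies two triangles for each \<open>K\<^sub>4\<close> counted by \<open>S\<close>.
  The sums weighted by \<open>|X|\<close> only see the edges without parallels, which brings in the numbers of
  paths with two and with no edges from multiple edges.

  The other checkerboard graph gives the same expansion with \<open>A\<close> and \<open>A\<^sup>-\<^sup>1\<close>
  exchanged. It supplies the coefficients at the other end, and the two expansions together
  confine the exponents to the stated range.
\<close>

section \<open>Connected components of a relation\<close>

text \<open>
  The equivalence relation generated by \<open>R\<close>, on the whole type, and the number of its classes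
  that meet \<open>V\<close>.
\<close>

definition conn :: "('a \<times> 'a) set \<Rightarrow> ('a \<times> 'a) set" where
  "conn R = (R \<union> R\<inverse>)\<^sup>*"

definition comps :: "'a set \<Rightarrow> ('a \<times> 'a) set \<Rightarrow> nat" where
  "comps V R = card ((\<lambda>x. conn R `` {x}) ` V)"

lemma conn_refl [simp, intro]: "(x, x) \<in> conn R"
  by (simp add: conn_def)

lemma conn_sym: "(x, y) \<in> conn R \<Longrightarrow> (y, x) \<in> conn R"
  unfolding conn_def
  by (metis converse_Un converse_converse rtrancl_converseI sup_commute)

lemma conn_trans: "(x, y) \<in> conn R \<Longrightarrow> (y, z) \<in> conn R \<Longrightarrow> (x, z) \<in> conn R"
  unfolding conn_def by (rule rtrancl_trans)

lemma conn_base: "(x, y) \<in> R \<Longrightarrow> (x, y) \<in> conn R"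
  by (auto simp: conn_def)

lemma conn_mono: "R \<subseteq> S \<Longrightarrow> conn R \<subseteq> conn S"
  unfolding conn_def by (intro rtrancl_mono) auto

lemma conn_least:
  assumes "(x, y) \<in> conn R"
    and "\<And>x y. (x, y) \<in> R \<Longrightarrow> E x y"
    and "\<And>x. E x x" "\<And>x y. E x y \<Longrightarrow> E y x" "\<And>x y z. E x y \<Longrightarrow> E y z \<Longrightarrow> E x z"
  shows "E x y"
  using assms(1) unfolding conn_def
proof (induction rule: rtrancl_induct)
  case base
  then show ?case by (rule assms(3))
next
  case (step y z)
  then have "E y z" using assms(2,4) by blast
  with step.IH show ?case by (rule assms(5))
qed

lemma conn_empty: "(x, y) \<in> conn {} \<longleftrightarrow> x = y"
  by (simp add: conn_def)

lemma conn_insert: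
  "(x, y) \<in> conn (insert (a, b) R) \<longleftrightarrow>
     (x, y) \<in> conn R \<or> (x, a) \<in> conn R \<and> (b, y) \<in> conn R \<or> (x, b) \<in> conn R \<and> (a, y) \<in> conn R"
  (is "?L \<longleftrightarrow> ?E x y")
proof
  assume ?L
  then show "?E x y"
  proof (rule conn_least[where E = ?E])
    fix x y assume "(x, y) \<in> insert (a, b) R"
    then show "?E x y" using conn_base[of x y R] by auto
  next
    fix x y assume "?E x y"
    then show "?E y x" by (metis conn_sym)
  next
    fix x y z assume "?E x y" "?E y z"
    then show "?E x z" by (metis conn_sym conn_trans)
  qed simp
next
  have 1: "conn R \<subseteq> conn (insert (a, b) R)" by (rule conn_mono) auto
  have 2: "(a, b) \<in> conn (insert (a, b) R)" by (rule conn_base) simp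
  assume "?E x y"
  then show ?L
    using 1 2 by (meson conn_sym conn_trans subsetD)
qed

lemma conn_class_eq: "conn R `` {x} = conn R `` {y} \<longleftrightarrow> (x, y) \<in> conn R"
proof
  assume "conn R `` {x} = conn R `` {y}"
  then have "y \<in> conn R `` {x}" by simp
  then show "(x, y) \<in> conn R" by simp
next
  assume "(x, y) \<in> conn R"
  then show "conn R `` {x} = conn R `` {y}"
    by (auto intro: conn_trans conn_sym)
qed

lemma card_image_cong:
  assumes "\<And>x y. x \<in> V \<Longrightarrow> y \<in> V \<Longrightarrow> f x = f y \<longleftrightarrow> g x = g y"
  shows "card (f ` V) = card (g ` V)"
proof (rule bij_betw_same_card[of "\<lambda>z. g (SOME x. x \<in> V \<and> f x = z)"])
  have s: "g (SOME y. y \<in> V \<and> f y = f x) = g x" if "x \<in> V" for x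
    using someI[of "\<lambda>y. y \<in> V \<and> f y = f x" x] that assms by blast
  show "bij_betw (\<lambda>z. g (SOME x. x \<in> V \<and> f x = z)) (f ` V) (g ` V)"
    unfolding bij_betw_def inj_on_def using s assms by (auto simp: image_iff)
qed

lemma comps_eqI:
  assumes "\<And>x y. x \<in> V \<Longrightarrow> y \<in> V \<Longrightarrow> (x, y) \<in> conn R \<longleftrightarrow> f x = f y"
  shows "comps V R = card (f ` V)"
  unfolding comps_def by (rule card_image_cong) (simp add: conn_class_eq assms)

lemma comps_cong:
  assumes "\<And>x y. x \<in> V \<Longrightarrow> y \<in> V \<Longrightarrow> (x, y) \<in> conn R \<longleftrightarrow> (x, y) \<in> conn S"
  shows "comps V R = comps V S"
  unfolding comps_def by (rule card_image_cong) (simp add: conn_class_eq assms)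

lemma comps_empty: "comps V {} = card V"
  using comps_eqI[of V "{}" "\<lambda>x. x"] by (simp add: conn_empty)

lemma comps_pos: "finite V \<Longrightarrow> V \<noteq> {} \<Longrightarrow> comps V R > 0"
  by (simp add: comps_def card_gt_0_iff)

lemma comps_le: "finite V \<Longrightarrow> comps V R \<le> card V"
  by (simp add: comps_def card_image_le)

lemma comps_insert_same: "(a, b) \<in> conn R \<Longrightarrow> comps V (insert (a, b) R) = comps V R"
  by (rule comps_cong) (metis conn_insert conn_sym conn_trans)

text \<open>
  Joining \<open>a\<close> and \<open>b\<close> amounts to replacing the class of \<open>b\<close> by that of \<open>a\<close>.
\<close>

lemma comps_insert_diff:
  assumes "finite V" "a \<in> V" "b \<in> V" "(a, b) \<notin> conn R"
  shows "comps V R = Suc (comps V (insert (a, b) R))"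
proof -
  define q where "q x = conn R `` {x}" for x
  have q: "q x = q y \<longleftrightarrow> (x, y) \<in> conn R" for x y
    by (simp add: q_def conn_class_eq)
  have "comps V (insert (a, b) R) = card ((\<lambda>x. if q x = q b then q a else q x) ` V)"
  proof (rule comps_eqI)
    fix x y
    show "(x, y) \<in> conn (insert (a, b) R) \<longleftrightarrow>
        (if q x = q b then q a else q x) = (if q y = q b then q a else q y)"
      using assms(4) unfolding conn_insert q[symmetric] by auto
  qed
  also have "(\<lambda>x. if q x = q b then q a else q x) ` V = q ` V - {q b}"
    using assms(2,4) unfolding q[symmetric] by auto
  finally have "comps V (insert (a, b) R) = card (q ` V - {q b})" .
  moreover have "comps V R = card (q ` V)"
    by (simp add: comps_def q_def)
  ultimately show ?thesis
    using card_Suc_Diff1[of "q ` V" "q b"] assms(1,3) by simp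
qed

lemma comps_insert:
  assumes "finite V" "a \<in> V" "b \<in> V"
  shows "int (comps V (insert (a, b) R)) = int (comps V R) - (if (a, b) \<in> conn R then 0 else 1)"
  using comps_insert_diff[OF assms] comps_insert_same[of a b R V] by auto

lemma comps_antimono:
  assumes "finite V" "R \<subseteq> S"
  shows "comps V S \<le> comps V R"
proof -
  have "(\<lambda>x. conn S `` {x}) ` V \<subseteq> (\<lambda>c. conn S `` c) ` (\<lambda>x. conn R `` {x}) ` V"
  proof
    fix c assume "c \<in> (\<lambda>x. conn S `` {x}) ` V"
    then obtain x where x: "x \<in> V" "c = conn S `` {x}" by auto
    have "conn S `` (conn R `` {x}) = conn S `` {x}"
      using conn_mono[OF assms(2)] by (blast intro: conn_trans)
    then show "c \<in> (\<lambda>c. conn S `` c) ` (\<lambda>x. conn R `` {x}) ` V"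
      using x by (auto simp: image_iff intro!: bexI[of _ x])
  qed
  then have "comps V S \<le> card ((\<lambda>c. conn S `` c) ` (\<lambda>x. conn R `` {x}) ` V)"
    unfolding comps_def using assms(1) by (simp add: card_mono)
  also have "\<dots> \<le> comps V R"
    unfolding comps_def using assms(1) by (intro card_image_le) simp
  finally show ?thesis .
qed

section \<open>Subgraphs of small rank\<close>

text \<open>
  A simple graph is a set \<open>Y\<close> of two-element sets of vertices, with \<open>links Y\<close> its symmetric
  adjacency relation. The rank of \<open>Y\<close> as a spanning subgraph on \<open>V\<close> is the number of vertices
  minus the number of components. A triangle is a set of three edges with three vertices in all.
\<close>

definition links :: "'v set set \<Rightarrow> ('v \<times> 'v) set" where
  "links Y = {(x, y). {x, y} \<in> Y}"

definition two_subsets :: "'v set \<Rightarrow> 'v set set" where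
  "two_subsets V = {f. f \<subseteq> V \<and> card f = 2}"

definition rank :: "'v set \<Rightarrow> 'v set set \<Rightarrow> nat" where
  "rank V Y = card V - comps V (links Y)"

definition triangle :: "'v set set \<Rightarrow> bool" where
  "triangle Y \<longleftrightarrow> card Y = 3 \<and> card (\<Union>Y) = 3"

lemma links_empty [simp]: "links {} = {}"
  by (simp add: links_def)

lemma conn_links_insert: "conn (links (insert {a, b} Y)) = conn (insert (a, b) (links Y))"
proof -
  have "links (insert {a, b} Y) \<union> (links (insert {a, b} Y))\<inverse> =
      insert (a, b) (links Y) \<union> (insert (a, b) (links Y))\<inverse>"
    by (auto simp: links_def doubleton_eq_iff insert_commute)
  then show ?thesis by (simp only: conn_def)
qed

lemma comps_links_insert:
  assumes "finite V" "a \<in> V" "b \<in> V"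
  shows "int (comps V (links (insert {a, b} Y))) =
    int (comps V (links Y)) - (if (a, b) \<in> conn (links Y) then 0 else 1)"
  using comps_insert[OF assms, of "links Y"] by (simp add: comps_def conn_links_insert)

lemma links_mono: "Y \<subseteq> Z \<Longrightarrow> links Y \<subseteq> links Z"
  by (auto simp: links_def)

lemma comps_rank: "finite V \<Longrightarrow> int (rank V Y) = int (card V) - int (comps V (links Y))"
  using comps_le[of V "links Y"] by (simp add: rank_def)

lemma rank_mono: "finite V \<Longrightarrow> Y \<subseteq> Z \<Longrightarrow> rank V Y \<le> rank V Z"
  unfolding rank_def by (intro diff_le_mono2 comps_antimono links_mono)

lemma rank_empty [simp]: "rank V {} = 0"
  by (simp add: rank_def comps_empty)

lemma rank_insert:
  assumes "finite V" "a \<in> V" "b \<in> V"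
  shows "rank V (insert {a, b} Y) = rank V Y + (if (a, b) \<in> conn (links Y) then 0 else 1)"
  using comps_links_insert[OF assms, of Y] comps_rank[OF assms(1), of Y]
    comps_rank[OF assms(1), of "insert {a, b} Y"]
  by (simp split: if_splits)

lemma two_subsetsE:
  assumes "f \<in> two_subsets V"
  obtains a b where "f = {a, b}" "a \<noteq> b" "a \<in> V" "b \<in> V"
  using assms by (auto simp: two_subsets_def card_2_iff)

lemma conn_links_single: "(x, y) \<in> conn (links {{a, b}}) \<longleftrightarrow> x = y \<or> {x, y} = {a, b}"
  unfolding conn_links_insert conn_insert links_empty conn_empty
  by (auto simp: doubleton_eq_iff)

lemma rank_single:
  assumes "finite V" "f \<in> two_subsets V"
  shows "rank V {f} = 1"
proof -
  obtain a b where "f = {a, b}" "a \<noteq> b" "a \<in> V" "b \<in> V" using assms(2) by (rule two_subsetsE)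
  then show ?thesis using rank_insert[OF assms(1), of a b "{}"] by (simp add: conn_empty)
qed

lemma rank_two:
  assumes "finite V" "f \<in> two_subsets V" "g \<in> two_subsets V" "f \<noteq> g"
  shows "rank V {f, g} = 2"
proof -
  obtain a b where f: "f = {a, b}" "a \<noteq> b" "a \<in> V" "b \<in> V" using assms(2) by (rule two_subsetsE)
  obtain p q where g: "g = {p, q}" using assms(3) by (rule two_subsetsE)
  have "(a, b) \<notin> conn (links {g})"
    using assms(4) f g by (simp add: conn_links_single)
  then show ?thesis
    using rank_insert[OF assms(1) f(3,4), of "{g}"] rank_single[OF assms(1,3)] f(1) by simp
qed

lemma conn_two_edges_iff:
  assumes "card f = 2" "card g = 2" "f \<noteq> g" "x \<noteq> y" "{x, y} \<noteq> f" "{x, y} \<noteq> g"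
  shows "(x, y) \<in> conn (links {f, g}) \<longleftrightarrow> card (f \<union> g \<union> {x, y}) = 3"
proof (cases "f \<inter> g = {}")
  case True
  obtain a b p q where ab: "f = {a, b}" "a \<noteq> b" and pq: "g = {p, q}" "p \<noteq> q"
    using assms(1,2) by (auto simp: card_2_iff)
  have "finite (f \<union> g \<union> {x, y})" using ab pq by simp
  then have "card (f \<union> g) \<le> card (f \<union> g \<union> {x, y})" by (intro card_mono) auto
  moreover have "card (f \<union> g) = 4"
    using True ab pq assms(1,2) by (subst card_Un_disjoint) auto
  moreover have "(x, y) \<notin> conn (links {f, g})"
    using True assms(4-6) unfolding ab(1) conn_links_insert conn_insert
    unfolding pq(1) conn_links_single by (auto simp: doubleton_eq_iff)
  ultimately show ?thesis by simp
next
  case False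
  then obtain b where b: "b \<in> f" "b \<in> g" by auto
  obtain a where a: "f = {b, a}" "a \<noteq> b" using b(1) assms(1) by (auto simp: card_2_iff)
  obtain z where z: "g = {b, z}" "z \<noteq> b" using b(2) assms(2) by (auto simp: card_2_iff)
  have az: "a \<noteq> z" using assms(3) a z by auto
  have "(x, y) \<in> conn (links {f, g}) \<longleftrightarrow> x \<in> {a, b, z} \<and> y \<in> {a, b, z}"
    using assms(4-6) unfolding a(1) conn_links_insert conn_insert
    unfolding z(1) conn_links_single by (auto simp: doubleton_eq_iff)
  moreover have "card (f \<union> g \<union> {x, y}) = 3 \<longleftrightarrow> x \<in> {a, b, z} \<and> y \<in> {a, b, z}"
  proof
    have 3: "card (f \<union> g) = 3" using a z az by (simp add: card_insert_if)
    have fin: "finite (f \<union> g \<union> {x, y})" using a z by simp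
    assume "card (f \<union> g \<union> {x, y}) = 3"
    then have "f \<union> g = f \<union> g \<union> {x, y}"
      using 3 fin by (intro card_subset_eq) auto
    then show "x \<in> {a, b, z} \<and> y \<in> {a, b, z}" using a z by auto
  next
    assume "x \<in> {a, b, z} \<and> y \<in> {a, b, z}"
    then have "f \<union> g \<union> {x, y} = {a, b, z}" using a z by auto
    then show "card (f \<union> g \<union> {x, y}) = 3" using a z az by simp
  qed
  ultimately show ?thesis by simp
qed

lemma rank_three:
  assumes "finite V" "f \<in> two_subsets V" "g \<in> two_subsets V" "h \<in> two_subsets V"
    and "f \<noteq> g" "h \<noteq> f" "h \<noteq> g"
  shows "rank V {f, g, h} = 2 \<longleftrightarrow> triangle {f, g, h}"
proof -
  obtain x y where h: "h = {x, y}" "x \<noteq> y" "x \<in> V" "y \<in> V" using assms(4) by (rule two_subsetsE)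
  have "rank V (insert {x, y} {f, g}) = 2 \<longleftrightarrow> (x, y) \<in> conn (links {f, g})"
    using rank_insert[OF assms(1) h(3,4), of "{f, g}"] rank_two[OF assms(1-3,5)] by simp
  also have "\<dots> \<longleftrightarrow> card (f \<union> g \<union> {x, y}) = 3"
    using assms h by (intro conn_two_edges_iff) (auto simp: two_subsets_def)
  also have "\<dots> \<longleftrightarrow> triangle {f, g, h}"
    using assms(5-7) h(1) by (auto simp: triangle_def Un_assoc)
  finally show ?thesis using h(1) by (simp add: insert_commute)
qed

lemma card_two_subsets: "finite T \<Longrightarrow> card (two_subsets T) = card T choose 2"
  by (simp add: two_subsets_def n_subsets)

lemma finite_two_subsets: "finite V \<Longrightarrow> finite (two_subsets V)"
  by (rule finite_subset[of _ "Pow V"]) (auto simp: two_subsets_def)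

lemma triangle_eq_two_subsets:
  assumes "triangle Y" "\<And>f. f \<in> Y \<Longrightarrow> card f = 2"
  shows "Y = two_subsets (\<Union>Y)"
proof (rule card_subset_eq)
  have "finite (\<Union>Y)" using assms(1) by (auto simp: triangle_def intro: card_ge_0_finite)
  then show "finite (two_subsets (\<Union>Y))" "card Y = card (two_subsets (\<Union>Y))"
    using assms(1) by (simp_all add: finite_two_subsets card_two_subsets triangle_def
        choose_two)
  show "Y \<subseteq> two_subsets (\<Union>Y)" using assms(2) by (auto simp: two_subsets_def)
qed

text \<open>
  Two distinct edges already have rank 2, and a third edge keeps the rank only if it closes a
  triangle. A fourth edge raises the rank, as three vertices carry no more than three edges.
\<close>

lemma rank_small:
  assumes "finite V" "Y \<subseteq> two_subsets V"
  shows "rank V Y = 0 \<longleftrightarrow> Y = {}"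
    and "rank V Y = 1 \<longleftrightarrow> card Y = 1"
    and "rank V Y = 2 \<longleftrightarrow> card Y = 2 \<or> triangle Y"
proof -
  have fin: "finite Y" using assms finite_two_subsets finite_subset by blast
  have le1: "card Y \<le> 1 \<Longrightarrow> rank V Y = card Y"
  proof (cases "card Y = 0")
    case False
    moreover assume "card Y \<le> 1"
    ultimately have "card Y = 1" by simp
    then obtain f where "Y = {f}" by (auto simp: card_1_singleton_iff)
    then show "rank V Y = card Y" using rank_single[OF assms(1), of f] assms(2) by simp
  qed (simp add: fin)
  have 2: "rank V Y = 2" if c: "card Y = 2"
  proof -
    obtain f g where "Y = {f, g}" "f \<noteq> g" using c by (auto simp: card_2_iff)
    then show ?thesis using rank_two[OF assms(1), of f g] assms(2) by simp
  qed
  have ge2: "rank V Y \<ge> 2" if c: "card Y \<ge> 2"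
  proof -
    obtain Z where "Z \<subseteq> Y" "card Z = 2"
      by (rule obtain_subset_with_card_n[OF c])
    then obtain f g where "f \<in> Y" "g \<in> Y" "f \<noteq> g" by (auto simp: card_2_iff)
    then show ?thesis
      using rank_mono[OF assms(1), of "{f, g}" Y] rank_two[OF assms(1), of f g] assms(2)
      by (simp add: subset_iff)
  qed
  show "rank V Y = 0 \<longleftrightarrow> Y = {}" "rank V Y = 1 \<longleftrightarrow> card Y = 1"
    using le1 ge2 fin by (cases "card Y \<ge> 2"; force)+
  have tri: "triangle {f, g, h}"
    if "rank V Y = 2" "f \<in> Y" "g \<in> Y" "h \<in> Y" "f \<noteq> g" "h \<noteq> f" "h \<noteq> g" for f g h
  proof -
    have in_V: "f \<in> two_subsets V" "g \<in> two_subsets V" "h \<in> two_subsets V"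
      using that(2-4) assms(2) by blast+
    have "{f, g, h} \<subseteq> Y" "{f, g} \<subseteq> {f, g, h}" using that(2-4) by blast+
    then have "rank V {f, g, h} \<le> 2" "rank V {f, g} \<le> rank V {f, g, h}"
      using rank_mono[OF assms(1)] that(1) by metis+
    then have "rank V {f, g, h} = 2" using rank_two[OF assms(1) in_V(1,2) that(5)] by simp
    then show ?thesis using rank_three[OF assms(1) in_V that(5-7)] by simp
  qed
  show "rank V Y = 2 \<longleftrightarrow> card Y = 2 \<or> triangle Y"
  proof
    assume r: "rank V Y = 2"
    show "card Y = 2 \<or> triangle Y"
    proof (cases "card Y \<le> 2")
      case True
      then show ?thesis using le1 r by (cases "card Y = 2") auto
    next
      case False
      then obtain Z where Z: "Z \<subseteq> Y" "card Z = 3"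
        using obtain_subset_with_card_n[of 3 Y] by auto
      then obtain f g h where fgh: "Z = {f, g, h}" "f \<noteq> g" "h \<noteq> f" "h \<noteq> g"
        by (auto simp: card_3_iff)
      have fghY: "f \<in> Y" "g \<in> Y" "h \<in> Y" using Z(1) fgh(1) by blast+
      have c: "card j = 2" if "j \<in> Y" for j
        using that assms(2) by (auto simp: two_subsets_def)
      have fin2: "finite f" "finite g" using c[OF fghY(1)] c[OF fghY(2)] by (auto intro: card_ge_0_finite)
      have "\<not> g \<subseteq> f"
        using c[OF fghY(1)] c[OF fghY(2)] fgh(2) fin2 card_subset_eq[of f g] by metis
      then obtain y where y: "y \<in> g" "y \<notin> f" by blast
      have "card (insert y f) \<le> card (f \<union> g)"
        using y fin2 by (intro card_mono) auto
      then have ge3: "card (f \<union> g) \<ge> 3" using y fin2 c[OF fghY(1)] by simp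
      have U: "f \<union> g \<union> i = f \<union> g" if "triangle {f, g, i}" for i
      proof -
        have "card (f \<union> g \<union> i) = 3" using that by (simp add: triangle_def Un_assoc)
        then show ?thesis using ge3 card_seteq[of "f \<union> g \<union> i" "f \<union> g"]
          by (metis Un_upper1 card_ge_0_finite zero_less_numeral)
      qed
      have "Y \<subseteq> Z"
      proof
        fix i assume i: "i \<in> Y"
        show "i \<in> Z"
        proof (rule ccontr)
          assume ni: "i \<notin> Z"
          have t: "triangle {f, g, h}" by (rule tri[OF r fghY fgh(2-4)])
          have "triangle {f, g, i}"
            by (rule tri[OF r fghY(1,2) i fgh(2)]) (use ni fgh(1) in blast)+
          then have "i \<in> two_subsets (f \<union> g)"
            using U[of i] c[OF i] by (auto simp: two_subsets_def)
          moreover have "{f, g, h} = two_subsets (\<Union>{f, g, h})"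
            by (rule triangle_eq_two_subsets[OF t]) (use c fghY in blast)
          moreover have "\<Union>{f, g, h} = f \<union> g" using U[OF t] by (simp add: Un_assoc)
          ultimately show False using ni fgh(1) by metis
        qed
      qed
      then have "Y = Z" using Z(1) by blast
      then show ?thesis using tri[OF r fghY fgh(2-4)] fgh(1) by simp
    qed
  next
    assume "card Y = 2 \<or> triangle Y"
    then show "rank V Y = 2"
    proof
      assume t: "triangle Y"
      then obtain f g h where fgh: "Y = {f, g, h}" "f \<noteq> g" "h \<noteq> f" "h \<noteq> g"
        by (auto simp: triangle_def card_3_iff)
      have "f \<in> two_subsets V" "g \<in> two_subsets V" "h \<in> two_subsets V"
        using fgh(1) assms(2) by blast+
      from rank_three[OF assms(1) this fgh(2-4)] show ?thesis
        using fgh(1) t by simp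
    qed (rule 2)
  qed
qed

section \<open>Alternating sums over subgraphs of small rank\<close>

lemma sum_Pow_insert:
  assumes "finite S" "x \<notin> S"
  shows "sum g (Pow (insert x S)) = (\<Sum>X\<in>Pow S. g X + g (insert x X))"
proof -
  have "Pow S \<inter> insert x ` Pow S = {}" using assms(2) by auto
  then have "sum g (Pow (insert x S)) = sum g (Pow S) + sum g (insert x ` Pow S)"
    unfolding Pow_insert using assms(1) by (intro sum.union_disjoint) auto
  also have "sum g (insert x ` Pow S) = (\<Sum>X\<in>Pow S. g (insert x X))"
    using assms(2) by (subst sum.reindex) (auto simp: inj_on_def)
  finally show ?thesis by (simp add: sum.distrib)
qed

text \<open>
  The sum of \<open>h X\<close> over all subsets \<open>X\<close> of \<open>E\<close>, with sign \<open>(- 1) ^ card X\<close>.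
\<close>

definition alt_sum :: "'e set \<Rightarrow> ('e set \<Rightarrow> int) \<Rightarrow> int" where
  "alt_sum E h = (\<Sum>X\<in>Pow E. (- 1) ^ card X * h X)"

lemma alt_sum_insert:
  assumes "finite S" "x \<notin> S"
  shows "alt_sum (insert x S) h = alt_sum S h - alt_sum S (\<lambda>X. h (insert x X))"
proof -
  have "(- 1) ^ card (insert x X) = - ((- 1 :: int) ^ card X)" if "X \<in> Pow S" for X
    using that assms finite_subset[of X S] by (subst card_insert_disjoint) auto
  then show ?thesis
    unfolding alt_sum_def sum_Pow_insert[OF assms] sum_subtractf[symmetric]
    by (intro sum.cong) auto
qed

lemma alt_sum_cong:
  "(\<And>X. X \<subseteq> E \<Longrightarrow> h X = k X) \<Longrightarrow> alt_sum E h = alt_sum E k"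
  unfolding alt_sum_def by (intro sum.cong) auto

lemma alt_sum_add: "alt_sum E (\<lambda>X. h X + k X) = alt_sum E h + alt_sum E k"
  by (simp add: alt_sum_def sum.distrib distrib_left)

lemma alt_sum_of_bool:
  assumes "finite E"
  shows "alt_sum E (\<lambda>X. of_bool (P X)) = (\<Sum>X\<in>{X. X \<subseteq> E \<and> P X}. (- 1) ^ card X)"
proof -
  have "alt_sum E (\<lambda>X. of_bool (P X)) = (\<Sum>X\<in>Pow E. if P X then (- 1) ^ card X else 0)"
    unfolding alt_sum_def by (intro sum.cong) auto
  also have "\<dots> = (\<Sum>X\<in>Pow E \<inter> {X. P X}. (- 1) ^ card X)"
    using assms by (simp add: sum.inter_restrict)
  also have "Pow E \<inter> {X. P X} = {X. X \<subseteq> E \<and> P X}" by auto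
  finally show ?thesis .
qed

text \<open>
  The subsets with and without \<open>x\<close> cancel.
\<close>

lemma alt_sum_absorb:
  assumes "finite S" "x \<in> S"
  shows "alt_sum S (\<lambda>X. h (insert x X)) = 0"
proof -
  obtain S' where S: "S = insert x S'" "x \<notin> S'" using assms(2) by (meson Set.set_insert)
  then have "finite S'" using assms(1) by simp
  from alt_sum_insert[OF this S(2), of "\<lambda>X. h (insert x X)"] show ?thesis by (simp add: S(1))
qed

text \<open>Parallel edges cancel: only the simple graph underneath a multigraph matters.\<close>

lemma alt_sum_image:
  assumes "finite E"
  shows "alt_sum E (\<lambda>X. h (f ` X)) = alt_sum (f ` E) h"
  using assms
proof (induction E arbitrary: h rule: finite_induct)
  case empty
  then show ?case by (simp add: alt_sum_def)
next
  case (insert e E)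
  have "alt_sum (insert e E) (\<lambda>X. h (f ` X)) = alt_sum (f ` E) h - alt_sum (f ` E) (\<lambda>Y. h (insert (f e) Y))"
    unfolding alt_sum_insert[OF insert.hyps] using insert.IH[of h] insert.IH[of "\<lambda>Y. h (insert (f e) Y)"]
    by simp
  also have "\<dots> = alt_sum (f ` insert e E) h"
  proof (cases "f e \<in> f ` E")
    case True
    then show ?thesis using insert.hyps(1) by (simp add: alt_sum_absorb insert_absorb)
  next
    case False
    then show ?thesis using insert.hyps(1) by (simp add: alt_sum_insert)
  qed
  finally show ?case .
qed

lemma alt_sum_one: "finite S \<Longrightarrow> alt_sum S (\<lambda>X. 1) = of_bool (S = {})"
proof (cases "S = {}")
  case False
  moreover assume "finite S"
  ultimately show ?thesis using alt_sum_absorb[of S _ "\<lambda>X. 1"] by auto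
qed (simp add: alt_sum_def)

lemma alt_sum_card:
  assumes "finite S"
  shows "alt_sum S (\<lambda>X. int (card X)) = - of_bool (card S = 1)"
proof (cases "S = {}")
  case False
  then obtain x S' where S: "S = insert x S'" "x \<notin> S'" by (meson Set.set_insert all_not_in_conv)
  then have f: "finite S'" using assms by simp
  have c: "card (insert x X) = card X + 1" if "X \<subseteq> S'" for X
    using that S(2) f finite_subset[OF that f] by (subst card_insert_disjoint) auto
  have "alt_sum S (\<lambda>X. int (card X)) = alt_sum S' (\<lambda>X. int (card X)) - alt_sum S' (\<lambda>X. int (card X) + 1)"
    unfolding S(1) alt_sum_insert[OF f S(2)]
    by (intro arg_cong2[of _ _ _ _ minus] alt_sum_cong refl) (use c in simp)
  also have "\<dots> = - of_bool (S' = {})" using f by (simp add: alt_sum_add alt_sum_one)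
  also have "S' = {} \<longleftrightarrow> card S = 1" using S f by auto
  finally show ?thesis .
qed (simp add: alt_sum_def)

definition num_triangles :: "'v set set \<Rightarrow> nat" where
  "num_triangles F = card {Y. Y \<subseteq> F \<and> triangle Y}"

text \<open>
  These are the leading coefficients of the chromatic polynomial of the graph \<open>(V, F)\<close>.
\<close>

lemma alt_sum_rank:
  assumes "finite V" "F \<subseteq> two_subsets V"
  shows "alt_sum F (\<lambda>Y. of_bool (rank V Y = 0)) = 1"
    and "alt_sum F (\<lambda>Y. of_bool (rank V Y = 1)) = - int (card F)"
    and "alt_sum F (\<lambda>Y. of_bool (rank V Y = 2)) = int (card F choose 2) - int (num_triangles F)"
proof -
  have fin: "finite F" using assms finite_two_subsets finite_subset by blast
  have F: "Y \<subseteq> two_subsets V" if "Y \<subseteq> F" for Y using that assms(2) by auto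
  have "{Y. Y \<subseteq> F \<and> rank V Y = 0} = {{}}" using rank_small(1)[OF assms(1) F] by auto
  then show "alt_sum F (\<lambda>Y. of_bool (rank V Y = 0)) = 1"
    unfolding alt_sum_of_bool[OF fin] by simp
  have "{Y. Y \<subseteq> F \<and> rank V Y = 1} = {Y. Y \<subseteq> F \<and> card Y = 1}"
    using rank_small(2)[OF assms(1) F] by auto
  moreover have "(\<Sum>Y\<in>{Y. Y \<subseteq> F \<and> card Y = 1}. (- 1) ^ card Y) = (\<Sum>Y\<in>{Y. Y \<subseteq> F \<and> card Y = 1}. - 1 :: int)"
    by (intro sum.cong) auto
  ultimately show "alt_sum F (\<lambda>Y. of_bool (rank V Y = 1)) = - int (card F)"
    unfolding alt_sum_of_bool[OF fin] using n_subsets[OF fin, of 1] by simp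
  have "{Y. Y \<subseteq> F \<and> rank V Y = 2} = {Y. Y \<subseteq> F \<and> card Y = 2} \<union> {Y. Y \<subseteq> F \<and> triangle Y}"
    using rank_small(3)[OF assms(1) F] by blast
  moreover have "{Y. Y \<subseteq> F \<and> card Y = 2} \<inter> {Y. Y \<subseteq> F \<and> triangle Y} = {}"
    by (auto simp: triangle_def)
  moreover have "finite {Y. Y \<subseteq> F \<and> card Y = 2}" "finite {Y. Y \<subseteq> F \<and> triangle Y}"
    using fin by auto
  ultimately have "alt_sum F (\<lambda>Y. of_bool (rank V Y = 2)) =
      (\<Sum>Y\<in>{Y. Y \<subseteq> F \<and> card Y = 2}. (- 1) ^ card Y) + (\<Sum>Y\<in>{Y. Y \<subseteq> F \<and> triangle Y}. (- 1) ^ card Y)"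
    unfolding alt_sum_of_bool[OF fin] by (simp add: sum.union_disjoint)
  also have "(\<Sum>Y\<in>{Y. Y \<subseteq> F \<and> card Y = 2}. (- 1) ^ card Y) = (\<Sum>Y\<in>{Y. Y \<subseteq> F \<and> card Y = 2}. 1 :: int)"
    by (intro sum.cong) auto
  also have "\<dots> = int (card F choose 2)" using n_subsets[OF fin, of 2] by simp
  also have "(\<Sum>Y\<in>{Y. Y \<subseteq> F \<and> triangle Y}. (- 1) ^ card Y) = (\<Sum>Y\<in>{Y. Y \<subseteq> F \<and> triangle Y}. - 1 :: int)"
    by (intro sum.cong) (auto simp: triangle_def)
  also have "\<dots> = - int (num_triangles F)" by (simp add: num_triangles_def)
  finally show "alt_sum F (\<lambda>Y. of_bool (rank V Y = 2)) = int (card F choose 2) - int (num_triangles F)"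
    by simp
qed

text \<open>
  The multiplicity of the simple edge \<open>f\<close> in a multigraph.
\<close>

definition mult :: "('e \<Rightarrow> 'v set) \<Rightarrow> 'e set \<Rightarrow> 'v set \<Rightarrow> nat" where
  "mult ends E f = card {e \<in> E. ends e = f}"

text \<open>
  A set of edges has rank 1 if it is a nonempty set of parallel edges. By \<open>alt_sum_card\<close>, only
  classes consisting of a single edge contribute.
\<close>

lemma alt_sum_card_rank_1:
  assumes "finite V" "finite E" "ends ` E \<subseteq> two_subsets V"
  shows "alt_sum E (\<lambda>X. int (card X) * of_bool (rank V (ends ` X) = 1)) =
    - int (card {f \<in> ends ` E. mult ends E f = 1})"
proof -
  let ?F = "ends ` E"
  define fib where "fib f = {e \<in> E. ends e = f}" for f
  let ?w = "\<lambda>X. (- 1) ^ card X * int (card X)"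
  have iff: "rank V (ends ` X) = 1 \<longleftrightarrow> (\<exists>f\<in>?F. X \<in> Pow (fib f) - {{}})" if X: "X \<subseteq> E" for X
  proof -
    have "rank V (ends ` X) = 1 \<longleftrightarrow> card (ends ` X) = 1"
      using rank_small(2)[OF assms(1), of "ends ` X"] assms(3) X by (meson image_mono order_trans)
    also have "\<dots> \<longleftrightarrow> (\<exists>f. ends ` X = {f})" by (simp add: card_1_singleton_iff)
    also have "\<dots> \<longleftrightarrow> (\<exists>f\<in>?F. X \<in> Pow (fib f) - {{}})"
    proof
      assume "\<exists>f. ends ` X = {f}"
      then obtain f where f: "ends ` X = {f}" ..
      have e: "ends e = f" if "e \<in> X" for e using imageI[OF that, of ends] f by simp
      have ne: "X \<noteq> {}" using f by auto
      then obtain e' where "e' \<in> X" by auto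
      then have "f \<in> ?F" using e[of e'] X by auto
      then show "\<exists>f\<in>?F. X \<in> Pow (fib f) - {{}}"
        using X e ne by (intro bexI[of _ f]) (auto simp: fib_def)
    next
      assume "\<exists>f\<in>?F. X \<in> Pow (fib f) - {{}}"
      then obtain f where "X \<noteq> {}" "\<And>e. e \<in> X \<Longrightarrow> ends e = f" by (auto simp: fib_def)
      then have "ends ` X = {f}" by (auto simp: image_iff)
      then show "\<exists>f. ends ` X = {f}" ..
    qed
    finally show ?thesis .
  qed
  \<comment> \<open>the subsets of rank 1 are split according to the parallel class that contains them\<close>
  have "alt_sum E (\<lambda>X. int (card X) * of_bool (rank V (ends ` X) = 1)) =
      (\<Sum>X\<in>Pow E. if rank V (ends ` X) = 1 then ?w X else 0)"
    unfolding alt_sum_def by (intro sum.cong) auto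
  also have "\<dots> = (\<Sum>X\<in>Pow E \<inter> {X. rank V (ends ` X) = 1}. ?w X)"
    using assms(2) by (simp add: sum.inter_restrict)
  also have "Pow E \<inter> {X. rank V (ends ` X) = 1} = (\<Union>f\<in>?F. Pow (fib f) - {{}})"
  proof (intro set_eqI iffI)
    fix X assume "X \<in> Pow E \<inter> {X. rank V (ends ` X) = 1}"
    then have "X \<subseteq> E" "rank V (ends ` X) = 1" by simp_all
    then show "X \<in> (\<Union>f\<in>?F. Pow (fib f) - {{}})" using iff[of X] by (simp only: UN_iff)
  next
    fix X assume X: "X \<in> (\<Union>f\<in>?F. Pow (fib f) - {{}})"
    then have "X \<subseteq> E" by (auto simp: fib_def)
    moreover have "rank V (ends ` X) = 1" using iff[OF calculation] X by (simp only: UN_iff)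
    ultimately show "X \<in> Pow E \<inter> {X. rank V (ends ` X) = 1}" by simp
  qed
  also have "(\<Sum>X\<in>(\<Union>f\<in>?F. Pow (fib f) - {{}}). ?w X) = (\<Sum>f\<in>?F. \<Sum>X\<in>Pow (fib f) - {{}}. ?w X)"
    using assms(2) by (intro sum.UNION_disjoint) (auto simp: fib_def)
  also have "\<dots> = (\<Sum>f\<in>?F. - of_bool (mult ends E f = 1))"
  proof (intro sum.cong refl)
    fix f
    have "finite (fib f)" using assms(2) by (simp add: fib_def)
    from alt_sum_card[OF this] show "(\<Sum>X\<in>Pow (fib f) - {{}}. ?w X) = - of_bool (mult ends E f = 1)"
      using \<open>finite (fib f)\<close> by (simp add: alt_sum_def mult_def fib_def sum.remove[of _ "{}"])
  qed
  also have "\<dots> = - int (card {f \<in> ends ` E. mult ends E f = 1})"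
  proof -
    have "?F \<inter> {f. mult ends E f = 1} = {f \<in> ?F. mult ends E f = 1}" by blast
    then show ?thesis using assms(2) by (simp add: sum_negf)
  qed
  finally show ?thesis .
qed


section \<open>Contracting a pair of vertices\<close>

text \<open>
  The vertex \<open>u2\<close> is identified with \<open>u1\<close>, which stays as the name of the new vertex.
\<close>

definition contract :: "'v \<Rightarrow> 'v \<Rightarrow> 'v \<Rightarrow> 'v" where
  "contract u1 u2 x = (if x = u2 then u1 else x)"

lemma conn_contract:
  assumes "Y \<subseteq> two_subsets V"
  shows "(x, y) \<in> conn (links (insert {u1, u2} Y)) \<longleftrightarrow>
    (contract u1 u2 x, contract u1 u2 y) \<in> conn (links ((`) (contract u1 u2) ` Y))"
  (is "_ \<in> ?C \<longleftrightarrow> (?g x, ?g y) \<in> ?C'")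
proof
  assume "(x, y) \<in> ?C"
  then show "(?g x, ?g y) \<in> ?C'"
  proof (rule conn_least[where E = "\<lambda>x y. (?g x, ?g y) \<in> ?C'"])
    fix x y assume "(x, y) \<in> links (insert {u1, u2} Y)"
    then consider "{x, y} = {u1, u2}" | "{x, y} \<in> Y" by (auto simp: links_def)
    then show "(?g x, ?g y) \<in> ?C'"
    proof cases
      case 1
      then have "?g x = ?g y" by (auto simp: contract_def doubleton_eq_iff)
      then show ?thesis by simp
    next
      case 2
      then have "?g ` {x, y} \<in> (`) ?g ` Y" by (rule imageI)
      then show ?thesis by (intro conn_base) (simp add: links_def)
    qed
  qed (rule conn_refl | erule conn_sym | erule (1) conn_trans)+
next
  have g: "(?g x, x) \<in> ?C" for x
  proof (cases "x = u2")
    case True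
    then show ?thesis by (intro conn_base) (simp add: contract_def links_def)
  qed (simp add: contract_def)
  assume "(?g x, ?g y) \<in> ?C'"
  then have "(?g x, ?g y) \<in> ?C"
  proof (rule conn_least[where E = "\<lambda>x y. (x, y) \<in> ?C"])
    fix x y assume "(x, y) \<in> links ((`) ?g ` Y)"
    then obtain f where f: "f \<in> Y" "{x, y} = ?g ` f" by (auto simp: links_def)
    have "f \<in> two_subsets V" using f(1) assms by blast
    then obtain p q where pq: "f = {p, q}" by (rule two_subsetsE)
    then have "(p, q) \<in> ?C" using f(1) by (intro conn_base) (simp add: links_def)
    then have "(?g p, ?g q) \<in> ?C" by (rule conn_trans[OF conn_trans[OF g] conn_sym[OF g]])
    moreover have "x = ?g p \<and> y = ?g q \<or> x = ?g q \<and> y = ?g p"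
      using f(2) unfolding pq by (simp add: doubleton_eq_iff)
    ultimately show "(x, y) \<in> ?C" using conn_sym[of "?g p" "?g q"] by (elim disjE) simp_all
  qed (rule conn_refl | erule conn_sym | erule (1) conn_trans)+
  then show "(x, y) \<in> ?C" by (rule conn_trans[OF conn_trans[OF conn_sym[OF g]] g])
qed

text \<open>
  The left side counts components in \<open>(V, Y)\<close>. Those of the contraction are the components of
  \<open>Y\<close> together with the edge from \<open>u1\<close> to \<open>u2\<close>.
\<close>

lemma rank_contract:
  assumes "finite V" "Y \<subseteq> two_subsets V" "u1 \<in> V" "u2 \<in> V" "u1 \<noteq> u2"
  shows "rank V Y = rank (V - {u2}) ((`) (contract u1 u2) ` Y) + of_bool ((u1, u2) \<in> conn (links Y))"
proof -
  let ?g = "contract u1 u2" and ?Y' = "(`) (contract u1 u2) ` Y"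
  have "V - {u2} = ?g ` V" using assms(3-5) by (auto simp: contract_def image_iff)
  then have "comps (V - {u2}) (links ?Y') = card ((\<lambda>x. conn (links ?Y') `` {?g x}) ` V)"
    by (simp add: comps_def image_image)
  also have "\<dots> = comps V (links (insert {u1, u2} Y))"
    unfolding comps_def
    by (rule card_image_cong) (simp add: conn_class_eq conn_contract[OF assms(2)])
  finally have "int (comps (V - {u2}) (links ?Y')) = int (comps V (links Y)) -
      (if (u1, u2) \<in> conn (links Y) then 0 else 1)"
    using comps_links_insert[OF assms(1,3,4), of Y] by simp
  moreover have "card V > 0" using assms(1,3) by (auto simp: card_gt_0_iff)
  ultimately show ?thesis
    using comps_rank[OF assms(1), of Y] comps_rank[of "V - {u2}" ?Y'] assms(1,4)
    by (simp add: of_nat_diff split: if_splits)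
qed

lemma contract_edge_two_subsets:
  assumes "f \<in> two_subsets V" "f \<noteq> {u1, u2}" "u1 \<in> V" "u1 \<noteq> u2"
  shows "contract u1 u2 ` f \<in> two_subsets (V - {u2})"
proof -
  obtain a b where f: "f = {a, b}" "a \<noteq> b" "a \<in> V" "b \<in> V" using assms(1) by (rule two_subsetsE)
  have "contract u1 u2 a \<noteq> contract u1 u2 b"
  proof
    assume "contract u1 u2 a = contract u1 u2 b"
    then have "{a, b} = {u1, u2}" using f(2) by (auto simp: contract_def split: if_splits)
    with assms(2) f(1) show False by simp
  qed
  moreover have "contract u1 u2 ` f = {contract u1 u2 a, contract u1 u2 b}" using f(1) by simp
  moreover have "contract u1 u2 x \<in> V - {u2}" if "x \<in> V" for x
    using that assms(3,4) by (simp add: contract_def)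
  ultimately show ?thesis using f(3,4) by (simp add: two_subsets_def)
qed

text \<open>
  The edges from \<open>u\<close> to the vertices in \<open>N\<close>.
\<close>

definition star :: "'v \<Rightarrow> 'v set \<Rightarrow> 'v set set" where
  "star u N = (\<lambda>x. {u, x}) ` N"

lemma inj_doubleton: "inj_on (\<lambda>x. {u, x}) N"
  by (auto simp: inj_on_def doubleton_eq_iff)

lemma card_star: "card (star u N) = card N"
  unfolding star_def by (rule card_image[OF inj_doubleton])

lemma star_Un: "star u (M \<union> N) = star u M \<union> star u N"
  by (auto simp: star_def)

lemma two_subsets_insert_edge:
  assumes "card f = 2" "u \<notin> f"
  shows "two_subsets (insert u f) = insert f (star u f)"
proof -
  obtain a b where f: "f = {a, b}" "a \<noteq> b" using assms(1) by (auto simp: card_2_iff)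
  have fin: "finite (insert u f)" using f by simp
  have "insert f (star u f) \<subseteq> two_subsets (insert u f)"
    using assms f(2) unfolding f(1) by (auto simp: two_subsets_def star_def)
  moreover have "card (insert f (star u f)) = 3"
  proof -
    have "f \<notin> star u f" using assms(2) by (auto simp: star_def)
    moreover have "finite (star u f)" using fin by (simp add: star_def)
    ultimately show ?thesis using assms(1) by (simp add: card_star)
  qed
  moreover have "card (two_subsets (insert u f)) = 3"
    using fin assms by (simp add: card_two_subsets choose_two)
  ultimately show ?thesis
    using card_subset_eq[OF finite_two_subsets[OF fin]] by metis
qed

text \<open>
  Attaching a new vertex \<open>u\<close> to the vertices in \<open>N\<close> creates a triangle over every edge inside
  \<open>N\<close>.
\<close>

lemma num_triangles_star:
  assumes "finite F" "\<And>f. f \<in> F \<Longrightarrow> card f = 2" "u \<notin> \<Union>F" "finite N" "u \<notin> N"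
  shows "num_triangles (F \<union> star u N) = num_triangles F + card {f \<in> F. f \<subseteq> N}"
proof -
  define T where "T f = insert f (star u f)" for f
  have fin: "finite (F \<union> star u N)" using assms(1,4) by (simp add: star_def)
  have c2: "card f = 2" if "f \<in> F \<union> star u N" for f
    using that assms(2,5) by (auto simp: star_def card_insert_if)
  have "{Y. Y \<subseteq> F \<union> star u N \<and> triangle Y} = {Y. Y \<subseteq> F \<and> triangle Y} \<union> T ` {f \<in> F. f \<subseteq> N}"
    (is "?L = ?R")
  proof (intro equalityI subsetI)
    fix Y assume "Y \<in> ?L"
    then have Y: "Y \<subseteq> F \<union> star u N" "triangle Y" by auto
    show "Y \<in> ?R"
    proof (cases "u \<in> \<Union>Y")
      case False
      then have "Y \<subseteq> F" using Y(1) by (auto simp: star_def)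
      then show ?thesis using Y(2) by simp
    next
      case True
      define f where "f = \<Union>Y - {u}"
      have "finite (\<Union>Y)" using Y(2) by (auto simp: triangle_def intro: card_ge_0_finite)
      then have cf: "card f = 2" using True Y(2) by (simp add: f_def triangle_def)
      have uf: "u \<notin> f" "\<Union>Y = insert u f" using True by (auto simp: f_def)
      have "Y = two_subsets (\<Union>Y)"
        by (rule triangle_eq_two_subsets[OF Y(2)]) (use c2 Y(1) in blast)
      then have YT: "Y = T f"
        unfolding uf(2) T_def two_subsets_insert_edge[OF cf uf(1)] .
      have "f \<in> F" using YT Y(1) uf(1) by (auto simp: T_def star_def)
      moreover have "f \<subseteq> N"
      proof
        fix x assume "x \<in> f"
        then have "{u, x} \<in> F \<union> star u N" using YT Y(1) by (auto simp: T_def star_def)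
        then show "x \<in> N" using assms(3,5) by (auto simp: star_def doubleton_eq_iff)
      qed
      ultimately show ?thesis using YT by blast
    qed
  next
    fix Y assume "Y \<in> ?R"
    then consider "Y \<subseteq> F" "triangle Y" | f where "f \<in> F" "f \<subseteq> N" "Y = T f" by blast
    then show "Y \<in> ?L"
    proof cases
      case 2
      have cf: "card f = 2" "u \<notin> f" using assms(2,5) 2 by auto
      then have fin_f: "finite f" by (auto intro: card_ge_0_finite)
      have "f \<noteq> {}" using cf(1) by auto
      then have "\<Union>Y = insert u f" unfolding 2(3) T_def star_def by auto
      moreover have "card Y = 3"
        unfolding 2(3) T_def two_subsets_insert_edge[OF cf, symmetric]
        using fin_f cf by (simp add: card_two_subsets choose_two)
      ultimately have "triangle Y" using fin_f cf by (simp add: triangle_def)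
      moreover have "Y \<subseteq> F \<union> star u N" using 2 by (auto simp: T_def star_def)
      ultimately show ?thesis by simp
    qed auto
  qed
  moreover have "{Y. Y \<subseteq> F \<and> triangle Y} \<inter> T ` {f \<in> F. f \<subseteq> N} = {}"
  proof -
    have "u \<in> \<Union>(T f)" if "f \<in> F" for f
    proof -
      have "f \<noteq> {}" using assms(2)[OF that] by auto
      then show ?thesis by (auto simp: T_def star_def)
    qed
    then show ?thesis using assms(3) by blast
  qed
  moreover have "finite {Y. Y \<subseteq> F \<and> triangle Y}" "finite (T ` {f \<in> F. f \<subseteq> N})"
    using assms(1) by auto
  moreover have "inj_on T {f \<in> F. f \<subseteq> N}"
  proof (rule inj_onI)
    fix f g assume fg: "f \<in> {f \<in> F. f \<subseteq> N}" "g \<in> {f \<in> F. f \<subseteq> N}" "T f = T g"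
    have T: "{h \<in> T f. u \<notin> h} = {f}" if "f \<in> F" for f
      using that assms(3) by (auto simp: T_def star_def)
    have "{f} = {h \<in> T f. u \<notin> h}" by (rule T[symmetric]) (use fg(1) in blast)
    also have "\<dots> = {h \<in> T g. u \<notin> h}" by (simp only: fg(3))
    also have "\<dots> = {g}" by (rule T) (use fg(2) in blast)
    finally show "f = g" by simp
  qed
  ultimately show ?thesis
    unfolding num_triangles_def by (simp add: card_Un_disjoint card_image)
qed

lemma choose_two_diff:
  assumes "p \<le> n"
  shows "int ((n - p) choose 2) - int (n choose 2) + int p = - (int n - 1) * int p + int (p choose 2) + int p"
proof -
  have c: "2 * int (m choose 2) = int m * (int m - 1)" for m
    by (induction m) (auto simp: numeral_2_eq_2 algebra_simps)
  have "2 * (int ((n - p) choose 2) - int (n choose 2)) = 2 * (- (int n - 1) * int p + int (p choose 2))"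
    using assms unfolding right_diff_distrib distrib_left c by (simp add: of_nat_diff algebra_simps c)
  then show ?thesis by simp
qed

section \<open>Subgraphs connecting two vertices\<close>

text \<open>
  The multigraph \<open>(V, E)\<close> stands for a checkerboard graph without the edge of the dealternator,
  and \<open>u1\<close>, \<open>u2\<close> for the ends of that edge. Since \<open>u1\<close> and \<open>u2\<close> are not adjacent, their
  contraction has no loop.
\<close>

locale edge_contraction =
  fixes V :: "'v set" and E :: "'e set" and ends :: "'e \<Rightarrow> 'v set" and u1 u2 :: 'v
  assumes finite_V: "finite V" and finite_E: "finite E"
    and ends_two: "ends ` E \<subseteq> two_subsets V"
    and u_in: "u1 \<in> V" "u2 \<in> V" and u_neq: "u1 \<noteq> u2"
    and no_parallel: "{u1, u2} \<notin> ends ` E"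
begin

text \<open>
  \<open>F\<close> is the set of edges of the underlying simple graph.
\<close>

abbreviation "F \<equiv> ends ` E"

abbreviation contracted :: "'e \<Rightarrow> 'v set" where
  "contracted e \<equiv> contract u1 u2 ` ends e"

definition joined_in :: "'e set \<Rightarrow> bool" where
  "joined_in X \<longleftrightarrow> (u1, u2) \<in> conn (links (ends ` X))"

text \<open>
  The neighbours of \<open>u1\<close>, those of \<open>u2\<close>, and the simple edges that avoid both vertices. In
  the contraction, the new vertex has the neighbours \<open>N1 \<union> N2\<close>.
\<close>

definition "N1 = {x. {u1, x} \<in> F}"
definition "N2 = {x. {u2, x} \<in> F}"
definition "F0 = {f \<in> F. u1 \<notin> f \<and> u2 \<notin> f}"

lemma card_F: "f \<in> F \<Longrightarrow> card f = 2"
  using ends_two by (auto simp: two_subsets_def)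

lemma finite_F: "finite F" using finite_E by simp

lemma rank_contracted:
  assumes "X \<subseteq> E"
  shows "rank V (ends ` X) = rank (V - {u2}) (contracted ` X) + of_bool (joined_in X)"
proof -
  have "ends ` X \<subseteq> two_subsets V" using assms ends_two by auto
  from rank_contract[OF finite_V this u_in u_neq] show ?thesis
    by (simp add: joined_in_def image_image)
qed

lemma contracted_two: "contracted ` E \<subseteq> two_subsets (V - {u2})"
proof (rule image_subsetI)
  fix e assume "e \<in> E"
  then have "ends e \<in> two_subsets V" "ends e \<noteq> {u1, u2}"
    using ends_two no_parallel by (blast, metis imageI)
  then show "contracted e \<in> two_subsets (V - {u2})"
    using u_in(1) u_neq by (rule contract_edge_two_subsets)
qed

text \<open>
  Both sides agree term by term: a set connecting \<open>u1\<close> and \<open>u2\<close> has rank \<open>k + 1\<close> if and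
  only if its contraction has rank \<open>k\<close>, and other sets keep their rank.
\<close>

lemma joined_sum_Suc:
  "alt_sum E (\<lambda>X. w X * of_bool (joined_in X \<and> rank V (ends ` X) = Suc k)) =
     alt_sum E (\<lambda>X. w X * of_bool (rank (V - {u2}) (contracted ` X) = k))
     - alt_sum E (\<lambda>X. w X * of_bool (rank V (ends ` X) = k))
     + alt_sum E (\<lambda>X. w X * of_bool (joined_in X \<and> rank V (ends ` X) = k))"
proof -
  have "alt_sum E (\<lambda>X. w X * of_bool (joined_in X \<and> rank V (ends ` X) = Suc k)) +
      alt_sum E (\<lambda>X. w X * of_bool (rank V (ends ` X) = k)) =
      alt_sum E (\<lambda>X. w X * of_bool (rank (V - {u2}) (contracted ` X) = k)) +
      alt_sum E (\<lambda>X. w X * of_bool (joined_in X \<and> rank V (ends ` X) = k))"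
    unfolding alt_sum_add[symmetric]
    by (intro alt_sum_cong) (auto simp: rank_contracted)
  then show ?thesis by simp
qed

lemma joined_rank_pos: "X \<subseteq> E \<Longrightarrow> joined_in X \<Longrightarrow> rank V (ends ` X) \<ge> 2"
proof -
  assume X: "X \<subseteq> E" "joined_in X"
  have "rank (V - {u2}) (contracted ` X) = 0 \<longleftrightarrow> contracted ` X = {}"
    by (rule rank_small(1)) (use X contracted_two finite_V in auto)
  moreover have "X \<noteq> {}" using X(2) u_neq by (auto simp: joined_in_def conn_empty)
  ultimately show ?thesis using rank_contracted[OF X(1)] X(2) by simp
qed

lemma joined_sum_1: "alt_sum E (\<lambda>X. w X * of_bool (joined_in X \<and> rank V (ends ` X) = 1)) = 0"
proof -
  have "alt_sum E (\<lambda>X. w X * of_bool (joined_in X \<and> rank V (ends ` X) = 1)) = alt_sum E (\<lambda>X. 0)"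
  proof (intro alt_sum_cong)
    fix X assume "X \<subseteq> E"
    then have "\<not> (joined_in X \<and> rank V (ends ` X) = 1)" using joined_rank_pos[of X] by auto
    then show "w X * of_bool (joined_in X \<and> rank V (ends ` X) = 1) = 0"
      by (simp only: of_bool_eq mult_zero_right)
  qed
  then show ?thesis by (simp add: alt_sum_def)
qed

lemma rank_sums:
  "alt_sum E (\<lambda>X. of_bool (rank V (ends ` X) = 0)) = 1"
  "alt_sum E (\<lambda>X. of_bool (rank V (ends ` X) = 1)) = - int (card F)"
  "alt_sum E (\<lambda>X. of_bool (rank V (ends ` X) = 2)) = int (card F choose 2) - int (num_triangles F)"
  using alt_sum_rank[OF finite_V ends_two]
    alt_sum_image[OF finite_E, of "\<lambda>Y. of_bool (rank V Y = 0)" ends]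
    alt_sum_image[OF finite_E, of "\<lambda>Y. of_bool (rank V Y = 1)" ends]
    alt_sum_image[OF finite_E, of "\<lambda>Y. of_bool (rank V Y = 2)" ends] by simp_all

lemma contracted_rank_sums:
  "alt_sum E (\<lambda>X. of_bool (rank (V - {u2}) (contracted ` X) = 1)) = - int (card (contracted ` E))"
  "alt_sum E (\<lambda>X. of_bool (rank (V - {u2}) (contracted ` X) = 2)) =
     int (card (contracted ` E) choose 2) - int (num_triangles (contracted ` E))"
  using alt_sum_rank[OF finite_Diff[OF finite_V] contracted_two]
    alt_sum_image[OF finite_E, of "\<lambda>Y. of_bool (rank (V - {u2}) Y = 1)" contracted]
    alt_sum_image[OF finite_E, of "\<lambda>Y. of_bool (rank (V - {u2}) Y = 2)" contracted] by simp_all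

lemma F_eq: "F = F0 \<union> star u1 N1 \<union> star u2 N2"
proof (intro equalityI subsetI)
  fix f assume f: "f \<in> F"
  then obtain a b where ab: "f = {a, b}" using card_F by (metis card_2_iff)
  show "f \<in> F0 \<union> star u1 N1 \<union> star u2 N2"
    using f unfolding ab F0_def star_def N1_def N2_def by (auto simp: insert_commute)
qed (auto simp: F0_def star_def N1_def N2_def)

lemma u_notin: "u1 \<notin> N1" "u2 \<notin> N1" "u1 \<notin> N2" "u2 \<notin> N2"
  using card_F[of "{u1}"] card_F[of "{u2}"] no_parallel
  by (auto simp: N1_def N2_def insert_commute)

lemma finite_N: "finite N1" "finite N2"
proof -
  have "star u1 N1 \<subseteq> F" "star u2 N2 \<subseteq> F" using F_eq by auto
  then show "finite N1" "finite N2"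
    using finite_F finite_subset finite_imageD[OF _ inj_doubleton] unfolding star_def by metis+
qed

lemma contracted_eq: "contracted ` E = F0 \<union> star u1 (N1 \<union> N2)"
proof -
  let ?g = "contract u1 u2"
  have "?g ` f = f" if "f \<in> F0" for f
  proof -
    have "u2 \<notin> f" using that by (simp add: F0_def)
    then have "?g ` f = id ` f" by (intro image_cong) (auto simp: contract_def)
    then show ?thesis by simp
  qed
  then have "(`) ?g ` F0 = F0" by simp
  moreover have "(`) ?g ` star u1 N1 = star u1 N1"
    unfolding star_def image_image
  proof (intro image_cong refl)
    fix x assume "x \<in> N1"
    then have "x \<noteq> u2" using u_notin by blast
    then show "?g ` {u1, x} = {u1, x}" using u_neq by (simp add: contract_def)
  qed
  moreover have "(`) ?g ` star u2 N2 = star u1 N2"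
    unfolding star_def image_image
  proof (intro image_cong refl)
    fix x assume "x \<in> N2"
    then have "x \<noteq> u2" using u_notin by blast
    then show "?g ` {u2, x} = {u1, x}" by (simp add: contract_def insert_commute)
  qed
  moreover have "contracted ` E = (`) ?g ` F" by (simp add: image_image)
  moreover have "(`) ?g ` F = (`) ?g ` (F0 \<union> star u1 N1 \<union> star u2 N2)"
    using F_eq by (rule arg_cong)
  ultimately show ?thesis by (simp add: image_Un star_Un Un_assoc)
qed

lemma disjoint_stars:
  "F0 \<inter> star u1 N = {}" "F0 \<inter> star u2 N = {}" "star u1 N1 \<inter> star u2 N2 = {}"
  using u_notin u_neq by (auto simp: F0_def star_def doubleton_eq_iff)

lemma finite_parts: "finite F0" "finite (star u1 N1)" "finite (star u2 N2)" "finite (star u1 (N1 \<union> N2))"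
  using finite_F finite_N by (auto simp: F0_def star_def)

lemma card_F_eq: "card F = card F0 + card N1 + card N2"
proof -
  have "card (F0 \<union> star u1 N1 \<union> star u2 N2) = card F0 + card N1 + card N2"
    using finite_parts disjoint_stars by (simp add: card_Un_disjoint card_star Int_Un_distrib2)
  then show ?thesis using F_eq by simp
qed

lemma card_contracted: "card (contracted ` E) + card (N1 \<inter> N2) = card F"
proof -
  have "card (contracted ` E) = card F0 + card (N1 \<union> N2)"
    unfolding contracted_eq using finite_parts disjoint_stars by (simp add: card_Un_disjoint card_star)
  then show ?thesis using card_F_eq card_Un_Int[OF finite_N] by simp
qed

theorem joined_sum_2:
  "alt_sum E (\<lambda>X. of_bool (joined_in X \<and> rank V (ends ` X) = 2)) = int (card (N1 \<inter> N2))"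
  using joined_sum_Suc[of "\<lambda>X. 1" 1] joined_sum_1[of "\<lambda>X. 1"] rank_sums(2) contracted_rank_sums(1)
    card_contracted by (simp add: numeral_2_eq_2)

text \<open>
  With the path from \<open>u1\<close> over a cross edge to \<open>u2\<close>, contraction closes up a new triangle. An
  inner edge forms one triangle with \<open>u1\<close> and one with \<open>u2\<close>, and these become equal.
\<close>

definition "cross_edges = {f \<in> F0. \<exists>x\<in>N1 - N2. \<exists>y\<in>N2 - N1. f = {x, y}}"
definition "inner_edges = {f \<in> F0. f \<subseteq> N1 \<inter> N2}"

lemma triangles_contracted:
  "num_triangles (contracted ` E) + card inner_edges = num_triangles F + card cross_edges"
proof -
  have F0: "\<And>f. f \<in> F0 \<Longrightarrow> card f = 2" "u1 \<notin> \<Union>F0" "u2 \<notin> \<Union>F0"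
    using card_F by (auto simp: F0_def)
  let ?n = "\<lambda>N. card {f \<in> F0. f \<subseteq> N}"
  have 1: "num_triangles (F0 \<union> star u1 N) = num_triangles F0 + ?n N" if "finite N" "u1 \<notin> N" for N
    by (rule num_triangles_star) (use finite_parts F0 that in auto)
  have "num_triangles (F0 \<union> star u1 N1 \<union> star u2 N2) =
      num_triangles (F0 \<union> star u1 N1) + card {f \<in> F0 \<union> star u1 N1. f \<subseteq> N2}"
  proof (rule num_triangles_star)
    show "card f = 2" if "f \<in> F0 \<union> star u1 N1" for f
      using that F_eq card_F by blast
    show "u2 \<notin> \<Union>(F0 \<union> star u1 N1)" using F0(3) u_notin u_neq by (auto simp: star_def)
  qed (use finite_parts finite_N u_notin in auto)
  also have "{f \<in> F0 \<union> star u1 N1. f \<subseteq> N2} = {f \<in> F0. f \<subseteq> N2}"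
    using u_notin(3) by (auto simp: star_def)
  finally have "num_triangles F = num_triangles F0 + ?n N1 + ?n N2"
    using 1[OF finite_N(1) u_notin(1)] F_eq by simp
  moreover have "num_triangles (contracted ` E) = num_triangles F0 + ?n (N1 \<union> N2)"
    unfolding contracted_eq using finite_N u_notin by (intro 1) auto
  moreover have "?n (N1 \<union> N2) + card inner_edges = ?n N1 + ?n N2 + card cross_edges"
  proof -
    let ?A = "{f \<in> F0. f \<subseteq> N1}" and ?B = "{f \<in> F0. f \<subseteq> N2}"
    have fin: "finite ?A" "finite ?B" "finite cross_edges"
      using finite_parts by (auto simp: cross_edges_def)
    have "{f \<in> F0. f \<subseteq> N1 \<union> N2} = (?A \<union> ?B) \<union> cross_edges"
    proof (intro equalityI subsetI)
      fix f assume f: "f \<in> {f \<in> F0. f \<subseteq> N1 \<union> N2}"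
      then obtain a b where ab: "f = {a, b}" using F0(1) by (metis (no_types, lifting) card_2_iff mem_Collect_eq)
      show "f \<in> (?A \<union> ?B) \<union> cross_edges"
        using f unfolding ab cross_edges_def by (auto simp: insert_commute)
    qed (auto simp: cross_edges_def)
    moreover have "(?A \<union> ?B) \<inter> cross_edges = {}"
      by (auto simp: cross_edges_def)
    ultimately have "?n (N1 \<union> N2) = card (?A \<union> ?B) + card cross_edges"
      using fin by (simp add: card_Un_disjoint)
    moreover have "?A \<inter> ?B = inner_edges" by (auto simp: inner_edges_def)
    ultimately show ?thesis using card_Un_Int[OF fin(1,2)] by simp
  qed
  ultimately show ?thesis by simp
qed

theorem joined_sum_3:
  "alt_sum E (\<lambda>X. of_bool (joined_in X \<and> rank V (ends ` X) = 3)) =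
     - (int (card F) - 2) * int (card (N1 \<inter> N2)) + int (card (N1 \<inter> N2) choose 2)
     - int (card cross_edges) + int (card inner_edges)"
proof -
  let ?p = "card (N1 \<inter> N2)"
  have c: "card (contracted ` E) = card F - ?p" "?p \<le> card F"
    using card_contracted by linarith+
  have "alt_sum E (\<lambda>X. of_bool (joined_in X \<and> rank V (ends ` X) = 3)) =
      int ((card F - ?p) choose 2) - int (card F choose 2) + int ?p
      + int (num_triangles F) - int (num_triangles (contracted ` E))"
    using joined_sum_Suc[of "\<lambda>X. 1" 2] joined_sum_2 rank_sums(3) contracted_rank_sums(2) c(1)
    by (simp add: numeral_3_eq_3 numeral_2_eq_2)
  then show ?thesis
    using triangles_contracted choose_two_diff[OF c(2)] by (simp add: algebra_simps)
qed

abbreviation "m f \<equiv> mult ends E f"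

text \<open>
  Used for the graph and for its contraction, whose edges at \<open>u2\<close> form the empty star.
\<close>

lemma single_edges:
  assumes "G = F0 \<union> star u1 M1 \<union> star u2 M2" "star u1 M1 \<inter> star u2 M2 = {}" "finite M1" "finite M2"
  shows "card {f \<in> G. P f} =
    card {f \<in> F0. P f} + card {x \<in> M1. P {u1, x}} + card {x \<in> M2. P {u2, x}}"
proof -
  have s: "{f \<in> star u M. P f} = star u {x \<in> M. P {u, x}}" for u M by (auto simp: star_def)
  have "{f \<in> G. P f} = {f \<in> F0. P f} \<union> {f \<in> star u1 M1. P f} \<union> {f \<in> star u2 M2. P f}"
    unfolding assms(1) by auto
  then have "card {f \<in> G. P f} =
      card {f \<in> F0. P f} + card {f \<in> star u1 M1. P f} + card {f \<in> star u2 M2. P f}"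
  proof -
    have "finite {f \<in> star u1 M1. P f}" "finite {f \<in> star u2 M2. P f}" "finite {f \<in> F0. P f}"
      using assms(3,4) finite_parts(1) by (auto simp: star_def)
    moreover have "{f \<in> F0. P f} \<inter> {f \<in> star u1 M1. P f} = {}"
      "({f \<in> F0. P f} \<union> {f \<in> star u1 M1. P f}) \<inter> {f \<in> star u2 M2. P f} = {}"
      using disjoint_stars(1)[of M1] disjoint_stars(2)[of M2] assms(2) by blast+
    ultimately show ?thesis
      using \<open>{f \<in> G. P f} = _\<close> by (simp add: card_Un_disjoint)
  qed
  then show ?thesis unfolding s card_star .
qed

lemma mult_contracted:
  "f \<in> F0 \<Longrightarrow> mult contracted E f = m f"
  "x \<in> N1 \<union> N2 \<Longrightarrow> mult contracted E {u1, x} = m {u1, x} + m {u2, x}"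
proof -
  have two: "\<exists>a b. ends e = {a, b}" if "e \<in> E" for e
    using card_F[of "ends e"] that by (auto simp: card_2_iff)
  show "mult contracted E f = m f" if "f \<in> F0"
  proof -
    have "{e \<in> E. contracted e = f} = {e \<in> E. ends e = f}"
    proof (intro Collect_cong conj_cong refl)
      fix e assume "e \<in> E"
      have f: "u1 \<notin> f" "u2 \<notin> f" using that by (simp_all add: F0_def)
      show "contracted e = f \<longleftrightarrow> ends e = f"
      proof (cases "u2 \<in> ends e")
        case True
        then have "contract u1 u2 u2 \<in> contracted e" by (rule imageI)
        then have "u1 \<in> contracted e" by (simp add: contract_def)
        then show ?thesis using True f by metis
      next
        case False
        then have "contracted e = id ` ends e" by (intro image_cong) (auto simp: contract_def)
        then show ?thesis by simp
      qed
    qed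
    then show ?thesis by (simp add: mult_def)
  qed
  show "mult contracted E {u1, x} = m {u1, x} + m {u2, x}" if x: "x \<in> N1 \<union> N2"
  proof -
    have xu: "x \<noteq> u1" "x \<noteq> u2" using x u_notin by auto
    have "{e \<in> E. contracted e = {u1, x}} = {e \<in> E. ends e = {u1, x}} \<union> {e \<in> E. ends e = {u2, x}}"
    proof (intro set_eqI iffI)
      fix e assume e: "e \<in> {e \<in> E. contracted e = {u1, x}}"
      then obtain a b where ab: "ends e = {a, b}" using two by blast
      have "{contract u1 u2 a, contract u1 u2 b} = {u1, x}" using e ab by simp
      then have cab: "contract u1 u2 a = u1 \<and> contract u1 u2 b = x \<or> contract u1 u2 a = x \<and> contract u1 u2 b = u1"
        by (simp add: doubleton_eq_iff)
      have x: "y = x" if "contract u1 u2 y = x" for y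
        using that xu by (simp add: contract_def split: if_splits)
      have u: "y = u1 \<or> y = u2" if "contract u1 u2 y = u1" for y
        using that by (simp add: contract_def split: if_splits)
      from cab have "a = x \<and> (b = u1 \<or> b = u2) \<or> b = x \<and> (a = u1 \<or> a = u2)"
        using x[of a] x[of b] u[of a] u[of b] by argo
      then have "ends e = {u1, x} \<or> ends e = {u2, x}"
        unfolding ab by (elim disjE conjE) (simp_all add: insert_commute)
      then show "e \<in> {e \<in> E. ends e = {u1, x}} \<union> {e \<in> E. ends e = {u2, x}}"
        using e by simp
    next
      fix e assume "e \<in> {e \<in> E. ends e = {u1, x}} \<union> {e \<in> E. ends e = {u2, x}}"
      then have "e \<in> E" "ends e = {u1, x} \<or> ends e = {u2, x}" by blast+
      then show "e \<in> {e \<in> E. contracted e = {u1, x}}"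
        using xu u_neq by (auto simp: contract_def)
    qed
    moreover have "{e \<in> E. ends e = {u1, x}} \<inter> {e \<in> E. ends e = {u2, x}} = {}"
      using u_neq by (auto simp: doubleton_eq_iff)
    ultimately show ?thesis using finite_E by (simp add: mult_def card_Un_disjoint)
  qed
qed

lemma mult_pos: "m f > 0 \<longleftrightarrow> f \<in> F"
  using finite_E by (auto simp: mult_def card_gt_0_iff)

text \<open>
  By \<open>joined_sum_Suc\<close> the left side is the number of simple edges of multiplicity 1 before
  contraction minus the number after it. A common neighbour of \<open>u1\<close> and \<open>u2\<close> is joined to the
  contracted vertex by at least two edges, so the two numbers only differ at common neighbours.
\<close>

theorem joined_card_sum_2:
  "alt_sum E (\<lambda>X. int (card X) * of_bool (joined_in X \<and> rank V (ends ` X) = 2)) =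
     int (card {x \<in> N1 \<inter> N2. m {u1, x} = 1}) + int (card {x \<in> N1 \<inter> N2. m {u2, x} = 1})"
proof -
  let ?m' = "mult contracted E"
  have in1: "x \<in> N1 \<longleftrightarrow> m {u1, x} > 0" and in2: "x \<in> N2 \<longleftrightarrow> m {u2, x} > 0" for x
    by (auto simp: mult_pos N1_def N2_def)
  have "contracted ` E = F0 \<union> star u1 (N1 \<union> N2) \<union> star u2 {}"
    by (simp add: contracted_eq star_def)
  from single_edges[OF this, of "\<lambda>f. ?m' f = 1"]
  have "card {f \<in> contracted ` E. ?m' f = 1} =
      card {f \<in> F0. ?m' f = 1} + card {x \<in> N1 \<union> N2. ?m' {u1, x} = 1}"
    using finite_N by (simp add: star_def)
  also have "{f \<in> F0. ?m' f = 1} = {f \<in> F0. m f = 1}" using mult_contracted(1) by auto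
  also have "{x \<in> N1 \<union> N2. ?m' {u1, x} = 1} =
      {x \<in> N1 - N2. m {u1, x} = 1} \<union> {x \<in> N2 - N1. m {u2, x} = 1}"
    using mult_contracted(2) in1 in2 by (auto; metis add_is_1 neq0_conv)
  also have "card \<dots> = card {x \<in> N1 - N2. m {u1, x} = 1} + card {x \<in> N2 - N1. m {u2, x} = 1}"
    using finite_N by (intro card_Un_disjoint) auto
  finally have 1: "card {f \<in> contracted ` E. ?m' f = 1} = card {f \<in> F0. m f = 1} +
      (card {x \<in> N1 - N2. m {u1, x} = 1} + card {x \<in> N2 - N1. m {u2, x} = 1})" .
  have 2: "card {f \<in> F. m f = 1} = card {f \<in> F0. m f = 1} +
      card {x \<in> N1. m {u1, x} = 1} + card {x \<in> N2. m {u2, x} = 1}"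
    by (rule single_edges[OF F_eq]) (use finite_N disjoint_stars in auto)
  have split: "card {x \<in> M. P x} = card {x \<in> M - N. P x} + card {x \<in> M \<inter> N. P x}"
    if "finite M" for M N :: "'v set" and P
  proof -
    have "{x \<in> M. P x} = {x \<in> M - N. P x} \<union> {x \<in> M \<inter> N. P x}" by auto
    then show ?thesis using that by (simp add: card_Un_disjoint disjoint_iff)
  qed
  have "alt_sum E (\<lambda>X. int (card X) * of_bool (joined_in X \<and> rank V (ends ` X) = 2)) =
      int (card {f \<in> F. m f = 1}) - int (card {f \<in> contracted ` E. ?m' f = 1})"
    using joined_sum_Suc[of "\<lambda>X. int (card X)" 1] joined_sum_1[of "\<lambda>X. int (card X)"]
      alt_sum_card_rank_1[OF finite_V finite_E ends_two]
      alt_sum_card_rank_1[OF finite_Diff[OF finite_V] finite_E contracted_two]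
    by (simp add: numeral_2_eq_2)
  then show ?thesis
    unfolding 1 2 using split[OF finite_N(1), of "\<lambda>x. m {u1, x} = 1" N2]
      split[OF finite_N(2), of "\<lambda>x. m {u2, x} = 1" N1] by (simp add: Int_commute)
qed

end

section \<open>The state sum\<close>

text \<open>
  The factor contributed by a split circle.
\<close>

definition \<delta> :: laurent where
  "\<delta> = - A_pow 2 - A_pow (-2)"

text \<open>
  The pairs of labels that the two resolutions of a crossing join, and all pairs joined in the state
  that resolves the crossings with index in \<open>S\<close> by the B-resolution and the others by the
  A-resolution.
\<close>

fun A_pairs :: "'a crossing \<Rightarrow> ('a \<times> 'a) list" where
  "A_pairs (Crossing a b c d) = [(a, b), (c, d)]"

fun B_pairs :: "'a crossing \<Rightarrow> ('a \<times> 'a) list" where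
  "B_pairs (Crossing a b c d) = [(b, c), (d, a)]"

definition smoothing :: "nat set \<Rightarrow> 'a crossing list \<Rightarrow> ('a \<times> 'a) set" where
  "smoothing S xs = (\<Union>i<length xs. set (if i \<in> S then B_pairs (xs ! i) else A_pairs (xs ! i)))"

text \<open>
  A relabelling with a circle count \<open>(f, n)\<close> results from joining the pairs \<open>ps\<close> of labels in
  \<open>V\<close>: \<open>f\<close> identifies the connected labels, and each join within a component
  closes a circle, so that \<open>n\<close> is the cyclomatic number of the graph \<open>(V, ps)\<close>.
\<close>

fun tracks :: "'a set \<Rightarrow> ('a \<Rightarrow> 'a) \<times> nat \<Rightarrow> ('a \<times> 'a) list \<Rightarrow> bool" where
  "tracks V (f, n) ps \<longleftrightarrow> (\<forall>x y. f x = f y \<longleftrightarrow> (x, y) \<in> conn (set ps)) \<and>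
     n + card V = length ps + comps V (set ps)"

lemma tracks_jn:
  assumes "tracks V s ps" "finite V" "a \<in> V" "b \<in> V"
  shows "tracks V (jn (a, b) s) ((a, b) # ps)"
proof -
  obtain f n where s: "s = (f, n)" by (cases s)
  have f: "f x = f y \<longleftrightarrow> (x, y) \<in> conn (set ps)" for x y
    using assms(1) by (simp add: s)
  have fn: "n + card V = length ps + comps V (set ps)" using assms(1) by (simp add: s)
  have ins: "(x, y) \<in> conn (insert (a, b) (set ps)) \<longleftrightarrow>
      f x = f y \<or> f x = f a \<and> f b = f y \<or> f x = f b \<and> f a = f y" for x y
    unfolding conn_insert f[symmetric] ..
  have "int (comps V (insert (a, b) (set ps))) = int (comps V (set ps)) - (if f a = f b then 0 else 1)"
    using comps_insert[OF assms(2-4), of "set ps"] f by simp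
  then show ?thesis
    using fn unfolding s by (simp add: ins fun_upd_def) auto
qed

lemma tracks_jnA:
  assumes "tracks V s ps" "finite V" "set (arc_ends x) \<subseteq> V"
  shows "tracks V (jnA x s) (rev (A_pairs x) @ ps)" "tracks V (jnB x s) (rev (B_pairs x) @ ps)"
proof -
  obtain a b c d where x: "x = Crossing a b c d" by (cases x)
  show "tracks V (jnA x s) (rev (A_pairs x) @ ps)" "tracks V (jnB x s) (rev (B_pairs x) @ ps)"
    using assms unfolding x jnA_def jnB_def
    by (simp_all add: tracks_jn del: jn.simps tracks.simps)
qed

lemma smoothing_snoc:
  assumes "S \<subseteq> {..<length xs}"
  shows "smoothing S (xs @ [x]) = smoothing S xs \<union> set (A_pairs x)"
    and "smoothing (insert (length xs) S) (xs @ [x]) = smoothing S xs \<union> set (B_pairs x)"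
proof -
  have "length xs \<notin> S" using assms by auto
  have init: "(\<Union>i<length xs. set (if i \<in> T then B_pairs ((xs @ [x]) ! i) else A_pairs ((xs @ [x]) ! i)))
      = smoothing S xs" if "T = S \<or> T = insert (length xs) S" for T
    unfolding smoothing_def
  proof (intro SUP_cong refl)
    fix i assume "i \<in> {..<length xs}"
    then have "(xs @ [x]) ! i = xs ! i" "i \<in> T \<longleftrightarrow> i \<in> S" using that by (auto simp: nth_append)
    then show "set (if i \<in> T then B_pairs ((xs @ [x]) ! i) else A_pairs ((xs @ [x]) ! i)) =
        set (if i \<in> S then B_pairs (xs ! i) else A_pairs (xs ! i))" by simp
  qed
  show "smoothing S (xs @ [x]) = smoothing S xs \<union> set (A_pairs x)"
    "smoothing (insert (length xs) S) (xs @ [x]) = smoothing S xs \<union> set (B_pairs x)"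
    unfolding smoothing_def[of _ "xs @ [x]"] length_append_singleton lessThan_Suc UN_insert
    using init[of S] init[of "insert (length xs) S"] \<open>length xs \<notin> S\<close> by (simp_all add: Un_commute)
qed

text \<open>
  The exponent of \<open>\<delta>\<close> is the cyclomatic number after all joins, minus 1.
\<close>

lemma bracket_tracks:
  assumes "finite V" "tracks V s ps" "set (arc_labels xs) \<subseteq> V"
  shows "bracket (apply_joins s xs) = (\<Sum>S\<in>Pow {..<length xs}.
    A_pow (int (length xs) - 2 * int (card S)) *
    \<delta> ^ (length ps + 2 * length xs + comps V (set ps \<union> smoothing S xs) - card V - 1))"
  using assms(2,3)
proof (induction xs arbitrary: s ps rule: rev_induct)
  case Nil
  obtain f n where s: "s = (f, n)" by (cases s)
  have "n + card V = length ps + comps V (set ps)" using Nil(1) by (simp add: s)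
  then have "n = length ps + comps V (set ps) - card V" by linarith
  then show ?case by (simp add: s bracket.simps smoothing_def A_pow_0 \<delta>_def)
next
  case (snoc x xs)
  let ?n = "length xs"
  let ?e = "\<lambda>S K. length ps + 2 * length (xs @ [x]) + K - card V - 1"
  have V: "set (arc_labels xs) \<subseteq> V" "set (arc_ends x) \<subseteq> V"
    using snoc.prems(2) by (auto simp: arc_labels_def)
  have len: "length (A_pairs x) = 2" "length (B_pairs x) = 2" by (cases x; simp)+
  have A: "bracket (apply_joins (jnA x s) xs) = (\<Sum>S\<in>Pow {..<?n}. A_pow (int ?n - 2 * int (card S)) *
      \<delta> ^ (length ps + 2 * length (xs @ [x]) + comps V (set ps \<union> smoothing S (xs @ [x])) - card V - 1))"
    unfolding snoc.IH[OF tracks_jnA(1)[OF snoc.prems(1) assms(1) V(2)] V(1)]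
    by (intro sum.cong refl) (simp add: smoothing_snoc len ac_simps)
  have B: "bracket (apply_joins (jnB x s) xs) = (\<Sum>S\<in>Pow {..<?n}. A_pow (int ?n - 2 * int (card S)) *
      \<delta> ^ (length ps + 2 * length (xs @ [x]) + comps V (set ps \<union> smoothing (insert ?n S) (xs @ [x])) - card V - 1))"
    unfolding snoc.IH[OF tracks_jnA(2)[OF snoc.prems(1) assms(1) V(2)] V(1)]
    by (intro sum.cong refl) (simp add: smoothing_snoc len ac_simps)
  have "bracket (apply_joins s (xs @ [x])) =
      A_pow 1 * bracket (apply_joins (jnA x s) xs) + A_pow (-1) * bracket (apply_joins (jnB x s) xs)"
    using bracket_skein_joins[of ?n "xs @ [x]" s] by simp
  also have "\<dots> = (\<Sum>S\<in>Pow (insert ?n {..<?n}). A_pow (int (length (xs @ [x])) - 2 * int (card S)) *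
      \<delta> ^ (length ps + 2 * length (xs @ [x]) + comps V (set ps \<union> smoothing S (xs @ [x])) - card V - 1))"
    unfolding A B sum_distrib_left sum.distrib[symmetric] mult.assoc[symmetric] A_pow_add[symmetric]
  proof (subst sum_Pow_insert; (intro sum.cong refl)?)
    fix S assume S: "S \<in> Pow {..<?n}"
    then have c: "card (insert ?n S) = Suc (card S)"
      using finite_subset[of S "{..<?n}"] by (subst card_insert_disjoint) auto
    have e: "1 + (int ?n - 2 * int (card S)) = int (length (xs @ [x])) - 2 * int (card S)"
      "- 1 + (int ?n - 2 * int (card S)) = int (length (xs @ [x])) - 2 * int (card (insert ?n S))"
      unfolding c by simp_all
    show "A_pow (1 + (int ?n - 2 * int (card S))) *
          \<delta> ^ (length ps + 2 * length (xs @ [x]) + comps V (set ps \<union> smoothing S (xs @ [x])) - card V - 1) +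
        A_pow (- 1 + (int ?n - 2 * int (card S))) *
          \<delta> ^ (length ps + 2 * length (xs @ [x]) + comps V (set ps \<union> smoothing (insert ?n S) (xs @ [x])) - card V - 1) =
        A_pow (int (length (xs @ [x])) - 2 * int (card S)) *
          \<delta> ^ (length ps + 2 * length (xs @ [x]) + comps V (set ps \<union> smoothing S (xs @ [x])) - card V - 1) +
        A_pow (int (length (xs @ [x])) - 2 * int (card (insert ?n S))) *
          \<delta> ^ (length ps + 2 * length (xs @ [x]) + comps V (set ps \<union> smoothing (insert ?n S) (xs @ [x])) - card V - 1)"
      unfolding e by (rule refl)
  qed simp_all
  finally show ?case by (simp add: lessThan_Suc)
qed

lemma card_arc_labels:
  assumes "well_formed D"
  shows "card (set (arc_labels (crossings D))) = 2 * num_crossings D"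
proof -
  let ?l = "arc_labels (crossings D)"
  have "length ?l = (\<Sum>a\<in>set ?l. count_list ?l a)" by (simp add: sum_count_set)
  also have "\<dots> = (\<Sum>a\<in>set ?l. 2)" using assms by (intro sum.cong) (auto simp: well_formed_def)
  also have "\<dots> = 2 * card (set ?l)" by simp
  finally have "length ?l = 2 * card (set ?l)" .
  moreover have "length (arc_labels xs) = 4 * length xs" for xs :: "'a crossing list"
  proof (induction xs)
    case (Cons x xs)
    then show ?case by (cases x) (simp add: arc_labels_def)
  qed (simp add: arc_labels_def)
  ultimately show ?thesis by simp
qed

text \<open>
  There are as many labels as joined pairs, hence the number of circles of a state is the number of
  components of its joined labels.
\<close>

theorem bracket_state_sum:
  assumes "well_formed D" "circles D = 0"
  shows "bracket D = (\<Sum>S\<in>Pow {..<num_crossings D}. A_pow (int (num_crossings D) - 2 * int (card S)) *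
    \<delta> ^ (comps (set (arc_labels (crossings D))) (smoothing S (crossings D)) - 1))"
proof -
  let ?V = "set (arc_labels (crossings D))"
  have "tracks ?V (id, 0) []" by (simp add: conn_empty comps_empty)
  moreover have "D = apply_joins (id, 0) (crossings D)"
    using assms(2) by (metis apply_joins_id diagram.collapse)
  ultimately show ?thesis
    using bracket_tracks[of ?V "(id, 0)" "[]" "crossings D"] card_arc_labels[OF assms(1)] by simp
qed

section \<open>Circles of a state of a planar diagram\<close>

text \<open>
  The facts on orbits of permutations carry over to an injective map of a finite set into itself,
  whatever its values outside the set.
\<close>

lemma self_in_orbit_finite:
  assumes "finite A" "\<And>x. x \<in> A \<Longrightarrow> f x \<in> A" "inj_on f A" "x \<in> A"
  shows "x \<in> orbit f x" and "\<And>y. y \<in> orbit f x \<Longrightarrow> orbit f y = orbit f x"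
proof -
  define g where "g y = (if y \<in> A then f y else y)" for y
  have "bij_betw f A A"
    using assms(1-3) endo_inj_surj[of A f] by (simp add: bij_betw_def image_subsetI)
  then have gA: "g permutes A"
    unfolding g_def by (intro bij_imp_permutes) (auto cong: bij_betw_cong)
  have g: "permutation g" using gA assms(1) by (auto simp: permutation_permutes)
  have fg: "orbit f y = orbit g y" if "y \<in> A" for y
    using that assms(2) by (intro orbit_cong0[of _ A]) (auto simp: g_def)
  show "x \<in> orbit f x" using permutation_self_in_orbit[OF g, of x] fg[OF assms(4)] by simp
  fix y assume y: "y \<in> orbit f x"
  have "orbit f x \<subseteq> A"
  proof
    fix z assume "z \<in> orbit f x"
    then show "z \<in> A" by induction (use assms(2,4) in auto)
  qed
  then have "y \<in> A" using y by auto
  moreover have "orbit g y = orbit g x"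
    using orbit_cyclic_eq3[OF cyclic_on_orbit[OF gA assms(1)]] y fg[OF assms(4)] by simp
  ultimately show "orbit f y = orbit f x" using fg assms(4) by simp
qed

lemma less_4E:
  assumes "k < (4 :: nat)"
  obtains "k = 0" | "k = 1" | "k = 2" | "k = 3"
  using assms by linarith

lemma mate_unique:
  assumes "well_formed D" "x \<in> darts D" "y \<in> darts D" "y \<noteq> x" "dart_label D y = dart_label D x"
  shows "y = mate D x"
proof (rule ccontr)
  assume ne: "y \<noteq> mate D x"
  let ?S = "{z \<in> darts D. dart_label D z = dart_label D x}"
  have "{x, y, mate D x} \<subseteq> ?S" using assms mate_dart[OF assms(1,2)] by auto
  moreover have "finite ?S" using finite_darts[of D] by simp
  ultimately have "card {x, y, mate D x} \<le> card ?S" by (intro card_mono) auto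
  moreover have "card {x, y, mate D x} = 3" using assms(4) ne mate_dart(2)[OF assms(1,2)] by auto
  moreover have "x \<in> ?S" using assms(2) by simp
  then have "card ?S \<noteq> 0" using \<open>finite ?S\<close> by (metis card_0_eq empty_iff)
  then have "card ?S = 2"
    using assms(1) unfolding card_darts_label well_formed_def by (metis count_list_0_iff)
  ultimately show False by simp
qed

lemma mate_mate:
  assumes "well_formed D" "x \<in> darts D"
  shows "mate D (mate D x) = x"
  using mate_unique[OF assms(1) mate_dart(1)[OF assms] assms(2)] mate_dart[OF assms] by auto

text \<open>
  The corner on the other side of the arc end \<open>x\<close>, which is the corner preceding \<open>x\<close> at the
  same crossing.
\<close>

definition prev_corner :: "nat \<times> nat \<Rightarrow> nat \<times> nat" where
  "prev_corner x = (fst x, (snd x + 3) mod 4)"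

lemma next_corner_eq: "next_corner D x = prev_corner (mate D x)"
  by (simp add: next_corner_def prev_corner_def split: prod.split)

lemma prev_corner_dart: "x \<in> darts D \<Longrightarrow> prev_corner x \<in> darts D"
  by (auto simp: prev_corner_def darts_def)

lemma inj_prev_corner: "inj_on prev_corner (darts D)"
proof (rule inj_onI)
  fix x y assume "x \<in> darts D" "y \<in> darts D" "prev_corner x = prev_corner y"
  then show "x = y" unfolding prev_corner_def darts_def
    by (cases x; cases y) (auto elim!: less_4E)
qed

lemma region_facts:
  assumes "well_formed D" "x \<in> darts D"
  shows next_corner_dart: "next_corner D x \<in> darts D"
    and self_in_region: "x \<in> region_at D x"
    and region_at_eq: "\<And>y. y \<in> region_at D x \<Longrightarrow> region_at D y = region_at D x"
proof -
  have next_in: "next_corner D y \<in> darts D" if "y \<in> darts D" for y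
    unfolding next_corner_eq using that mate_dart(1)[OF assms(1)] by (intro prev_corner_dart)
  have "inj_on (next_corner D) (darts D)"
  proof (rule inj_onI)
    fix y z assume yz: "y \<in> darts D" "z \<in> darts D" "next_corner D y = next_corner D z"
    then have "mate D y = mate D z"
      unfolding next_corner_eq using inj_prev_corner mate_dart(1)[OF assms(1)]
      by (meson inj_onD)
    then show "y = z" using mate_mate[OF assms(1)] yz by metis
  qed
  note orb = self_in_orbit_finite[OF finite_darts next_in this assms(2)]
  show "next_corner D x \<in> darts D" by (rule next_in[OF assms(2)])
  show "x \<in> region_at D x" "\<And>y. y \<in> region_at D x \<Longrightarrow> region_at D y = region_at D x"
    unfolding region_at_def using orb by blast+
qed

lemma card_less_4: "card {k. k < (4 :: nat) \<and> P k} =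
  of_bool (P 0) + of_bool (P 1) + of_bool (P 2) + of_bool (P 3)"
proof -
  have "{k. k < (4 :: nat) \<and> P k} = {..<4} \<inter> {k. P k}" by auto
  then have "card {k. k < (4 :: nat) \<and> P k} = (\<Sum>k<4. of_bool (P k))"
    by simp
  also have "\<dots> = of_bool (P 0) + of_bool (P 1) + of_bool (P 2) + of_bool (P 3)"
    by (simp add: numeral_eq_Suc)
  finally show ?thesis .
qed

lemma Collect_less_4: "{f k | k. k < (4 :: nat) \<and> P k} =
  (if P 0 then {f 0} else {}) \<union> (if P 1 then {f 1} else {}) \<union>
  (if P 2 then {f 2} else {}) \<union> (if P 3 then {f 3} else {})"
proof (intro set_eqI iffI)
  fix x assume "x \<in> {f k | k. k < (4 :: nat) \<and> P k}"
  then obtain k where k: "x = f k" "k < 4" "P k" by blast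
  from k(2) show "x \<in> (if P 0 then {f 0} else {}) \<union> (if P 1 then {f 1} else {}) \<union>
      (if P 2 then {f 2} else {}) \<union> (if P 3 then {f 3} else {})"
    by (cases rule: less_4E) (use k in simp_all)
next
  fix x assume "x \<in> (if P 0 then {f 0} else {}) \<union> (if P 1 then {f 1} else {}) \<union>
      (if P 2 then {f 2} else {}) \<union> (if P 3 then {f 3} else {})"
  then consider "x = f 0" "P 0" | "x = f 1" "P 1" | "x = f 2" "P 2" | "x = f 3" "P 3"
    by (auto split: if_splits)
  then show "x \<in> {f k | k. k < (4 :: nat) \<and> P k}" by cases force+
qed

text \<open>
  \<open>R\<close> is one of the two colour classes of regions. The other one satisfies the same
  assumptions.
\<close>

locale shaded_diagram =
  fixes D :: "'a diagram" and R :: "region set"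
  assumes link: "connected_link_diagram D" and shading: "checkerboard_shading D R"
begin

abbreviation "n \<equiv> num_crossings D"
abbreviation "L \<equiv> set (arc_labels (crossings D))"
abbreviation "lab \<equiv> dart_label D"
abbreviation "reg \<equiv> region_at D"

lemma wf: "well_formed D" using link by (simp add: connected_link_diagram_def)

text \<open>
  The endpoints of the edge of crossing \<open>i\<close> in the checkerboard graph on \<open>R\<close>.
\<close>

definition ends :: "nat \<Rightarrow> region set" where
  "ends i = {reg (i, k) | k. k < 4} \<inter> R"

lemma dart_iff: "(i, k) \<in> darts D \<longleftrightarrow> i < n \<and> k < 4"
  by (auto simp: darts_def)

lemma labels_eq: "L = lab ` darts D"
proof -
  have "a \<in> L \<longleftrightarrow> (\<exists>x\<in>darts D. lab x = a)" for a
  proof -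
    have "a \<in> L \<longleftrightarrow> card {x \<in> darts D. lab x = a} \<noteq> 0"
      unfolding card_darts_label by (metis count_list_0_iff)
    also have "\<dots> \<longleftrightarrow> (\<exists>x\<in>darts D. lab x = a)" using finite_darts[of D] by auto
    finally show ?thesis .
  qed
  then show ?thesis by auto
qed

lemma reg_in_regions: "x \<in> darts D \<Longrightarrow> reg x \<in> regions D"
  by (simp add: regions_def)

lemma R_sub: "R \<subseteq> regions D" using shading by (simp add: checkerboard_shading_def)

lemma finite_regions: "finite (regions D)" by (simp add: regions_def finite_darts)

lemma finite_R: "finite R" using R_sub finite_regions finite_subset by blast

lemma R_corner: "x \<in> darts D \<Longrightarrow> reg x \<in> R \<longleftrightarrow> reg (prev_corner x) \<notin> R"
  using shading by (auto simp: checkerboard_shading_def prev_corner_def)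

lemma R_corner_parity:
  assumes "i < n" "k < 4"
  shows "reg (i, k) \<in> R \<longleftrightarrow> (reg (i, 0) \<in> R \<longleftrightarrow> even k)"
proof -
  have s: "reg (i, Suc j) \<in> R \<longleftrightarrow> reg (i, j) \<notin> R" if "Suc j < 4" for j
    using R_corner[of "(i, Suc j)"] that assms(1) by (simp add: dart_iff prev_corner_def)
  from assms(2) show ?thesis by (induction k) (use s in auto)
qed

lemma reg_prev_mate: "x \<in> darts D \<Longrightarrow> reg (prev_corner (mate D x)) = reg x"
  using region_at_eq[OF wf] self_in_region[OF wf] next_corner_eq[of D x]
  by (metis orbit.base region_at_def)

lemma reg_mate: "x \<in> darts D \<Longrightarrow> reg (mate D x) = reg (prev_corner x)"
  using reg_prev_mate[OF mate_dart(1)[OF wf]] mate_mate[OF wf] by metis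

text \<open>
  The region in \<open>R\<close> beside the arc at the arc end \<open>x\<close>; of the two regions on the sides of
  an arc, exactly one is in \<open>R\<close>. It is the same at both ends, and \<open>arc_side\<close> is the
  corresponding function of the label.
\<close>

definition side :: "nat \<times> nat \<Rightarrow> region" where
  "side x = (if reg x \<in> R then reg x else reg (prev_corner x))"

lemma side_in_R: "x \<in> darts D \<Longrightarrow> side x \<in> R"
  using R_corner by (auto simp: side_def)

lemma side_mate: "x \<in> darts D \<Longrightarrow> side (mate D x) = side x"
  using R_corner[of x] reg_mate reg_prev_mate by (auto simp: side_def)

definition arc_side :: "'a \<Rightarrow> region" where
  "arc_side a = side (SOME x. x \<in> darts D \<and> lab x = a)"

lemma arc_side_label: "x \<in> darts D \<Longrightarrow> arc_side (lab x) = side x"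
proof -
  assume x: "x \<in> darts D"
  define y where "y = (SOME y. y \<in> darts D \<and> lab y = lab x)"
  have y: "y \<in> darts D" "lab y = lab x"
    using someI[of "\<lambda>y. y \<in> darts D \<and> lab y = lab x" x] x by (simp_all add: y_def)
  then have "y = x \<or> y = mate D x" using mate_unique[OF wf x y(1) _ y(2)] by blast
  then have "side y = side x" using side_mate[OF x] by metis
  then show ?thesis by (simp only: arc_side_def y_def)
qed

text \<open>
  The labels joined in the state that merges, at the crossings in \<open>H\<close>, the two corners belonging
  to \<open>R\<close> and, at the others, the two corners not in \<open>R\<close>. The ends next to a
  corner \<open>k\<close> are joined when that corner is not merged. \<open>state_of H\<close> lists the B-resolved
  crossings of this state, because the B-resolution merges the corners 0 and 2.
\<close>

definition merged_pairs :: "nat set \<Rightarrow> ('a \<times> 'a) set" where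
  "merged_pairs H = {(lab (i, k), lab (i, (k + 1) mod 4)) | i k.
     i < n \<and> k < 4 \<and> (reg (i, k) \<in> R \<longleftrightarrow> i \<notin> H)}"

definition state_of :: "nat set \<Rightarrow> nat set" where
  "state_of H = {i. i < n \<and> (i \<in> H \<longleftrightarrow> reg (i, 0) \<in> R)}"

lemma smoothing_state_of: "smoothing (state_of H) (crossings D) = merged_pairs H"
proof -
  have s: "set (if i \<in> state_of H then B_pairs (crossings D ! i) else A_pairs (crossings D ! i)) =
      {(lab (i, k), lab (i, (k + 1) mod 4)) | k. k < 4 \<and> (reg (i, k) \<in> R \<longleftrightarrow> i \<notin> H)}" if "i < n" for i
  proof -
    obtain a b c d where x: "crossings D ! i = Crossing a b c d" by (cases "crossings D ! i")
    have st: "i \<in> state_of H \<longleftrightarrow> (i \<in> H \<longleftrightarrow> reg (i, 0) \<in> R)" using that by (simp add: state_of_def)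
    have l: "lab (i, 0) = a" "lab (i, Suc 0) = b" "lab (i, 2) = c" "lab (i, 3) = d"
      "lab (i, Suc (Suc 0)) = c"
      by (simp_all add: dart_label_def x)
    have r: "reg (i, Suc 0) \<in> R \<longleftrightarrow> reg (i, 0) \<notin> R" "reg (i, 2) \<in> R \<longleftrightarrow> reg (i, 0) \<in> R"
      "reg (i, 3) \<in> R \<longleftrightarrow> reg (i, 0) \<notin> R"
      using R_corner_parity[OF that, of 1] R_corner_parity[OF that, of 2] R_corner_parity[OF that, of 3]
      by auto
    show ?thesis
      unfolding st Collect_less_4[of "\<lambda>k. (lab (i, k), lab (i, (k + 1) mod 4))"] by (simp add: x l r insert_commute)
  qed
  have "smoothing (state_of H) (crossings D) = (\<Union>i<n.
      {(lab (i, k), lab (i, (k + 1) mod 4)) | k. k < 4 \<and> (reg (i, k) \<in> R \<longleftrightarrow> i \<notin> H)})"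
    unfolding smoothing_def by (intro SUP_cong refl s) simp
  also have "\<dots> = merged_pairs H" unfolding merged_pairs_def by blast
  finally show ?thesis .
qed

end

lemma mod_4_simps:
  assumes "k < (4 :: nat)"
  shows "((k + 1) mod 4 + 3) mod 4 = k" "((k + 3) mod 4 + 2) mod 4 = (k + 1) mod 4"
    "((k + 3) mod 4 + 1) mod 4 = k"
  using assms by (auto elim!: less_4E)

text \<open>
  The two smoothings of a crossing with arc ends \<open>a\<close>, \<open>b\<close>, \<open>c\<close>, \<open>d\<close> are compared by
  joining all four ends. The second part is the case where two different circles pass the crossing:
  the other smoothing merges them.
\<close>

lemma comps_smoothing_change:
  assumes "finite V" "{a, b, c, d} \<subseteq> V"
  shows "comps V (J \<union> {(b, c), (d, a)}) \<le> Suc (comps V (J \<union> {(a, b), (c, d)}))"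
    and "(a, b) \<in> conn J \<Longrightarrow> (c, d) \<in> conn J \<Longrightarrow> (a, c) \<notin> conn (J \<union> {(a, b), (c, d)}) \<Longrightarrow>
      comps V (J \<union> {(a, b), (c, d)}) = Suc (comps V (J \<union> {(b, c), (d, a)}))"
proof -
  define A where "A = J \<union> {(a, b), (c, d)}"
  define B where "B = J \<union> {(b, c), (d, a)}"
  define M where "M = J \<union> {(a, b), (c, d), (b, c), (d, a)}"
  have in_V: "a \<in> V" "b \<in> V" "c \<in> V" "d \<in> V" using assms(2) by auto
  have conn_M: "(x, y) \<in> conn S" if "(x, y) \<in> S" for x y and S :: "('a \<times> 'a) set"
    using that by (rule conn_base)
  \<comment> \<open>one more pair beyond either smoothing connects all four ends\<close>
  have "comps V M = comps V (insert (b, c) A)"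
  proof -
    have "(c, d) \<in> conn (insert (b, c) A)" "(b, c) \<in> conn (insert (b, c) A)"
      "(a, b) \<in> conn (insert (b, c) A)"
      by (auto simp: A_def intro!: conn_base)
    then have "(d, a) \<in> conn (insert (b, c) A)" by (meson conn_sym conn_trans)
    from comps_insert_same[OF this, of V] show ?thesis
      by (simp add: M_def A_def insert_commute)
  qed
  then have MA: "comps V M = (if (b, c) \<in> conn A then comps V A else comps V A - 1)"
    "(b, c) \<notin> conn A \<Longrightarrow> comps V A = Suc (comps V M)"
    using comps_insert_same[of b c A V] comps_insert_diff[OF assms(1) in_V(2,3), of A] by auto
  have MB': "comps V M = comps V (insert (a, b) B)"
  proof -
    have "(b, c) \<in> conn (insert (a, b) B)" "(a, b) \<in> conn (insert (a, b) B)"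
      "(d, a) \<in> conn (insert (a, b) B)"
      by (auto simp: B_def intro!: conn_base)
    then have "(c, d) \<in> conn (insert (a, b) B)" by (meson conn_sym conn_trans)
    from comps_insert_same[OF this, of V] show ?thesis
      by (simp add: M_def B_def insert_commute)
  qed
  have "comps V B \<le> Suc (comps V M)"
    unfolding MB' using comps_insert_same[of a b B V] comps_insert_diff[OF assms(1) in_V(1,2), of B]
    by (cases "(a, b) \<in> conn B") auto
  moreover have "comps V M \<le> comps V A"
    unfolding M_def A_def by (rule comps_antimono[OF assms(1)]) auto
  ultimately show "comps V (J \<union> {(b, c), (d, a)}) \<le> Suc (comps V (J \<union> {(a, b), (c, d)}))"
    unfolding A_def[symmetric] B_def[symmetric] by simp
  assume ab: "(a, b) \<in> conn J" and cd: "(c, d) \<in> conn J" and ac: "(a, c) \<notin> conn (J \<union> {(a, b), (c, d)})"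
  have "(a, b) \<in> conn A" by (rule conn_base) (simp add: A_def)
  then have "(b, c) \<notin> conn A" using ac unfolding A_def[symmetric] by (blast intro: conn_trans)
  moreover have "(a, b) \<in> conn B" using ab conn_mono[of J B] by (auto simp: B_def)
  then have "comps V M = comps V B" unfolding MB' by (rule comps_insert_same)
  ultimately show "comps V (J \<union> {(a, b), (c, d)}) = Suc (comps V (J \<union> {(b, c), (d, a)}))"
    using MA(2) unfolding A_def[symmetric] B_def[symmetric] by simp
qed

context shaded_diagram
begin

lemma ends_eq:
  assumes "i < n" "k < 4" "reg (i, k) \<in> R"
  shows "ends i = {reg (i, k), reg (i, (k + 2) mod 4)}"
proof -
  have r: "reg (i, Suc 0) \<in> R \<longleftrightarrow> reg (i, 0) \<notin> R" "reg (i, 2) \<in> R \<longleftrightarrow> reg (i, 0) \<in> R"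
    "reg (i, 3) \<in> R \<longleftrightarrow> reg (i, 0) \<notin> R"
    using R_corner_parity[OF assms(1), of 1] R_corner_parity[OF assms(1), of 2]
      R_corner_parity[OF assms(1), of 3] by auto
  have "ends i = {reg (i, k) | k. k < 4 \<and> reg (i, k) \<in> R}" by (auto simp: ends_def)
  also have "\<dots> = {reg (i, k), reg (i, (k + 2) mod 4)}"
    unfolding Collect_less_4[of "\<lambda>k. reg (i, k)"] using assms(2,3)
    by (cases rule: less_4E[OF assms(2)]) (simp_all add: r insert_commute flip: numeral_2_eq_2)
  finally show ?thesis .
qed

lemma next_not_in_R:
  assumes "i < n" "k < 4"
  shows "prev_corner (i, (k + 1) mod 4) = (i, k)"
    and "reg (i, (k + 1) mod 4) \<in> R \<longleftrightarrow> reg (i, k) \<notin> R"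
proof -
  show p: "prev_corner (i, (k + 1) mod 4) = (i, k)"
    using mod_4_simps(1)[OF assms(2)] by (simp add: prev_corner_def)
  show "reg (i, (k + 1) mod 4) \<in> R \<longleftrightarrow> reg (i, k) \<notin> R"
    using R_corner[of "(i, (k + 1) mod 4)"] assms(1) unfolding p by (simp add: dart_iff)
qed

text \<open>
  A circle of the state \<open>H\<close> runs along a single component of the subgraph \<open>H\<close>.
\<close>

lemma arc_side_merged:
  assumes "(x, y) \<in> conn (merged_pairs H)"
  shows "(arc_side x, arc_side y) \<in> conn (links (ends ` H))"
  using assms
proof (rule conn_least[where E = "\<lambda>x y. (arc_side x, arc_side y) \<in> conn (links (ends ` H))"])
  fix x y assume "(x, y) \<in> merged_pairs H"
  then obtain i k where ik: "x = lab (i, k)" "y = lab (i, (k + 1) mod 4)" "i < n" "k < 4"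
    "reg (i, k) \<in> R \<longleftrightarrow> i \<notin> H" unfolding merged_pairs_def by blast
  note nxt = next_not_in_R[OF ik(3,4)]
  have s: "arc_side x = side (i, k)" "arc_side y = side (i, (k + 1) mod 4)"
    unfolding ik(1,2) using ik(3,4) by (simp_all add: arc_side_label dart_iff)
  show "(arc_side x, arc_side y) \<in> conn (links (ends ` H))"
  proof (cases "reg (i, k) \<in> R")
    case True
    then have "side (i, k) = side (i, (k + 1) mod 4)" using nxt unfolding side_def by simp
    then show ?thesis unfolding s by simp
  next
    case False
    then have "i \<in> H" using ik(5) by simp
    have p: "reg (i, (k + 3) mod 4) \<in> R"
      using False R_corner[of "(i, k)"] ik(3,4) by (simp add: dart_iff prev_corner_def)
    have "ends i = {reg (i, (k + 3) mod 4), reg (i, (k + 1) mod 4)}"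
      using ends_eq[OF ik(3) _ p] mod_4_simps(2)[OF ik(4)] by simp
    moreover have "side (i, k) = reg (i, (k + 3) mod 4)" "side (i, (k + 1) mod 4) = reg (i, (k + 1) mod 4)"
      using False nxt(2) by (simp_all add: side_def prev_corner_def)
    ultimately have "{side (i, k), side (i, (k + 1) mod 4)} \<in> ends ` H"
      using imageI[OF \<open>i \<in> H\<close>, of ends] by simp
    then show ?thesis unfolding s by (intro conn_base) (simp add: links_def)
  qed
qed (rule conn_refl | erule conn_sym | erule (1) conn_trans)+

lemma region_arcs_joined:
  assumes "z \<in> darts D" "reg z \<in> R" "w \<in> reg z"
  shows "w \<in> darts D \<and> reg w = reg z \<and> (lab z, lab w) \<in> conn (merged_pairs {})"
proof -
  have step: "next_corner D w \<in> darts D \<and> reg (next_corner D w) = reg z \<and>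
      (lab z, lab (next_corner D w)) \<in> conn (merged_pairs {})"
    if w: "w \<in> darts D" "reg w = reg z" "(lab z, lab w) \<in> conn (merged_pairs {})" for w
  proof -
    obtain j l where m: "mate D w = (j, l)" by (cases "mate D w")
    have jl: "j < n" "l < 4" using mate_dart(1)[OF wf w(1)] m by (simp_all add: dart_iff)
    have nw: "next_corner D w = (j, (l + 3) mod 4)" by (simp add: next_corner_def m)
    have r: "reg (next_corner D w) = reg z"
      using reg_prev_mate[OF w(1)] w(2) by (simp add: next_corner_eq)
    have "(lab (j, (l + 3) mod 4), lab (j, ((l + 3) mod 4 + 1) mod 4)) \<in> merged_pairs {}"
      unfolding merged_pairs_def using jl r assms(2) unfolding nw by force
    then have "(lab (next_corner D w), lab (mate D w)) \<in> conn (merged_pairs {})"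
      unfolding nw m mod_4_simps(3)[OF jl(2)] by (rule conn_base)
    then have "(lab z, lab (next_corner D w)) \<in> conn (merged_pairs {})"
      using w(3) unfolding mate_dart(3)[OF wf w(1)] by (blast intro: conn_sym conn_trans)
    then show ?thesis using r next_corner_dart[OF wf w(1)] by simp
  qed
  from assms(3) show ?thesis
    unfolding region_at_def[of D z]
    by (induction rule: orbit.induct) (use step[of z] step assms(1) in \<open>simp add: region_at_def\<close>)+
qed

text \<open>
  If no two regions of \<open>R\<close> are merged, then each circle runs around one region of \<open>R\<close>.
\<close>

lemma comps_merged_empty: "comps L (merged_pairs {}) = card R"
proof -
  have rep: "\<exists>z\<in>darts D. reg z = side x \<and> (lab x, lab z) \<in> conn (merged_pairs {})"
    if x: "x \<in> darts D" for x
  proof (cases "reg x \<in> R")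
    case True
    then show ?thesis using x by (intro bexI[of _ x]) (simp_all add: side_def)
  next
    case False
    obtain i k where ik: "x = (i, k)" by (cases x)
    have k: "i < n" "k < 4" using x ik by (simp_all add: dart_iff)
    have p: "reg (prev_corner x) \<in> R" using R_corner[OF x] False by simp
    have "(lab (prev_corner x), lab (i, ((k + 3) mod 4 + 1) mod 4)) \<in> merged_pairs {}"
      unfolding merged_pairs_def using k p unfolding ik prev_corner_def by force
    then have "(lab (prev_corner x), lab x) \<in> conn (merged_pairs {})"
      unfolding mod_4_simps(3)[OF k(2)] ik by (rule conn_base)
    then show ?thesis
      using False prev_corner_dart[OF x] conn_sym by (intro bexI[of _ "prev_corner x"]) (auto simp: side_def)
  qed
  have "comps L (merged_pairs {}) = card (arc_side ` L)"
  proof (rule comps_eqI)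
    fix a b assume "a \<in> L" "b \<in> L"
    then obtain x y where xy: "x \<in> darts D" "a = lab x" "y \<in> darts D" "b = lab y"
      unfolding labels_eq by auto
    show "(a, b) \<in> conn (merged_pairs {}) \<longleftrightarrow> arc_side a = arc_side b"
    proof
      assume "(a, b) \<in> conn (merged_pairs {})"
      from arc_side_merged[OF this] show "arc_side a = arc_side b" by (simp add: conn_empty)
    next
      assume eq: "arc_side a = arc_side b"
      obtain z where z: "z \<in> darts D" "reg z = side x" "(lab x, lab z) \<in> conn (merged_pairs {})"
        using rep[OF xy(1)] by blast
      obtain w where w: "w \<in> darts D" "reg w = side y" "(lab y, lab w) \<in> conn (merged_pairs {})"
        using rep[OF xy(3)] by blast
      have "reg w = reg z" using eq z(2) w(2) xy by (simp add: arc_side_label)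
      then have "w \<in> reg z" using self_in_region[OF wf w(1)] by simp
      then have "(lab z, lab w) \<in> conn (merged_pairs {})"
        using region_arcs_joined[OF z(1), of w] z(2) side_in_R[OF xy(1)] by simp
      then show "(a, b) \<in> conn (merged_pairs {})"
        unfolding xy(2,4) using z(3) w(3) by (meson conn_sym conn_trans)
    qed
  qed
  also have "arc_side ` L = R"
  proof (intro equalityI subsetI)
    fix r assume "r \<in> arc_side ` L"
    then obtain x where "x \<in> darts D" "r = side x" unfolding labels_eq by (auto simp: arc_side_label)
    then show "r \<in> R" using side_in_R by simp
  next
    fix r assume r: "r \<in> R"
    then obtain x where x: "x \<in> darts D" "r = reg x" using R_sub by (auto simp: regions_def)
    then have "arc_side (lab x) = r" using r by (simp add: arc_side_label side_def)
    moreover have "lab x \<in> L" using x(1) unfolding labels_eq by simp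
    ultimately show "r \<in> arc_side ` L" by blast
  qed
  finally show ?thesis .
qed

lemma complement: "shaded_diagram D (regions D - R)"
proof
  show "checkerboard_shading D (regions D - R)"
    unfolding checkerboard_shading_def
  proof (intro conjI ballI)
    fix x assume x: "x \<in> darts D"
    then have "reg x \<in> regions D" "reg (prev_corner x) \<in> regions D"
      by (simp_all add: reg_in_regions prev_corner_dart)
    then show "case x of (i, k) \<Rightarrow>
        (reg (i, k) \<in> regions D - R) = (reg (i, (k + 3) mod 4) \<notin> regions D - R)"
      using R_corner[OF x] by (auto simp: prev_corner_def split: prod.split)
  qed simp
qed (rule link)

lemma merged_pairs_complement:
  "shaded_diagram.merged_pairs D (regions D - R) ({..<n} - H) = merged_pairs H"
proof -
  interpret C: shaded_diagram D "regions D - R" by (rule complement)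
  have "C.merged_pairs ({..<n} - H) = {(lab (i, k), lab (i, (k + 1) mod 4)) | i k.
     i < n \<and> k < 4 \<and> (reg (i, k) \<in> regions D - R \<longleftrightarrow> i \<notin> {..<n} - H)}"
    by (rule C.merged_pairs_def)
  also have "\<dots> = merged_pairs H"
    unfolding merged_pairs_def
    by (intro Collect_cong ex_cong1 conj_cong refl) (auto simp: reg_in_regions dart_iff)
  finally show ?thesis .
qed

lemma comps_merged_full: "comps L (merged_pairs {..<n}) = card (regions D - R)"
proof -
  interpret C: shaded_diagram D "regions D - R" by (rule complement)
  show ?thesis using C.comps_merged_empty merged_pairs_complement[of "{..<n}"] by simp
qed

lemma euler: "card (regions D) = n + 2"
  using link card_arc_labels[OF wf]
  by (simp add: connected_link_diagram_def planar_diagram_def)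

lemma card_R_complement: "card R + card (regions D - R) = n + 2"
  using card_Diff_subset[OF finite_R R_sub] card_mono[OF finite_regions R_sub] euler by simp

lemma n_pos: "n > 0"
  using link by (simp add: connected_link_diagram_def connected_diagram_def)

lemma R_nonempty: "R \<noteq> {}"
  using side_in_R[of "(0, 0)"] n_pos by (auto simp: dart_iff)

text \<open>
  All \<open>R\<close>-regions at a crossing are connected by its edge, and crossings that share an arc
  share the \<open>R\<close>-region beside it. So connectedness of the diagram passes to the graph.
\<close>

lemma comps_full_graph: "comps R (links (ends ` {..<n})) = 1"
proof -
  let ?C = "conn (links (ends ` {..<n}))"
  have same: "(reg (i, k), reg (i, l)) \<in> ?C"
    if "i < n" "k < 4" "l < 4" "reg (i, k) \<in> R" "reg (i, l) \<in> R" for i k l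
  proof -
    have "reg (i, l) \<in> ends i" using that(3,5) by (auto simp: ends_def)
    moreover note ends_eq[OF that(1,2,4)]
    ultimately consider "reg (i, l) = reg (i, k)" | "ends i = {reg (i, k), reg (i, l)}"
      by auto
    then show ?thesis
    proof cases
      case 2
      then have "{reg (i, k), reg (i, l)} \<in> ends ` {..<n}" using that(1) by blast
      then show ?thesis by (intro conn_base) (simp add: links_def)
    qed simp
  qed
  have side_corner: "\<exists>k'<4. side (i, k) = reg (i, k')" if "k < 4" for i k
  proof (cases "reg (i, k) \<in> R")
    case True
    then show ?thesis using that by (auto simp: side_def)
  next
    case False
    then show ?thesis
      by (intro exI[of _ "(k + 3) mod 4"]) (simp add: side_def prev_corner_def)
  qed
  have walk: "i < n \<longrightarrow> (\<forall>k<4. \<forall>l<4. reg (i, k) \<in> R \<longrightarrow> reg (j, l) \<in> R \<longrightarrow> (reg (i, k), reg (j, l)) \<in> ?C)"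
    if "(i, j) \<in> (adjacent_crossings D)\<^sup>*" for i j
    using that
  proof (induction rule: rtrancl_induct)
    case base
    then show ?case using same by blast
  next
    case (step j m)
    have jm: "j < n" "m < n" using step.hyps(2) by (auto simp: adjacent_crossings_def)
    obtain a where "a \<in> set (arc_ends (crossings D ! j))" "a \<in> set (arc_ends (crossings D ! m))"
      using step.hyps(2) by (auto simp: adjacent_crossings_def)
    moreover have "length (arc_ends x) = 4" for x :: "'a crossing" by (cases x) simp
    ultimately obtain p q where pq: "p < 4" "q < 4" "lab (j, p) = lab (m, q)"
      by (auto simp: in_set_conv_nth dart_label_def)
    have "side (j, p) = side (m, q)"
      using arc_side_label[of "(j, p)"] arc_side_label[of "(m, q)"] pq jm by (simp add: dart_iff)
    then obtain p' q' where p': "p' < 4" "q' < 4" "side (j, p) = reg (j, p')" "side (j, p) = reg (m, q')"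
      using side_corner pq by metis
    have in_R: "reg (j, p') \<in> R" "reg (m, q') \<in> R"
      using side_in_R[of "(j, p)"] pq jm p' by (simp_all add: dart_iff)
    show ?case
    proof (intro impI allI)
      fix k l assume kl: "i < n" "k < 4" "l < 4" "reg (i, k) \<in> R" "reg (m, l) \<in> R"
      have "(reg (i, k), reg (j, p')) \<in> ?C" using step.IH kl in_R p' by blast
      moreover have "(reg (m, q'), reg (m, l)) \<in> ?C" using same jm kl in_R p' by blast
      ultimately show "(reg (i, k), reg (m, l)) \<in> ?C" using p'(3,4) by (metis conn_trans)
    qed
  qed
  have "comps R (links (ends ` {..<n})) = card ((\<lambda>_. 0 :: nat) ` R)"
  proof (rule comps_eqI)
    have corner: "\<exists>i k. r = reg (i, k) \<and> i < n \<and> k < 4" if "r \<in> R" for r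
    proof -
      have "r \<in> reg ` darts D" using that R_sub by (auto simp: regions_def)
      then obtain x where "x \<in> darts D" "r = reg x" by blast
      then show ?thesis by (cases x) (auto simp: dart_iff)
    qed
    fix r r' assume r: "r \<in> R" "r' \<in> R"
    obtain i k where ik: "r = reg (i, k)" "i < n" "k < 4" using corner[OF r(1)] by blast
    obtain j l where jl: "r' = reg (j, l)" "j < n" "l < 4" using corner[OF r(2)] by blast
    note xy = r[unfolded ik(1) jl(1)] ik jl
    have "(i, j) \<in> (adjacent_crossings D)\<^sup>*"
      using link xy by (simp add: connected_link_diagram_def connected_diagram_def)
    then show "(r, r') \<in> ?C \<longleftrightarrow> (0 :: nat) = 0" using walk xy by simp
  qed
  moreover have "(\<lambda>_. 0 :: nat) ` R = {0}" using R_nonempty by auto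
  ultimately show ?thesis by simp
qed

text \<open>
  The labels joined in the state of \<open>H\<close> at the crossings other than \<open>i\<close>.
\<close>

definition other_pairs :: "nat \<Rightarrow> nat set \<Rightarrow> ('a \<times> 'a) set" where
  "other_pairs i H = {(lab (j, l), lab (j, (l + 1) mod 4)) | j l.
     j < n \<and> j \<noteq> i \<and> l < 4 \<and> (reg (j, l) \<in> R \<longleftrightarrow> j \<notin> H)}"

lemma even_darts: "even (card {x \<in> darts D. lab x \<in> C})"
proof -
  have "{x \<in> darts D. lab x \<in> C} = (\<Union>a\<in>C \<inter> L. {x \<in> darts D. lab x = a})"
    unfolding labels_eq by auto
  also have "card \<dots> = (\<Sum>a\<in>C \<inter> L. card {x \<in> darts D. lab x = a})"
    using finite_darts[of D] by (intro card_UN_disjoint) auto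
  also have "\<dots> = (\<Sum>a\<in>C \<inter> L. 2)"
    using wf by (intro sum.cong refl) (simp add: card_darts_label well_formed_def)
  finally show ?thesis by simp
qed

text \<open>
  With the join of \<open>p 0\<close> and \<open>p 1\<close> left out, the joins of a state still connect these two
  labels: in the graph of labels and joins every vertex has degree 2, so no edge is a bridge. In
  the proof, the arc ends with a label in the component \<open>C\<close> of \<open>p 0\<close> are counted twice, by labels
  and by crossings.
\<close>

lemma arcs_joined_by_parity:
  assumes i: "i < n" and k: "k < 4"
  defines "p \<equiv> \<lambda>m. lab (i, (k + m) mod 4)"
  shows "(p 0, p 1) \<in> conn (insert (p 2, p 3) (other_pairs i H))"
proof -
  define J where "J = insert (p 2, p 3) (other_pairs i H)"
  define C where "C = {x. (p 0, x) \<in> conn J}"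
  have closed: "x \<in> C \<longleftrightarrow> y \<in> C" if "(x, y) \<in> J" for x y
    using conn_base[OF that] unfolding C_def mem_Collect_eq by (metis conn_sym conn_trans)
  have "{x \<in> darts D. lab x \<in> C} = Sigma {..<n} (\<lambda>j. {l. l < 4 \<and> lab (j, l) \<in> C})"
    by (auto simp: darts_def)
  then have "card {x \<in> darts D. lab x \<in> C} = (\<Sum>j<n. card {l. l < 4 \<and> lab (j, l) \<in> C})"
    by simp
  also have "\<dots> = card {l. l < 4 \<and> lab (i, l) \<in> C} + (\<Sum>j\<in>{..<n} - {i}. card {l. l < 4 \<and> lab (j, l) \<in> C})"
    using i by (simp add: sum.remove)
  finally have sum: "even (card {l. l < 4 \<and> lab (i, l) \<in> C} +
      (\<Sum>j\<in>{..<n} - {i}. card {l. l < 4 \<and> lab (j, l) \<in> C}))"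
    using even_darts[of C] by simp
  have "even (\<Sum>j\<in>{..<n} - {i}. card {l. l < 4 \<and> lab (j, l) \<in> C})"
  proof (intro dvd_sum)
    fix j assume j: "j \<in> {..<n} - {i}"
    have pair: "lab (j, l) \<in> C \<longleftrightarrow> lab (j, (l + 1) mod 4) \<in> C"
      if "l < 4" "reg (j, l) \<in> R \<longleftrightarrow> j \<notin> H" for l
      using j that by (intro closed) (auto simp: J_def other_pairs_def)
    show "even (card {l. l < 4 \<and> lab (j, l) \<in> C})"
    proof (cases "reg (j, 0) \<in> R \<longleftrightarrow> j \<notin> H")
      case True
      then have "reg (j, 2) \<in> R \<longleftrightarrow> j \<notin> H" using R_corner_parity[of j 2] j by simp
      with True have "lab (j, 0) \<in> C \<longleftrightarrow> lab (j, 1) \<in> C" "lab (j, 2) \<in> C \<longleftrightarrow> lab (j, 3) \<in> C"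
        using pair[of 0] pair[of 2] by simp_all
      then show ?thesis unfolding card_less_4 by simp
    next
      case False
      then have "reg (j, 1) \<in> R \<longleftrightarrow> j \<notin> H" "reg (j, 3) \<in> R \<longleftrightarrow> j \<notin> H"
        using R_corner_parity[of j 1] R_corner_parity[of j 3] j by auto
      then have "lab (j, 1) \<in> C \<longleftrightarrow> lab (j, 2) \<in> C" "lab (j, 3) \<in> C \<longleftrightarrow> lab (j, 0) \<in> C"
        using pair[of 1] pair[of 3] by (simp_all flip: numeral_2_eq_2)
      then show ?thesis unfolding card_less_4 by simp
    qed
  qed
  with sum have ev: "even (card {l. l < 4 \<and> lab (i, l) \<in> C})" by simp
  have "card {l. l < 4 \<and> lab (i, l) \<in> C} =
      of_bool (p 0 \<in> C) + of_bool (p 1 \<in> C) + of_bool (p 2 \<in> C) + of_bool (p 3 \<in> C)"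
    unfolding card_less_4 p_def
    by (cases rule: less_4E[OF k]) (simp_all flip: numeral_2_eq_2 numeral_3_eq_3)
  moreover have "p 0 \<in> C" by (simp add: C_def)
  moreover have "p 2 \<in> C \<longleftrightarrow> p 3 \<in> C" by (rule closed) (simp add: J_def)
  ultimately have "p 1 \<in> C" using ev by (cases "p 1 \<in> C"; cases "p 3 \<in> C") simp_all
  then show ?thesis by (simp add: C_def J_def)
qed

lemma merged_pairs_split:
  assumes "i < n" "k < 4" "reg (i, k) \<in> R \<longleftrightarrow> i \<notin> H"
  shows "merged_pairs H = other_pairs i H \<union>
    {(lab (i, k), lab (i, (k + 1) mod 4)), (lab (i, (k + 2) mod 4), lab (i, (k + 3) mod 4))}"
proof -
  have "merged_pairs H = other_pairs i H \<union>
    {(lab (i, l), lab (i, (l + 1) mod 4)) | l. l < 4 \<and> (reg (i, l) \<in> R \<longleftrightarrow> i \<notin> H)}"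
    unfolding merged_pairs_def other_pairs_def using assms(1) by blast
  also have "{(lab (i, l), lab (i, (l + 1) mod 4)) | l. l < 4 \<and> (reg (i, l) \<in> R \<longleftrightarrow> i \<notin> H)} =
    {(lab (i, k), lab (i, (k + 1) mod 4)), (lab (i, (k + 2) mod 4), lab (i, (k + 3) mod 4))}"
  proof -
    have r: "reg (i, Suc 0) \<in> R \<longleftrightarrow> reg (i, 0) \<notin> R" "reg (i, 2) \<in> R \<longleftrightarrow> reg (i, 0) \<in> R"
      "reg (i, 3) \<in> R \<longleftrightarrow> reg (i, 0) \<notin> R"
      using R_corner_parity[OF assms(1), of 1] R_corner_parity[OF assms(1), of 2]
        R_corner_parity[OF assms(1), of 3] by auto
    show ?thesis
      unfolding Collect_less_4[of "\<lambda>l. (lab (i, l), lab (i, (l + 1) mod 4))"] using assms(3)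
      by (cases rule: less_4E[OF assms(2)])
        (simp_all add: r insert_commute flip: numeral_2_eq_2 numeral_3_eq_3)
  qed
  finally show ?thesis .
qed

lemma other_pairs_insert: "other_pairs i (insert i H) = other_pairs i H"
  unfolding other_pairs_def by (intro Collect_cong ex_cong1 conj_cong refl) auto

text \<open>
  The number of circles expected from the Euler characteristic of the subgraph \<open>H\<close> minus the
  actual number, that is, twice the genus of the ribbon graph of \<open>H\<close>.
\<close>

definition excess :: "nat set \<Rightarrow> int" where
  "excess H = 2 * int (comps R (links (ends ` H))) + int (card H) - int (card R)
     - int (comps L (merged_pairs H))"

text \<open>
  If the new edge lies within a component, the expected number rises by 1 and the actual one by
  at most 1. If it connects two components, the expected number drops by 1, and so does the actual
  one, as two different circles are merged.
\<close>

lemma excess_insert: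
  assumes "i < n" "i \<notin> H" "finite H"
  shows "excess H \<le> excess (insert i H)"
proof -
  define k where "k = (if reg (i, 0) \<in> R then 0 else 1 :: nat)"
  have k4: "k < 4" by (simp add: k_def)
  have kR: "reg (i, k) \<in> R"
    using R_corner_parity[OF assms(1), of 1] by (auto simp: k_def)
  define p where "p m = lab (i, (k + m) mod 4)" for m
  let ?J = "other_pairs i H"
  have p0: "p 0 = lab (i, k)" using k4 by (simp add: p_def)
  have JH: "merged_pairs H = ?J \<union> {(p 0, p 1), (p 2, p 3)}"
    using merged_pairs_split[OF assms(1) k4, of H] kR assms(2) k4 by (simp add: p_def)
  have k1: "(k + 1) mod 4 < 4" "reg (i, (k + 1) mod 4) \<notin> R"
    using next_not_in_R(2)[OF assms(1) k4] kR by auto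
  have JI: "merged_pairs (insert i H) = ?J \<union> {(p 1, p 2), (p 3, p 0)}"
    using merged_pairs_split[OF assms(1) k1(1), of "insert i H"] k1(2) unfolding p0 p_def other_pairs_insert
    by (simp add: k_def split: if_splits flip: numeral_2_eq_2 numeral_3_eq_3)
  have in_L: "p m \<in> L" for m
    unfolding p_def labels_eq using assms(1) by (auto simp: dart_iff)
  then have sub: "{p 0, p 1, p 2, p 3} \<subseteq> L" by simp
  define r r' where "r = reg (i, k)" and "r' = reg (i, (k + 2) mod 4)"
  have e: "ends i = {r, r'}" using ends_eq[OF assms(1) k4 kR] by (simp add: r_def r'_def)
  then have rR: "r \<in> R" "r' \<in> R" by (auto simp: ends_def)
  have card: "card (insert i H) = Suc (card H)" using assms(2,3) by simp
  have comps_R: "int (comps R (links (ends ` insert i H))) =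
      int (comps R (links (ends ` H))) - (if (r, r') \<in> conn (links (ends ` H)) then 0 else 1)"
    using comps_links_insert[OF finite_R rR, of "ends ` H"] by (simp add: e)
  show ?thesis
  proof (cases "(r, r') \<in> conn (links (ends ` H))")
    case True
    then show ?thesis
      using comps_smoothing_change(1)[OF _ sub, of ?J] comps_R card
      unfolding excess_def JH JI by simp
  next
    case False
    have side0: "arc_side (p 0) = r"
      using assms(1) k4 kR by (simp add: p0 arc_side_label dart_iff side_def r_def)
    have side2: "arc_side (p 2) = r'"
      using assms(1) k4 rR(2) by (simp add: p_def arc_side_label dart_iff side_def r'_def)
    have nac: "(p 0, p 2) \<notin> conn (merged_pairs H)"
      using arc_side_merged[of "p 0" "p 2" H] False side0 side2 by auto
    have sub1: "conn (insert (p 2, p 3) ?J) \<subseteq> conn (merged_pairs H)"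
      "conn (insert (p 0, p 1) ?J) \<subseteq> conn (merged_pairs H)" "conn ?J \<subseteq> conn (merged_pairs H)"
      unfolding JH by (intro conn_mono; auto)+
    have in_JH: "(p 0, p 1) \<in> conn (merged_pairs H)" "(p 2, p 3) \<in> conn (merged_pairs H)"
      unfolding JH by (simp_all add: conn_base)
    have "(p 0, p 1) \<in> conn ?J"
    proof -
      have "(p 0, p 1) \<in> conn (insert (p 2, p 3) ?J)"
        using arcs_joined_by_parity[OF assms(1) k4, of H] by (simp add: p_def)
      moreover have "(p 0, p 2) \<notin> conn ?J" using nac sub1(3) by blast
      moreover have "(p 0, p 3) \<notin> conn ?J"
        using nac sub1(3) in_JH(2) by (meson conn_sym conn_trans subsetD)
      ultimately show ?thesis unfolding conn_insert by blast
    qed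
    moreover have "(p 2, p 3) \<in> conn ?J"
    proof -
      have *: "(k + 2) mod 4 < 4" "((k + 2) mod 4 + 0) mod 4 = (k + 2) mod 4"
        "((k + 2) mod 4 + 1) mod 4 = (k + 3) mod 4" "((k + 2) mod 4 + 2) mod 4 = (k + 0) mod 4"
        "((k + 2) mod 4 + 3) mod 4 = (k + 1) mod 4"
        by (simp_all add: k_def)
      have "(p 2, p 3) \<in> conn (insert (p 0, p 1) ?J)"
        using arcs_joined_by_parity[OF assms(1) *(1), of H] unfolding *(2-5) by (simp only: p_def)
      moreover have "(p 2, p 0) \<notin> conn ?J" using nac sub1(3) by (meson conn_sym subsetD)
      moreover have "(p 2, p 1) \<notin> conn ?J"
        using nac sub1(3) in_JH(1) by (meson conn_sym conn_trans subsetD)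
      ultimately show ?thesis unfolding conn_insert by blast
    qed
    ultimately have "comps L (merged_pairs H) = Suc (comps L (merged_pairs (insert i H)))"
      using comps_smoothing_change(2)[OF _ sub, of ?J] nac unfolding JH JI by simp
    then show ?thesis using comps_R card False unfolding excess_def by simp
  qed
qed

lemma excess_mono:
  assumes "finite K" "H \<subseteq> K" "K \<subseteq> {..<n}"
  shows "excess H \<le> excess K"
proof -
  have "excess H \<le> excess (H \<union> M)" if "finite M" "M \<subseteq> {..<n}" for M
    using that
  proof (induction M rule: finite_induct)
    case (insert i M)
    have "finite (H \<union> M)" using assms insert finite_subset by auto
    then show ?case
      using insert excess_insert[of i "H \<union> M"] by (cases "i \<in> H \<union> M") (auto simp: insert_absorb)
  qed simp
  from this[of K] show ?thesis using assms by (simp add: Un_absorb1)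
qed

theorem circles_of_state:
  assumes "H \<subseteq> {..<n}"
  shows "int (comps L (smoothing (state_of H) (crossings D))) =
    2 * int (comps R (links (ends ` H))) + int (card H) - int (card R)"
proof -
  have "excess {} = 0"
    by (simp add: excess_def comps_empty comps_merged_empty)
  moreover have "excess {..<n} = 0"
    using card_R_complement by (simp add: excess_def comps_full_graph comps_merged_full)
  moreover have "excess {} \<le> excess H" "excess H \<le> excess {..<n}"
    using assms finite_subset[OF assms] by (simp_all add: excess_mono)
  ultimately have "excess H = 0" by simp
  then show ?thesis unfolding excess_def smoothing_state_of by simp
qed

end

section \<open>Short paths and complete subgraphs\<close>

lemma image_two_subsets:
  assumes "bij_betw h W U"
  shows "(\<lambda>e. h ` e) ` two_subsets W = two_subsets U"
proof (intro equalityI subsetI)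
  fix f assume "f \<in> (\<lambda>e. h ` e) ` two_subsets W"
  then obtain e where e: "f = h ` e" "e \<subseteq> W" "card e = 2" by (auto simp: two_subsets_def)
  have "inj_on h e" using assms e(2) by (auto simp: bij_betw_def intro: inj_on_subset)
  then have "card f = 2" using e by (simp add: card_image)
  then show "f \<in> two_subsets U" using assms e by (auto simp: two_subsets_def bij_betw_def)
next
  fix f assume "f \<in> two_subsets U"
  then have f: "f \<subseteq> h ` W" "card f = 2" using assms by (auto simp: two_subsets_def bij_betw_def)
  then obtain e where e: "e \<subseteq> W" "f = h ` e" by (meson subset_image_iff)
  have "inj_on h e" using assms e(1) by (auto simp: bij_betw_def intro: inj_on_subset)
  then have "card e = 2" using f(2) e(2) by (simp add: card_image)
  then show "f \<in> (\<lambda>e. h ` e) ` two_subsets W" using e by (auto simp: two_subsets_def)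
qed

text \<open>
  The order is positive, as an infinite vertex set has cardinality 0 by convention.
\<close>

lemma isomorphic_complete_graph_iff:
  assumes "\<And>f. f \<in> snd K \<Longrightarrow> f \<subseteq> fst K"
  shows "isomorphic K (complete_graph (Suc k)) \<longleftrightarrow> card (fst K) = Suc k \<and> snd K = two_subsets (fst K)"
proof -
  have c: "complete_graph (Suc k) = ({..<Suc k}, two_subsets {..<Suc k})"
    by (simp add: complete_graph_def two_subsets_def)
  show ?thesis
  proof
    assume "isomorphic K (complete_graph (Suc k))"
    then obtain h where h: "bij_betw h (fst K) {..<Suc k}"
      "two_subsets {..<Suc k} = (\<lambda>e. h ` e) ` snd K"
      unfolding isomorphic_def c by auto
    have "card (fst K) = Suc k" using bij_betw_same_card[OF h(1)] by simp
    moreover have "snd K = two_subsets (fst K)"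
    proof -
      have "inj_on ((`) h) (Pow (fst K))"
        using h(1) by (simp add: bij_betw_def inj_on_image_Pow)
      moreover have "(`) h ` snd K = (`) h ` two_subsets (fst K)"
        using h(2) image_two_subsets[OF h(1)] by simp
      moreover have "snd K \<subseteq> Pow (fst K)" "two_subsets (fst K) \<subseteq> Pow (fst K)"
        using assms by (auto simp: two_subsets_def)
      ultimately show ?thesis by (simp add: inj_on_image_eq_iff)
    qed
    ultimately show "card (fst K) = Suc k \<and> snd K = two_subsets (fst K)" by simp
  next
    assume K: "card (fst K) = Suc k \<and> snd K = two_subsets (fst K)"
    then have "finite (fst K)" by (metis card.infinite nat.distinct(1))
    then obtain h where "bij_betw h (fst K) {..<Suc k}"
      using ex_bij_betw_finite_nat[of "fst K"] K by (auto simp: atLeast0LessThan)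
    then show "isomorphic K (complete_graph (Suc k))"
      unfolding isomorphic_def c using K image_two_subsets by fastforce
  qed
qed

lemma length_3_list:
  "length p = 3 \<and> hd p = u \<and> last p = w \<longleftrightarrow> (\<exists>x. p = [u, x, w])"
  by (auto simp: numeral_3_eq_3 length_Suc_conv)

lemma length_4_list:
  "length p = 4 \<and> hd p = u \<and> last p = w \<longleftrightarrow> (\<exists>x y. p = [u, x, y, w])"
  by (auto simp: numeral_eq_Suc length_Suc_conv)

lemma paths_2_iff: "p \<in> paths H 2 u w \<longleftrightarrow> (\<exists>x. p = [u, x, w] \<and> distinct [u, x, w] \<and>
  {u, x, w} \<subseteq> fst H \<and> {u, x} \<in> snd H \<and> {x, w} \<in> snd H)"
proof -
  have "p \<in> paths H 2 u w \<longleftrightarrow> (length p = 3 \<and> hd p = u \<and> last p = w) \<and>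
      distinct p \<and> set p \<subseteq> fst H \<and> (\<forall>i<2. {p ! i, p ! Suc i} \<in> snd H)"
    unfolding paths_def by (simp add: conj_ac)
  also have "\<dots> \<longleftrightarrow> (\<exists>x. p = [u, x, w] \<and> distinct [u, x, w] \<and> set [u, x, w] \<subseteq> fst H \<and>
      (\<forall>i<2. {[u, x, w] ! i, [u, x, w] ! Suc i} \<in> snd H))"
    unfolding length_3_list by metis
  also have "\<dots> \<longleftrightarrow> (\<exists>x. p = [u, x, w] \<and> distinct [u, x, w] \<and>
      {u, x, w} \<subseteq> fst H \<and> {u, x} \<in> snd H \<and> {x, w} \<in> snd H)"
    by (intro ex_cong1 conj_cong refl) (simp_all add: numeral_eq_Suc All_less_Suc2)
  finally show ?thesis .
qed

lemma paths_3_iff: "p \<in> paths H 3 u w \<longleftrightarrow> (\<exists>x y. p = [u, x, y, w] \<and> distinct [u, x, y, w] \<and>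
  {u, x, y, w} \<subseteq> fst H \<and> {u, x} \<in> snd H \<and> {x, y} \<in> snd H \<and> {y, w} \<in> snd H)"
proof -
  have "p \<in> paths H 3 u w \<longleftrightarrow> (length p = 4 \<and> hd p = u \<and> last p = w) \<and>
      distinct p \<and> set p \<subseteq> fst H \<and> (\<forall>i<3. {p ! i, p ! Suc i} \<in> snd H)"
    unfolding paths_def by (simp add: conj_ac)
  also have "\<dots> \<longleftrightarrow> (\<exists>x y. p = [u, x, y, w] \<and> distinct [u, x, y, w] \<and> set [u, x, y, w] \<subseteq> fst H \<and>
      (\<forall>i<3. {[u, x, y, w] ! i, [u, x, y, w] ! Suc i} \<in> snd H))"
    unfolding length_4_list by metis
  also have "\<dots> \<longleftrightarrow> (\<exists>x y. p = [u, x, y, w] \<and> distinct [u, x, y, w] \<and>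
      {u, x, y, w} \<subseteq> fst H \<and> {u, x} \<in> snd H \<and> {x, y} \<in> snd H \<and> {y, w} \<in> snd H)"
    by (intro ex_cong1 conj_cong refl) (simp_all add: numeral_eq_Suc All_less_Suc2)
  finally show ?thesis .
qed

lemma path_edges_3: "path_edges [u, x, w] = {{u, x}, {x, w}}"
proof -
  have "path_edges [u, x, w] = (\<lambda>i. {[u, x, w] ! i, [u, x, w] ! Suc i}) ` {i. i < 2}"
    by (auto simp: path_edges_def)
  also have "{i. i < (2 :: nat)} = {0, 1}" by auto
  finally show ?thesis by simp
qed

text \<open>
  The multigraph \<open>G\<close> is \<open>(V, E)\<close> with one more edge \<open>d\<close> from \<open>u1\<close> to \<open>u2\<close>.
\<close>

locale dealternator_graph = edge_contraction V E ends u1 u2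
  for V :: "'v set" and E :: "'e set" and ends u1 u2 +
  fixes G :: "('v, 'e) multigraph" and d :: 'e
  assumes verts_G: "verts G = V" and edges_G: "edges G = insert d E" and d_notin: "d \<notin> E"
    and endpoints_E: "\<And>e. e \<in> E \<Longrightarrow> endpoints G e = ends e" and endpoints_d: "endpoints G d = {u1, u2}"
begin

lemma simplification_G: "simplification G = (V, insert {u1, u2} F)"
proof -
  have e: "card (endpoints G e) = 2" if "e \<in> edges G" for e
    using that card_F endpoints_E endpoints_d u_neq by (auto simp: edges_G)
  then have "{e \<in> edges G. \<not> is_loop G e} = insert d E" by (auto simp: is_loop_def edges_G)
  moreover have "endpoints G ` E = F" using endpoints_E by (intro image_cong) auto
  ultimately show ?thesis by (simp add: simplification_def verts_G endpoints_d)
qed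

lemma num_v_G: "num_v G = card V"
  by (simp add: num_v_def simplification_G)

lemma num_e_G: "num_e G = Suc (card F)"
  using no_parallel finite_F by (simp add: num_e_def simplification_G)

lemma N_in_V: "x \<in> N1 \<Longrightarrow> x \<in> V" "x \<in> N2 \<Longrightarrow> x \<in> V"
  using ends_two unfolding N1_def N2_def two_subsets_def by blast+

lemma edge_N1: "x \<noteq> u2 \<Longrightarrow> {u1, x} \<in> insert {u1, u2} F \<longleftrightarrow> x \<in> N1"
  using u_neq by (auto simp: N1_def doubleton_eq_iff)

lemma edge_N2: "x \<noteq> u1 \<Longrightarrow> {x, u2} \<in> insert {u1, u2} F \<longleftrightarrow> x \<in> N2"
  using u_neq by (auto simp: N2_def doubleton_eq_iff insert_commute)

lemma paths_2: "paths (simplification G) 2 u1 u2 = (\<lambda>x. [u1, x, u2]) ` (N1 \<inter> N2)"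
proof -
  have "(distinct [u1, x, u2] \<and> {u1, x, u2} \<subseteq> V \<and> {u1, x} \<in> insert {u1, u2} F \<and>
      {x, u2} \<in> insert {u1, u2} F) \<longleftrightarrow> x \<in> N1 \<inter> N2" for x
    using edge_N1[of x] edge_N2[of x] u_notin N_in_V[of x] u_neq u_in
    by (cases "x = u1 \<or> x = u2") auto
  then have "p \<in> paths (simplification G) 2 u1 u2 \<longleftrightarrow> (\<exists>x. p = [u1, x, u2] \<and> x \<in> N1 \<inter> N2)" for p
    unfolding paths_2_iff simplification_G fst_conv snd_conv by simp
  then show ?thesis by auto
qed

lemma num_P_G: "num_P G u1 u2 = card (N1 \<inter> N2)"
  unfolding num_P_def paths_2 by (intro card_image) (auto simp: inj_on_def)

lemma from_multiple_G: "f \<noteq> {u1, u2} \<Longrightarrow> from_multiple G f \<longleftrightarrow> m f \<ge> 2"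
proof -
  assume "f \<noteq> {u1, u2}"
  then have "{e \<in> edges G. endpoints G e = f} = {e \<in> E. ends e = f}"
    using endpoints_E endpoints_d by (auto simp: edges_G)
  then show ?thesis by (simp add: from_multiple_def mult_def)
qed

lemma num_Pi_G: "num_Pi i G u1 u2 =
  card {x \<in> N1 \<inter> N2. of_bool (m {u1, x} \<ge> 2) + of_bool (m {u2, x} \<ge> 2) = i}"
proof -
  let ?p = "\<lambda>x. [u1, x, u2]"
  have "card {f \<in> path_edges (?p x). from_multiple G f} =
      of_bool (m {u1, x} \<ge> 2) + of_bool (m {u2, x} \<ge> 2)" if x: "x \<in> N1 \<inter> N2" for x
  proof -
    have xu: "x \<noteq> u1" "x \<noteq> u2" using x u_notin by auto
    have "path_edges (?p x) = {{u1, x}, {u2, x}}"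
      by (simp add: path_edges_3 insert_commute)
    moreover have "from_multiple G {u1, x} \<longleftrightarrow> m {u1, x} \<ge> 2" "from_multiple G {u2, x} \<longleftrightarrow> m {u2, x} \<ge> 2"
      using xu by (intro from_multiple_G; auto simp: doubleton_eq_iff)+
    moreover have "{f \<in> {{u1, x}, {u2, x}}. P f} =
        (if P {u1, x} then {{u1, x}} else {}) \<union> (if P {u2, x} then {{u2, x}} else {})" for P
      by auto
    moreover have "{u1, x} \<noteq> {u2, x}" using u_neq by (auto simp: doubleton_eq_iff)
    ultimately show ?thesis by simp
  qed
  then have "{p \<in> paths (simplification G) 2 u1 u2. card {f \<in> path_edges p. from_multiple G f} = i} =
      ?p ` {x \<in> N1 \<inter> N2. of_bool (m {u1, x} \<ge> 2) + of_bool (m {u2, x} \<ge> 2) = i}"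
    unfolding paths_2 by auto
  then show ?thesis unfolding num_Pi_def by (simp add: card_image inj_on_def)
qed

text \<open>
  A path of length two has two, one or no edges of multiplicity 1 when it counts towards
  \<open>P_0\<close>, \<open>P_1\<close> or \<open>P_2\<close>; and \<open>2 P_0 + P_1 = P + P_0 - P_2\<close>.
\<close>

lemma single_edge_count:
  "int (card {x \<in> N1 \<inter> N2. m {u1, x} = 1}) + int (card {x \<in> N1 \<inter> N2. m {u2, x} = 1}) =
     int (num_P G u1 u2) + int (num_Pi 0 G u1 u2) - int (num_Pi 2 G u1 u2)"
proof -
  let ?N = "N1 \<inter> N2"
  have c: "int (card {x \<in> ?N. P x}) = (\<Sum>x\<in>?N. of_bool (P x))" for P
  proof -
    have "{x \<in> ?N. P x} = ?N \<inter> {x. P x}" by auto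
    then show ?thesis using finite_N by simp
  qed
  have "(\<Sum>x\<in>?N. of_bool (m {u1, x} = 1)) + (\<Sum>x\<in>?N. of_bool (m {u2, x} = 1)) =
     (\<Sum>x\<in>?N. 1 + of_bool (of_bool (m {u1, x} \<ge> 2) + of_bool (m {u2, x} \<ge> 2) = (0 :: nat))
       - of_bool (of_bool (m {u1, x} \<ge> 2) + of_bool (m {u2, x} \<ge> 2) = (2 :: nat)) :: int)"
    unfolding sum.distrib[symmetric]
  proof (intro sum.cong refl)
    fix x assume "x \<in> ?N"
    then have "m {u1, x} > 0" "m {u2, x} > 0" by (auto simp: mult_pos N1_def N2_def)
    then show "of_bool (m {u1, x} = 1) + of_bool (m {u2, x} = 1) =
      (1 + of_bool (of_bool (m {u1, x} \<ge> 2) + of_bool (m {u2, x} \<ge> 2) = (0 :: nat))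
       - of_bool (of_bool (m {u1, x} \<ge> 2) + of_bool (m {u2, x} \<ge> 2) = (2 :: nat)) :: int)"
      by (cases "m {u1, x} = 1"; cases "m {u2, x} = 1") auto
  qed
  then show ?thesis
    unfolding num_P_G num_Pi_G c by (simp add: sum.distrib sum_subtractf)
qed

lemma num_Q_G: "num_Q G u1 u2 = card cross_edges"
proof -
  let ?A = "{(x, y). x \<in> N1 - N2 \<and> y \<in> N2 - N1 \<and> {x, y} \<in> F0}"
  have "p \<in> paths (simplification G) 3 u1 u2 \<and> (\<forall>x \<in> set p - {u1, u2}.
      \<not> ({x, u1} \<in> snd (simplification G) \<and> {x, u2} \<in> snd (simplification G))) \<longleftrightarrow>
    (\<exists>x y. p = [u1, x, y, u2] \<and> (x, y) \<in> ?A)" for p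
  proof -
    let ?F = "insert {u1, u2} F"
    define A where "A x y \<longleftrightarrow> distinct [u1, x, y, u2] \<and> {u1, x, y, u2} \<subseteq> V \<and>
      {u1, x} \<in> ?F \<and> {x, y} \<in> ?F \<and> {y, u2} \<in> ?F" for x y
    define Q where "Q p \<longleftrightarrow> (\<forall>x \<in> set p - {u1, u2}. \<not> ({x, u1} \<in> ?F \<and> {x, u2} \<in> ?F))" for p
    have A: "p \<in> paths (simplification G) 3 u1 u2 \<longleftrightarrow> (\<exists>x y. p = [u1, x, y, u2] \<and> A x y)"
      unfolding paths_3_iff simplification_G fst_conv snd_conv A_def ..
    have "(\<exists>x y. p = [u1, x, y, u2] \<and> A x y) \<and> Q p \<longleftrightarrow>
        (\<exists>x y. p = [u1, x, y, u2] \<and> A x y \<and> Q [u1, x, y, u2])"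
      by blast
    also have "\<dots> \<longleftrightarrow> (\<exists>x y. p = [u1, x, y, u2] \<and> (x, y) \<in> ?A)"
    proof (intro ex_cong1 conj_cong refl)
      fix x y
      show "(A x y \<and> Q [u1, x, y, u2]) = ((x, y) \<in> ?A)"
      proof (cases "distinct [u1, x, y, u2]")
        case True
        then have ne: "x \<noteq> u1" "x \<noteq> u2" "y \<noteq> u1" "y \<noteq> u2" by auto
        have e: "{u1, x} \<in> ?F \<longleftrightarrow> x \<in> N1" "{x, u1} \<in> ?F \<longleftrightarrow> x \<in> N1" "{x, u2} \<in> ?F \<longleftrightarrow> x \<in> N2"
          "{y, u1} \<in> ?F \<longleftrightarrow> y \<in> N1" "{y, u2} \<in> ?F \<longleftrightarrow> y \<in> N2"
          using edge_N1[OF ne(2)] edge_N2[OF ne(1)] edge_N1[OF ne(4)] edge_N2[OF ne(3)]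
          by (simp_all only: insert_commute)
        have "{x, y} \<in> ?F \<longleftrightarrow> {x, y} \<in> F0" using ne by (auto simp: F0_def doubleton_eq_iff)
        then have "A x y \<longleftrightarrow> x \<in> N1 \<and> {x, y} \<in> F0 \<and> y \<in> N2"
          unfolding A_def e using True N_in_V[of x] N_in_V[of y] u_in by blast
        moreover have "set [u1, x, y, u2] - {u1, u2} = {x, y}" using True by auto
        then have "Q [u1, x, y, u2] \<longleftrightarrow> \<not> (x \<in> N1 \<and> x \<in> N2) \<and> \<not> (y \<in> N1 \<and> y \<in> N2)"
          unfolding Q_def by (simp only: ball_simps e) simp
        ultimately show ?thesis by auto
      next
        case False
        then have "x = u1 \<or> x = u2 \<or> y = u1 \<or> y = u2 \<or> x = y" using u_neq by auto
        then have "(x, y) \<notin> ?A" using u_notin by auto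
        then show ?thesis using False unfolding A_def by blast
      qed
    qed
    finally show ?thesis unfolding A[symmetric] Q_def simplification_G snd_conv .
  qed
  then have "num_Q G u1 u2 = card ((\<lambda>(x, y). [u1, x, y, u2]) ` ?A)"
    unfolding num_Q_def by (intro arg_cong[of _ _ card]) auto
  also have "\<dots> = card ((\<lambda>(x, y). {x, y}) ` ?A)"
    by (subst (1 2) card_image) (auto simp: inj_on_def doubleton_eq_iff)
  also have "(\<lambda>(x, y). {x, y}) ` ?A = cross_edges"
    by (auto simp: cross_edges_def)
  finally show ?thesis .
qed

lemma num_S_G: "num_S G u1 u2 = card inner_edges"
proof -
  let ?W = "\<lambda>g. insert u1 (insert u2 g)"
  let ?K = "\<lambda>g. (?W g, two_subsets (?W g))"
  have ig: "card g = 2" "u1 \<notin> g" "u2 \<notin> g" "g \<in> F" if "g \<in> inner_edges" for g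
    using that card_F by (auto simp: inner_edges_def F0_def)
  have "K \<in> {K. subgraph K (simplification G) \<and> u1 \<in> fst K \<and> u2 \<in> fst K \<and> isomorphic K (complete_graph 4)}
      \<longleftrightarrow> K \<in> ?K ` inner_edges" for K
  proof
    assume K: "K \<in> {K. subgraph K (simplification G) \<and> u1 \<in> fst K \<and> u2 \<in> fst K \<and> isomorphic K (complete_graph 4)}"
    then have sub: "snd K \<subseteq> insert {u1, u2} F" "\<And>f. f \<in> snd K \<Longrightarrow> f \<subseteq> fst K"
      by (auto simp: subgraph_def simplification_G)
    have K4: "card (fst K) = 4" "snd K = two_subsets (fst K)"
      using isomorphic_complete_graph_iff[of K 3] sub(2) K by auto
    define g where "g = fst K - {u1, u2}"
    have u: "u1 \<in> fst K" "u2 \<in> fst K" using K by auto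
    have W: "fst K = ?W g" "u1 \<notin> g" "u2 \<notin> g" using u by (auto simp: g_def)
    have cg: "card g = 2"
      using K4(1) u u_neq unfolding g_def by (subst card_Diff_subset) auto
    have edge: "f \<in> F" if "f \<subseteq> fst K" "card f = 2" "f \<noteq> {u1, u2}" for f
      using that sub(1) K4(2) by (auto simp: two_subsets_def)
    have "g \<in> F" by (rule edge) (use W cg in auto)
    moreover have "x \<in> N1 \<inter> N2" if "x \<in> g" for x
    proof -
      have "x \<noteq> u1" "x \<noteq> u2" "x \<in> fst K" using that W by auto
      then have "{u1, x} \<in> F" "{u2, x} \<in> F"
        using u by (intro edge; auto simp: doubleton_eq_iff)+
      then show ?thesis by (simp add: N1_def N2_def)
    qed
    ultimately have "g \<in> inner_edges" using W by (auto simp: inner_edges_def F0_def)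
    moreover have "K = ?K g" using W(1) K4(2) by (simp add: prod_eq_iff)
    ultimately show "K \<in> ?K ` inner_edges" by blast
  next
    assume "K \<in> ?K ` inner_edges"
    then obtain g where g: "g \<in> inner_edges" "K = ?K g" by blast
    note ig = ig[OF g(1)]
    obtain x y where xy: "g = {x, y}" "x \<noteq> y" using ig(1) by (auto simp: card_2_iff)
    have N: "x \<in> N1" "x \<in> N2" "y \<in> N1" "y \<in> N2" using g(1) xy by (auto simp: inner_edges_def)
    have "fst K \<subseteq> V" using g(2) xy N_in_V N u_in by auto
    moreover have "two_subsets (?W g) \<subseteq> insert {u1, u2} F"
    proof
      fix f assume "f \<in> two_subsets (?W g)"
      then obtain a b where ab: "f = {a, b}" "a \<noteq> b" "a \<in> ?W g" "b \<in> ?W g" by (rule two_subsetsE)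
      have e: "{x, y} \<in> F" "{u1, x} \<in> F" "{u1, y} \<in> F" "{u2, x} \<in> F" "{u2, y} \<in> F"
        using ig(4) xy N by (auto simp: N1_def N2_def)
      then have e': "{y, x} \<in> F" "{x, u1} \<in> F" "{y, u1} \<in> F" "{x, u2} \<in> F" "{y, u2} \<in> F"
        by (simp_all only: insert_commute)
      show "f \<in> insert {u1, u2} F"
        using ab(2-4) e e' unfolding ab(1) xy(1) by (elim insertE) (simp_all add: insert_commute)
    qed
    moreover have "card (fst K) = 4"
      using g(2) xy ig u_neq by (simp add: card_insert_if)
    ultimately show "K \<in> {K. subgraph K (simplification G) \<and> u1 \<in> fst K \<and> u2 \<in> fst K \<and> isomorphic K (complete_graph 4)}"
      using g(2) isomorphic_complete_graph_iff[of K 3]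
      by (auto simp: subgraph_def simplification_G two_subsets_def)
  qed
  then have "num_S G u1 u2 = card (?K ` inner_edges)"
    unfolding num_S_def by (intro arg_cong[of _ _ card]) blast
  also have "\<dots> = card inner_edges"
  proof (intro card_image inj_onI)
    fix g h assume gh: "g \<in> inner_edges" "h \<in> inner_edges" "?K g = ?K h"
    then have "?W g - {u1, u2} = ?W h - {u1, u2}" by simp
    moreover have "?W g - {u1, u2} = g" "?W h - {u1, u2} = h"
      using ig(2,3)[OF gh(1)] ig(2,3)[OF gh(2)] by auto
    ultimately show "g = h" by simp
  qed
  finally show ?thesis .
qed

end

section \<open>Expansion of the bracket\<close>

lemma A_pow_power: "A_pow k ^ m = A_pow (k * int m)"
  by (induction m) (simp_all add: A_pow_0 A_pow_add[symmetric] algebra_simps)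

lemma delta_power:
  assumes "s = 1 \<or> s = (-1 :: int)"
  shows "\<delta> ^ q = (-1) ^ q * A_pow (s * (2 * int q)) * (1 + A_pow (-4 * s)) ^ q"
proof -
  have "\<delta> = (-1) * A_pow (2 * s) * (1 + A_pow (-4 * s))"
    using assms by (auto simp: \<delta>_def distrib_left A_pow_add[symmetric])
  then have "\<delta> ^ q = ((-1) * A_pow (2 * s) * (1 + A_pow (-4 * s))) ^ q" by (rule arg_cong)
  also have "\<dots> = (-1) ^ q * A_pow (2 * s * int q) * (1 + A_pow (-4 * s)) ^ q"
    unfolding power_mult_distrib A_pow_power ..
  also have "2 * s * int q = s * (2 * int q)" by simp
  finally show ?thesis .
qed

lemma A_pow_mult_delta:
  assumes "s = 1 \<or> s = (-1 :: int)"
  shows "A_pow (s * m) * \<delta> = - A_pow (s * (m + 2)) - A_pow (s * (m - 2))"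
  using assms by (auto simp: \<delta>_def right_diff_distrib A_pow_add[symmetric] algebra_simps)

text \<open>
  The contributions of \<open>X\<close> and \<open>X \<union> {d}\<close>. If \<open>X\<close> connects the ends of \<open>d\<close>, then adding
  \<open>d\<close> splits off a circle, otherwise it merges two. The sign \<open>s\<close> is \<open>1\<close> for the graph
  whose edges are A-edges apart from \<open>d\<close> and \<open>- 1\<close> for the dual graph, where \<open>A\<close> is
  replaced by its inverse.
\<close>

lemma joined_term:
  assumes s: "s = 1 \<or> s = (-1 :: int)"
  shows "A_pow (s * (m - 1)) * \<delta> ^ q + A_pow (s * (m + 1)) * \<delta> ^ Suc q =
    (-1) ^ Suc q * (A_pow (s * (m + 3 + 2 * int q)) * (1 + A_pow (-4 * s)) ^ q)"
proof -
  have "A_pow (s * (m - 1)) * \<delta> ^ q + A_pow (s * (m + 1)) * \<delta> ^ Suc q =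
      (A_pow (s * (m - 1)) + A_pow (s * (m + 1)) * \<delta>) * \<delta> ^ q"
    by (simp add: algebra_simps)
  also have "A_pow (s * (m - 1)) + A_pow (s * (m + 1)) * \<delta> = - A_pow (s * (m + 3))"
    unfolding A_pow_mult_delta[OF s] by (simp add: add.commute)
  also have "- A_pow (s * (m + 3)) * \<delta> ^ q =
      (-1) ^ Suc q * ((A_pow (s * (m + 3)) * A_pow (s * (2 * int q))) * (1 + A_pow (-4 * s)) ^ q)"
    unfolding delta_power[OF s] by (simp add: ac_simps)
  finally show ?thesis unfolding A_pow_add[symmetric] distrib_left[symmetric] .
qed

lemma unjoined_term:
  assumes s: "s = 1 \<or> s = (-1 :: int)"
  shows "A_pow (s * (m - 1)) * \<delta> ^ Suc q + A_pow (s * (m + 1)) * \<delta> ^ q =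
    - ((-1) ^ q * (A_pow (s * (m - 3 + 2 * int q)) * (1 + A_pow (-4 * s)) ^ q))"
proof -
  have "A_pow (s * (m - 1)) * \<delta> ^ Suc q + A_pow (s * (m + 1)) * \<delta> ^ q =
      (A_pow (s * (m - 1)) * \<delta> + A_pow (s * (m + 1))) * \<delta> ^ q"
    by (simp add: algebra_simps)
  also have "A_pow (s * (m - 1)) * \<delta> + A_pow (s * (m + 1)) = - A_pow (s * (m - 3))"
    unfolding A_pow_mult_delta[OF s] by (simp add: add.commute)
  also have "- A_pow (s * (m - 3)) * \<delta> ^ q =
      - ((-1) ^ q * ((A_pow (s * (m - 3)) * A_pow (s * (2 * int q))) * (1 + A_pow (-4 * s)) ^ q))"
    unfolding delta_power[OF s] by (simp add: ac_simps)
  finally show ?thesis unfolding A_pow_add[symmetric] distrib_left[symmetric] .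
qed

text \<open>
  The coefficient of \<open>t ^ i\<close> in \<open>t ^ a * (1 + t) ^ q\<close>.
\<close>

definition binom_coeff :: "nat \<Rightarrow> nat \<Rightarrow> nat \<Rightarrow> int" where
  "binom_coeff a q i = (if a \<le> i then int (q choose (i - a)) else 0)"

lemma binomial_expansion:
  assumes "a + q \<le> N"
  shows "A_pow (s * (t - 4 * int a)) * (1 + A_pow (-4 * s)) ^ q =
    (\<Sum>i\<le>N. of_int (binom_coeff a q i) * A_pow (s * (t - 4 * int i)))"
proof -
  let ?f = "\<lambda>i. of_int (binom_coeff a q i) * A_pow (s * (t - 4 * int i))"
  have "(\<Sum>i\<le>N. ?f i) = (\<Sum>i\<in>{0 + a..q + a}. ?f i)"
    using assms by (intro sum.mono_neutral_right) (auto simp: binom_coeff_def)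
  also have "\<dots> = (\<Sum>l\<in>{0..q}. ?f (l + a))" by (rule sum.shift_bounds_cl_nat_ivl)
  also have "\<dots> = (\<Sum>l\<le>q. A_pow (s * (t - 4 * int a)) * (of_nat (q choose l) * A_pow (-4 * s) ^ l))"
    unfolding atMost_atLeast0[symmetric]
  proof (intro sum.cong refl)
    fix l
    have "A_pow (s * (t - 4 * int (l + a))) = A_pow (s * (t - 4 * int a)) * A_pow (-4 * s) ^ l"
      unfolding A_pow_power A_pow_add[symmetric] by (simp add: algebra_simps)
    then show "?f (l + a) = A_pow (s * (t - 4 * int a)) * (of_nat (q choose l) * A_pow (-4 * s) ^ l)"
      by (simp add: binom_coeff_def ac_simps)
  qed
  also have "\<dots> = A_pow (s * (t - 4 * int a)) * (A_pow (-4 * s) + 1) ^ q"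
    unfolding binomial_ring sum_distrib_left by simp
  finally show ?thesis by (simp add: add.commute)
qed

lemma alt_sum_cmult: "alt_sum E (\<lambda>X. a * h X) = a * alt_sum E h"
  by (simp add: alt_sum_def sum_distrib_left mult.left_commute)

context shaded_diagram
begin

lemma checkerboard_graph_eq:
  "checkerboard_graph D R = \<lparr>verts = R, edges = {..<n}, endpoints = ends\<rparr>"
  by (simp add: checkerboard_graph_def ends_def fun_eq_iff)

lemma ends_two_subsets:
  assumes "i < n" "\<not> is_loop (checkerboard_graph D R) i"
  shows "ends i \<in> two_subsets R"
proof -
  obtain k where k: "k < 4" "reg (i, k) \<in> R"
    using R_corner_parity[OF assms(1), of 1] that[of 0] that[of 1] by auto
  have "ends i = {reg (i, k), reg (i, (k + 2) mod 4)}" by (rule ends_eq[OF assms(1) k])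
  moreover have "card (ends i) \<noteq> 1" using assms by (simp add: is_loop_def checkerboard_graph_eq)
  moreover have "ends i \<subseteq> R" by (simp add: ends_def)
  ultimately show ?thesis by (auto simp: two_subsets_def card_insert_if split: if_splits)
qed

lemma state_of_bij: "bij_betw state_of (Pow {..<n}) (Pow {..<n})"
  by (rule bij_betw_byWitness[where f' = state_of]) (auto simp: state_of_def)

lemma L_nonempty: "L \<noteq> {}"
proof -
  have "(0, 0) \<in> darts D" using n_pos by (simp add: dart_iff)
  then show ?thesis unfolding labels_eq by blast
qed

text \<open>
  The expansion from one end, for either checkerboard graph. The assumptions \<open>weight\<close> say that the
  power of \<open>A\<close> belonging to the state of \<open>H\<close> is \<open>s\<close> times the number of edges outside
  \<open>H\<close> minus the number of edges in \<open>H\<close>, except that \<open>d\<close> is counted with the opposite sign.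
\<close>

theorem bracket_expansion:
  fixes s :: int and d :: nat and G :: "(region, nat) multigraph"
  defines "G \<equiv> checkerboard_graph D R"
  defines "E \<equiv> {..<n} - {d}"
  assumes d: "d < n" and u: "endpoints G d = {u1, u2}" "u1 \<noteq> u2"
    and single: "{e \<in> edges G. endpoints G e = {u1, u2}} = {d}" and no_loop: "\<And>e. \<not> is_loop G e"
    and s: "s = 1 \<or> s = -1"
    and weight: "\<And>X. X \<subseteq> E \<Longrightarrow> int n - 2 * int (card (state_of X)) = s * (int n - 2 * int (card X) - 2)"
      "\<And>X. X \<subseteq> E \<Longrightarrow> int n - 2 * int (card (state_of (insert d X))) = s * (int n - 2 * int (card X))"
  obtains N a where "N \<ge> 1"
    and "bracket D = (\<Sum>i\<le>N. of_int (a i) * A_pow (s * (int n + 2 * int (num_v G) - 8 - 4 * int i)))"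
    and "a 0 = (- 1) ^ num_v G * (int (num_P G u1 u2) - 1)"
    and "a 1 = (- 1) ^ (num_v G - 1) *
      (beta1 G * (int (num_P G u1 u2) - 1) - int (num_P G u1 u2 choose 2)
        + int (num_Pi 2 G u1 u2) - int (num_Pi 0 G u1 u2)
        + int (num_Q G u1 u2) - int (num_S G u1 u2))"
proof -
  have two: "ends i \<in> two_subsets R" if "i < n" for i
    using ends_two_subsets[OF that] no_loop unfolding G_def by blast
  have ud: "ends d = {u1, u2}" using u(1) by (simp add: G_def checkerboard_graph_eq)
  have u_in: "u1 \<in> R" "u2 \<in> R" using two[OF d] by (auto simp: ud two_subsets_def)
  interpret Gr: dealternator_graph R E ends u1 u2 G d
  proof
    show "ends ` E \<subseteq> two_subsets R" using two by (auto simp: E_def)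
    show "{u1, u2} \<notin> ends ` E"
    proof
      assume "{u1, u2} \<in> ends ` E"
      then obtain e where "e \<in> E" "ends e = {u1, u2}" by auto
      then have "e \<in> {e \<in> edges G. endpoints G e = {u1, u2}}"
        by (simp add: G_def checkerboard_graph_eq E_def)
      then show False using \<open>e \<in> E\<close> unfolding single by (simp add: E_def)
    qed
  qed (use finite_R u_in u d in \<open>auto simp: G_def checkerboard_graph_eq E_def\<close>)
  let ?v = "card R" and ?t = "int n + 2 * int (card R) - 8"
  \<comment> \<open>K counts circles, k components and r the rank; contrib X is the contribution of X and X with d\<close>
  define K where "K H = comps L (smoothing (state_of H) (crossings D))" for H
  define k where "k X = comps R (links (ends ` X))" for X
  define r where "r X = rank R (ends ` X)" for X
  define f where "f S = A_pow (int n - 2 * int (card S)) *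
    \<delta> ^ (comps L (smoothing S (crossings D)) - 1)" for S
  define contrib where "contrib X = f (state_of X) + f (state_of (insert d X))" for X
  define coeff where "coeff X i = (if Gr.joined_in X then binom_coeff (r X - 2) (K X - 1) i
    else - binom_coeff (r X) (K X - 2) i)" for X i
  define N where "N = ?v + 2 * n"
  define a where "a i = (-1) ^ ?v * alt_sum E (\<lambda>X. coeff X i)" for i
  have En: "X \<subseteq> {..<n}" "d \<notin> X" "finite X" if "X \<subseteq> E" for X
    using that finite_subset[of X "{..<n}"] by (auto simp: E_def)
  have K: "int (K X) = 2 * int (k X) + int (card X) - int ?v" if "X \<subseteq> E" for X
    using circles_of_state[OF En(1)[OF that]] by (simp add: K_def k_def)
  have K_ins: "int (K (insert d X)) = int (K X) + (if Gr.joined_in X then 1 else - 1)" if X: "X \<subseteq> E" for X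
  proof -
    have "int (K (insert d X)) = 2 * int (comps R (links (ends ` insert d X))) + int (card (insert d X)) - int ?v"
      unfolding K_def using En(1)[OF X] d by (intro circles_of_state) simp
    moreover have "int (comps R (links (ends ` insert d X))) = int (k X) - (if Gr.joined_in X then 0 else 1)"
      using comps_links_insert[OF finite_R u_in, of "ends ` X"]
      by (simp add: ud k_def Gr.joined_in_def)
    ultimately show ?thesis using K[OF X] En[OF X] by simp
  qed
  have K_pos: "K H \<ge> 1" for H
    using comps_pos[OF _ L_nonempty] by (simp add: K_def Suc_le_eq)
  have K_le: "K H \<le> 2 * n" for H
    using comps_le[of L] card_arc_labels[OF wf] by (simp add: K_def)
  have r: "int (r X) = int ?v - int (k X)" for X
    using comps_rank[OF finite_R] by (simp add: r_def k_def)
  \<comment> \<open>connecting the nonadjacent vertices u1 and u2 takes at least two edges\<close>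
  have r_joined: "r X \<ge> 2" if "X \<subseteq> E" "Gr.joined_in X" for X
    using Gr.joined_rank_pos[OF that] by (simp add: r_def)
  have K_unjoined: "K X \<ge> 2" if "X \<subseteq> E" "\<not> Gr.joined_in X" for X
    using K_ins[OF that(1)] K_pos[of "insert d X"] that(2) by simp
  have r_le: "r X \<le> ?v" for X using r[of X] by simp
  have sign: "(-1 :: laurent) ^ K X = (-1) ^ (card X + ?v)" if "X \<subseteq> E" for X
  proof -
    have "K X + ?v = 2 * k X + card X" using K[OF that] by linarith
    then have "even (K X) \<longleftrightarrow> even (card X + ?v)" by presburger
    then show ?thesis by (simp add: uminus_power_if del: power_add)
  qed
  have contrib: "contrib X = (\<Sum>i\<le>N. of_int ((-1) ^ (card X + ?v) * coeff X i) * A_pow (s * (?t - 4 * int i)))"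
    if X: "X \<subseteq> E" for X
  proof -
    let ?m = "int n - 2 * int (card X) - 1"
    have f: "f (state_of X) = A_pow (s * (?m - 1)) * \<delta> ^ (K X - 1)"
      "f (state_of (insert d X)) = A_pow (s * (?m + 1)) * \<delta> ^ (K (insert d X) - 1)"
      unfolding f_def K_def weight(1)[OF X] weight(2)[OF X] by simp_all
    show ?thesis
    proof (cases "Gr.joined_in X")
      case True
      have "K (insert d X) - 1 = Suc (K X - 1)" using K_ins[OF X] True K_pos[of X] by simp
      then have "contrib X = (-1) ^ Suc (K X - 1) *
          (A_pow (s * (?m + 3 + 2 * int (K X - 1))) * (1 + A_pow (-4 * s)) ^ (K X - 1))"
        unfolding contrib_def f using joined_term[OF s, of ?m "K X - 1"] by simp
      also have "Suc (K X - 1) = K X" using K_pos[of X] by simp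
      also have "?m + 3 + 2 * int (K X - 1) = ?t - 4 * int (r X - 2)"
        using K[OF X] K_pos[of X] r[of X] r_joined[OF X True] by (simp add: of_nat_diff)
      also have "A_pow (s * (?t - 4 * int (r X - 2))) * (1 + A_pow (-4 * s)) ^ (K X - 1) =
          (\<Sum>i\<le>N. of_int (binom_coeff (r X - 2) (K X - 1) i) * A_pow (s * (?t - 4 * int i)))"
        using r_le[of X] K_le[of X] by (intro binomial_expansion) (simp add: N_def)
      finally show ?thesis
        using True by (simp add: sign[OF X] coeff_def sum_distrib_left mult.assoc)
    next
      case False
      have K2: "K X - 1 = Suc (K X - 2)" "K (insert d X) - 1 = K X - 2"
        using K_ins[OF X] False K_unjoined[OF X False] by simp_all
      then have "contrib X = - ((-1) ^ (K X - 2) *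
          (A_pow (s * (?m - 3 + 2 * int (K X - 2))) * (1 + A_pow (-4 * s)) ^ (K X - 2)))"
        unfolding contrib_def f using unjoined_term[OF s, of ?m "K X - 2"] by simp
      also have "(-1 :: laurent) ^ (K X - 2) = (-1) ^ K X"
        using K_unjoined[OF X False] by (simp add: uminus_power_if)
      also have "?m - 3 + 2 * int (K X - 2) = ?t - 4 * int (r X)"
        using K[OF X] K_unjoined[OF X False] r[of X] by (simp add: of_nat_diff)
      also have "A_pow (s * (?t - 4 * int (r X))) * (1 + A_pow (-4 * s)) ^ (K X - 2) =
          (\<Sum>i\<le>N. of_int (binom_coeff (r X) (K X - 2) i) * A_pow (s * (?t - 4 * int i)))"
        using r_le[of X] K_le[of X] by (intro binomial_expansion) (simp add: N_def)
      finally show ?thesis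
        using False by (simp add: sign[OF X] coeff_def sum_distrib_left mult.assoc sum_negf)
    qed
  qed
  have circ: "circles D = 0"
    using link by (simp add: connected_link_diagram_def connected_diagram_def)
  have n_eq: "{..<n} = insert d E" using d by (auto simp: E_def)
  have "bracket D = (\<Sum>S\<in>Pow {..<n}. f S)"
    unfolding f_def by (rule bracket_state_sum[OF wf circ])
  also have "\<dots> = (\<Sum>H\<in>Pow {..<n}. f (state_of H))"
    by (rule sum.reindex_bij_betw[OF state_of_bij, symmetric])
  also have "\<dots> = (\<Sum>X\<in>Pow E. contrib X)"
    unfolding n_eq contrib_def by (rule sum_Pow_insert) (auto simp: E_def)
  also have "\<dots> = (\<Sum>X\<in>Pow E. \<Sum>i\<le>N. of_int ((-1) ^ (card X + ?v) * coeff X i) * A_pow (s * (?t - 4 * int i)))"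
    by (intro sum.cong refl contrib) simp
  also have "\<dots> = (\<Sum>i\<le>N. \<Sum>X\<in>Pow E. of_int ((-1) ^ (card X + ?v) * coeff X i) * A_pow (s * (?t - 4 * int i)))"
    by (rule sum.swap)
  also have "\<dots> = (\<Sum>i\<le>N. of_int (a i) * A_pow (s * (?t - 4 * int i)))"
  proof (intro sum.cong refl)
    fix i
    have "a i = (\<Sum>X\<in>Pow E. (-1) ^ (card X + ?v) * coeff X i)"
      unfolding a_def alt_sum_def sum_distrib_left by (intro sum.cong refl) (simp add: power_add)
    then show "(\<Sum>X\<in>Pow E. of_int ((-1) ^ (card X + ?v) * coeff X i) * A_pow (s * (?t - 4 * int i))) =
        of_int (a i) * A_pow (s * (?t - 4 * int i))"
      by (simp only: of_int_sum sum_distrib_right)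
  qed
  finally have expansion: "bracket D = (\<Sum>i\<le>N. of_int (a i) * A_pow (s * (?t - 4 * int i)))" .
  have not_joined: "\<not> Gr.joined_in X" if "X \<subseteq> E" "r X < 2" for X
    using r_joined[OF that(1)] that(2) by auto
  have coeff0: "coeff X 0 = of_bool (Gr.joined_in X \<and> r X = 2) + (-1) * of_bool (r X = 0)" if X: "X \<subseteq> E" for X
    using r_joined[OF X] by (auto simp: coeff_def binom_coeff_def)
  have "alt_sum E (\<lambda>X. coeff X 0) = int (num_P G u1 u2) - 1"
  proof -
    have "alt_sum E (\<lambda>X. coeff X 0) =
        alt_sum E (\<lambda>X. of_bool (Gr.joined_in X \<and> r X = 2) + (-1) * of_bool (r X = 0))"
      by (rule alt_sum_cong) (rule coeff0)
    also have "\<dots> = int (num_P G u1 u2) + (-1) * 1"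
      unfolding alt_sum_add alt_sum_cmult r_def Gr.joined_sum_2 Gr.rank_sums Gr.num_P_G ..
    finally show ?thesis by simp
  qed
  then have a0: "a 0 = (- 1) ^ num_v G * (int (num_P G u1 u2) - 1)"
    by (simp add: a_def Gr.num_v_G)
  have coeff1: "coeff X 1 = (int ?v - 5) * of_bool (Gr.joined_in X \<and> r X = 2)
      + int (card X) * of_bool (Gr.joined_in X \<and> r X = 2)
      + of_bool (Gr.joined_in X \<and> r X = 3)
      + (2 - int ?v) * of_bool (r X = 0) + (-1) * of_bool (r X = 1)" if X: "X \<subseteq> E" for X
  proof (cases "Gr.joined_in X")
    case True
    then have "r X \<ge> 2" using r_joined[OF X] by simp
    then consider "r X = 2" | "r X = 3" | "r X > 3" by linarith
    then show ?thesis
    proof cases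
      case 1
      then have "int (K X - 1) = int ?v - 5 + int (card X)"
        using K[OF X] K_pos[of X] r[of X] by (simp add: of_nat_diff)
      then show ?thesis using True 1 by (simp add: coeff_def binom_coeff_def)
    qed (use True in \<open>simp_all add: coeff_def binom_coeff_def\<close>)
  next
    case False
    consider "r X = 0" | "r X = 1" | "r X > 1" by linarith
    then show ?thesis
    proof cases
      case 1
      have "ends ` X = {}"
        using rank_small(1)[OF finite_R, of "ends ` X"] 1 two En(1)[OF X] by (auto simp: r_def)
      then have "card X = 0" by simp
      then have "int (K X - 2) = int ?v - 2"
        using K[OF X] K_unjoined[OF X False] r[of X] 1 by (simp add: of_nat_diff)
      then show ?thesis using False 1 by (simp add: coeff_def binom_coeff_def)
    qed (use False in \<open>simp_all add: coeff_def binom_coeff_def\<close>)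
  qed
  let ?P = "int (num_P G u1 u2)"
  have P: "int (card (Gr.N1 \<inter> Gr.N2)) = ?P" by (simp add: Gr.num_P_G)
  have "alt_sum E (\<lambda>X. coeff X 1) = (int ?v - 5) * ?P
      + (?P + int (num_Pi 0 G u1 u2) - int (num_Pi 2 G u1 u2))
      + (- (int (num_e G) - 3) * ?P + int (num_P G u1 u2 choose 2)
         - int (num_Q G u1 u2) + int (num_S G u1 u2))
      + (2 - int ?v) + (int (num_e G) - 1)"
  proof -
    have "alt_sum E (\<lambda>X. coeff X 1) = alt_sum E (\<lambda>X. (int ?v - 5) * of_bool (Gr.joined_in X \<and> r X = 2)
      + int (card X) * of_bool (Gr.joined_in X \<and> r X = 2)
      + of_bool (Gr.joined_in X \<and> r X = 3)
      + (2 - int ?v) * of_bool (r X = 0) + (-1) * of_bool (r X = 1))"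
      by (rule alt_sum_cong) (rule coeff1)
    also have "\<dots> = (int ?v - 5) * ?P
      + (?P + int (num_Pi 0 G u1 u2) - int (num_Pi 2 G u1 u2))
      + (- (int (card Gr.F) - 2) * ?P + int (num_P G u1 u2 choose 2)
         - int (num_Q G u1 u2) + int (num_S G u1 u2))
      + (2 - int ?v) * 1 + (-1) * (- int (card Gr.F))"
      unfolding alt_sum_add alt_sum_cmult r_def Gr.joined_sum_2 Gr.joined_card_sum_2 Gr.joined_sum_3
        Gr.rank_sums Gr.single_edge_count Gr.num_P_G Gr.num_Q_G Gr.num_S_G ..
    finally show ?thesis using Gr.num_e_G by simp
  qed
  then have sum1: "alt_sum E (\<lambda>X. coeff X 1) = - (beta1 G * (?P - 1) - int (num_P G u1 u2 choose 2)
        + int (num_Pi 2 G u1 u2) - int (num_Pi 0 G u1 u2)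
        + int (num_Q G u1 u2) - int (num_S G u1 u2))"
    unfolding beta1_def Gr.num_v_G by (simp add: algebra_simps)
  have minus: "(-1 :: int) ^ ?v = - ((-1) ^ (?v - 1))"
    using u_in finite_R by (cases ?v) auto
  have a1: "a 1 = (- 1) ^ (num_v G - 1) *
      (beta1 G * (int (num_P G u1 u2) - 1) - int (num_P G u1 u2 choose 2)
        + int (num_Pi 2 G u1 u2) - int (num_Pi 0 G u1 u2)
        + int (num_Q G u1 u2) - int (num_S G u1 u2))"
    unfolding a_def sum1 Gr.num_v_G minus by (simp only: minus_mult_minus)
  have "N \<ge> 1" unfolding N_def using n_pos by linarith
  then show thesis using expansion[folded Gr.num_v_G] a0 a1 by (rule that)
qed

text \<open>
  If the corners 0 at all crossings were in \<open>R\<close>, then the diagram would be alternating at every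
  arc. By almost alternation this fails at an arc from the dealternator to another crossing, and
  connectedness provides such an arc.
\<close>

lemma dealternator_corner:
  assumes "almost_alternating D d" "\<And>i. i < n \<Longrightarrow> i \<noteq> d \<Longrightarrow> reg (i, 0) \<in> R" "n \<ge> 2"
  shows "reg (d, 0) \<notin> R"
proof
  assume "reg (d, 0) \<in> R"
  then have "reg (i, 0) \<in> R" if "i < n" for i using assms(2) that by (cases "i = d") auto
  then have even: "reg (i, k) \<in> R \<longleftrightarrow> even k" if "i < n" "k < 4" for i k
    using R_corner_parity that by blast
  have d: "d < n" using assms(1) by (simp add: almost_alternating_def)
  obtain i where i: "i < n" "i \<noteq> d"
  proof
    show "(if d = 0 then 1 else 0) < n" "(if d = 0 then 1 else 0) \<noteq> d"
      using assms(3) n_pos by simp_all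
  qed
  have "(d, i) \<in> (adjacent_crossings D)\<^sup>*"
    using link d i(1) by (simp add: connected_link_diagram_def connected_diagram_def)
  then have "\<exists>j. j \<noteq> d \<and> (d, j) \<in> adjacent_crossings D"
    using i(2) by (induction rule: rtrancl_induct) auto
  then obtain j where j: "j \<noteq> d" "(d, j) \<in> adjacent_crossings D" by blast
  then obtain a where "j < n" "a \<in> set (arc_ends (crossings D ! d))" "a \<in> set (arc_ends (crossings D ! j))"
    by (auto simp: adjacent_crossings_def)
  moreover have "length (arc_ends x) = 4" for x :: "'a crossing" by (cases x) simp
  ultimately obtain p q where pq: "p < 4" "q < 4" "lab (d, p) = lab (j, q)" "j < n"
    by (auto simp: in_set_conv_nth dart_label_def)
  have darts: "(d, p) \<in> darts D" "(j, q) \<in> darts D" using d pq by (simp_all add: dart_iff)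
  have m: "mate D (d, p) = (j, q)"
    using mate_unique[OF wf darts] j(1) pq(3) by simp
  have "reg (j, (q + 3) mod 4) = reg (d, p)"
    using reg_prev_mate[OF darts(1)] by (simp add: m prev_corner_def)
  then have "even ((q + 3) mod 4) \<longleftrightarrow> even p" using even d pq by (metis mod_less_divisor zero_less_numeral)
  moreover have "even ((q + 3) mod 4) \<longleftrightarrow> odd q" by presburger
  moreover have "even p \<longleftrightarrow> even q"
    using almost_alternating_mate[OF wf assms(1) darts(1) m] j(1) by simp
  ultimately show False by simp
qed

end

lemma lookup_A_pow_sum:
  "Poly_Mapping.lookup (\<Sum>i\<in>I. of_int (a i) * A_pow (g i)) e = (\<Sum>i\<in>I. if g i = e then a i else 0)"
proof -
  have "of_int z * A_pow k = Poly_Mapping.single k z" for z k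
    unfolding A_pow_def single_of_int[symmetric] mult_single by simp
  then show ?thesis by (simp add: lookup_sum lookup_single when_def)
qed

theorem theorem3p1:
  fixes D :: "'a diagram" and d c :: nat and sh :: "region set"
    and G Gbar :: "(region, nat) multigraph" and u1 u2 v1 v2 :: region
  assumes "connected_link_diagram D"
    and "c = num_crossings D"
    and "almost_alternating D d"
    and "checkerboard_shading D sh"
    and "G = checkerboard_graph D sh"
    and "Gbar = checkerboard_graph D (regions D - sh)"
    and "\<forall>i < c. i \<noteq> d \<longrightarrow> A_edge D sh i"
    and "endpoints G d = {u1, u2}"
    and "endpoints Gbar d = {v1, v2}"
    and "strongly_reduced G Gbar d u1 u2 v1 v2"
  shows "\<exists>\<alpha> :: int \<Rightarrow> int.
    bracket D = (\<Sum>i = 0..int c - 3. of_int (\<alpha> i) * A_pow (int c + 2 * int (num_v G) - 8 - 4 * i)) \<and>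
    \<alpha> 0 = (- 1) ^ num_v G * (int (num_P G u1 u2) - 1) \<and>
    \<alpha> 1 = (- 1) ^ (num_v G - 1) *
      (beta1 G * (int (num_P G u1 u2) - 1) - int (num_P G u1 u2 choose 2)
        + int (num_Pi 2 G u1 u2) - int (num_Pi 0 G u1 u2)
        + int (num_Q G u1 u2) - int (num_S G u1 u2)) \<and>
    \<alpha> (int c - 4) = (- 1) ^ (num_v Gbar - 1) *
      (beta1 Gbar * (int (num_P Gbar v1 v2) - 1) - int (num_P Gbar v1 v2 choose 2)
        + int (num_Pi 2 Gbar v1 v2) - int (num_Pi 0 Gbar v1 v2)
        + int (num_Q Gbar v1 v2) - int (num_S Gbar v1 v2)) \<and>
    \<alpha> (int c - 3) = (- 1) ^ num_v Gbar * (int (num_P Gbar v1 v2) - 1)"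
proof -
  note c = assms(2) and G = assms(5) and Gbar = assms(6)
  interpret S: shaded_diagram D sh using assms(1,4) by unfold_locales
  interpret C: shaded_diagram D "regions D - sh" by (rule S.complement)
  have red: "u1 \<noteq> u2" "v1 \<noteq> v2" "{e \<in> edges G. endpoints G e = {u1, u2}} = {d}"
    "{e \<in> edges Gbar. endpoints Gbar e = {v1, v2}} = {d}"
    "\<And>e. \<not> is_loop G e" "\<And>e. \<not> is_loop Gbar e"
    using assms(10) by (auto simp: strongly_reduced_def)
  have d: "d < num_crossings D" using assms(3) by (simp add: almost_alternating_def)
  have verts: "num_v G = card sh" "num_v Gbar = card (regions D - sh)"
    by (simp_all add: num_v_def simplification_def G Gbar checkerboard_graph_def)
  have vv: "num_v G + num_v Gbar = c + 2" unfolding verts c by (rule S.card_R_complement)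
  have "c \<ge> 2"
  proof -
    have "{u1, u2} \<subseteq> sh" using assms(8) by (auto simp: G S.checkerboard_graph_eq S.ends_def)
    then have "card sh \<ge> 2" using card_mono[OF S.finite_R, of "{u1, u2}"] red(1) by simp
    moreover have "{v1, v2} \<subseteq> regions D - sh"
      using assms(9) by (auto simp: Gbar C.checkerboard_graph_eq C.ends_def)
    then have "card (regions D - sh) \<ge> 2"
      using card_mono[OF C.finite_R, of "{v1, v2}"] red(2) by simp
    ultimately show ?thesis using vv verts by simp
  qed
  have A: "region_at D (i, 0) \<in> sh" if "i < num_crossings D" "i \<noteq> d" for i
    using assms(7) that c by (auto simp: A_edge_def)
  have not_A: "region_at D (d, 0) \<notin> sh"
    using S.dealternator_corner[OF assms(3) A] \<open>c \<ge> 2\<close> c by simp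
  let ?E = "{..<num_crossings D} - {d}"
  have fin: "finite X" if "X \<subseteq> ?E" for X using that finite_subset by blast
  have cE: "card ?E = num_crossings D - 1" using d by simp
  have Sst: "S.state_of X = insert d X" "S.state_of (insert d X) = X" if "X \<subseteq> ?E" for X
    using that A not_A d unfolding S.state_of_def by auto
  have Cst: "C.state_of X = ?E - X" "C.state_of (insert d X) = insert d (?E - X)" if "X \<subseteq> ?E" for X
    using that A not_A d C.reg_in_regions unfolding C.state_of_def by (auto simp: C.dart_iff)
  have cX: "card X \<le> num_crossings D - 1" if "X \<subseteq> ?E" for X
    using card_mono[OF _ that] cE by simp
  have cD: "card (?E - X) = num_crossings D - 1 - card X" if "X \<subseteq> ?E" for X
    using card_Diff_subset[OF fin[OF that] that] cE by simp
  have dX: "d \<notin> X" if "X \<subseteq> ?E" for X using that by auto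
  have weight_S:
    "int (num_crossings D) - 2 * int (card (S.state_of X)) = 1 * (int (num_crossings D) - 2 * int (card X) - 2)"
    "int (num_crossings D) - 2 * int (card (S.state_of (insert d X))) = 1 * (int (num_crossings D) - 2 * int (card X))"
    if "X \<subseteq> ?E" for X
    using fin[OF that] dX[OF that] by (simp_all add: Sst[OF that])
  have weight_C:
    "int (num_crossings D) - 2 * int (card (C.state_of X)) = -1 * (int (num_crossings D) - 2 * int (card X) - 2)"
    "int (num_crossings D) - 2 * int (card (C.state_of (insert d X))) = -1 * (int (num_crossings D) - 2 * int (card X))"
    if "X \<subseteq> ?E" for X
    using cX[OF that] cD[OF that] d by (simp_all add: Cst[OF that] of_nat_diff)
  obtain N a where a: "N \<ge> 1"
    "bracket D = (\<Sum>i\<le>N. of_int (a i) * A_pow (1 * (int (num_crossings D) + 2 * int (num_v G) - 8 - 4 * int i)))"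
    "a 0 = (- 1) ^ num_v G * (int (num_P G u1 u2) - 1)"
    "a 1 = (- 1) ^ (num_v G - 1) *
      (beta1 G * (int (num_P G u1 u2) - 1) - int (num_P G u1 u2 choose 2)
        + int (num_Pi 2 G u1 u2) - int (num_Pi 0 G u1 u2)
        + int (num_Q G u1 u2) - int (num_S G u1 u2))"
    by (rule S.bracket_expansion[where s = 1 and d = d, folded G,
        OF d assms(8) red(1,3,5) disjI1[OF refl] weight_S])
  obtain M b where b: "M \<ge> 1"
    "bracket D = (\<Sum>i\<le>M. of_int (b i) * A_pow (-1 * (int (num_crossings D) + 2 * int (num_v Gbar) - 8 - 4 * int i)))"
    "b 0 = (- 1) ^ num_v Gbar * (int (num_P Gbar v1 v2) - 1)"
    "b 1 = (- 1) ^ (num_v Gbar - 1) *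
      (beta1 Gbar * (int (num_P Gbar v1 v2) - 1) - int (num_P Gbar v1 v2 choose 2)
        + int (num_Pi 2 Gbar v1 v2) - int (num_Pi 0 Gbar v1 v2)
        + int (num_Q Gbar v1 v2) - int (num_S Gbar v1 v2))"
    by (rule C.bracket_expansion[where s = "-1" and d = d, folded Gbar,
        OF d assms(9) red(2,4,6) disjI2[OF refl] weight_C])
  let ?t = "int c + 2 * int (num_v G) - 8"
  \<comment> \<open>defined for all integers i, so no case distinction on c is needed for overlapping coefficients\<close>
  define \<alpha> where "\<alpha> i = Poly_Mapping.lookup (bracket D) (?t - 4 * i)" for i
  have lookup_a: "Poly_Mapping.lookup (bracket D) e = (\<Sum>i\<le>N. if ?t - 4 * int i = e then a i else 0)" for e
    unfolding a(2) lookup_A_pow_sum by (simp add: c)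
  have shift: "-1 * (int (num_crossings D) + 2 * int (num_v Gbar) - 8 - 4 * int i) =
      ?t - 4 * (int c - 3 - int i)" for i
    using vv c by simp
  have lookup_b: "Poly_Mapping.lookup (bracket D) e =
      (\<Sum>i\<le>M. if ?t - 4 * (int c - 3 - int i) = e then b i else 0)" for e
    unfolding b(2) lookup_A_pow_sum shift ..
  have \<alpha>_a: "\<alpha> (int j) = a j" if "j \<le> N" for j
    using that unfolding \<alpha>_def lookup_a by simp
  have \<alpha>_b: "\<alpha> (int c - 3 - int j) = b j" if "j \<le> M" for j
    using that unfolding \<alpha>_def lookup_b by simp
  \<comment> \<open>one expansion bounds the exponents from above, the other one from below\<close>
  have support: "\<exists>i\<in>{0..int c - 3}. ?t - 4 * i = e" if nz: "Poly_Mapping.lookup (bracket D) e \<noteq> 0" for e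
  proof -
    have "\<exists>i. ?t - 4 * int i = e"
    proof (rule ccontr)
      assume "\<nexists>i. ?t - 4 * int i = e"
      then show False using nz unfolding lookup_a by simp
    qed
    then obtain i where i: "?t - 4 * int i = e" ..
    have "\<exists>j. ?t - 4 * (int c - 3 - int j) = e"
    proof (rule ccontr)
      assume "\<nexists>j. ?t - 4 * (int c - 3 - int j) = e"
      then show False using nz unfolding lookup_b by simp
    qed
    then obtain j where j: "?t - 4 * (int c - 3 - int j) = e" ..
    show ?thesis using i j by (intro bexI[of _ "int i"]) auto
  qed
  have "bracket D = (\<Sum>i = 0..int c - 3. of_int (\<alpha> i) * A_pow (?t - 4 * i))"
  proof (rule poly_mapping_eqI)
    fix e
    show "Poly_Mapping.lookup (bracket D) e =
        Poly_Mapping.lookup (\<Sum>i = 0..int c - 3. of_int (\<alpha> i) * A_pow (?t - 4 * i)) e"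
    proof (cases "\<exists>i\<in>{0..int c - 3}. ?t - 4 * i = e")
      case True
      then obtain i where i: "i \<in> {0..int c - 3}" "e = ?t - 4 * i" by blast
      then show ?thesis unfolding lookup_A_pow_sum by (simp add: \<alpha>_def)
    next
      case False
      then have "(\<Sum>i = 0..int c - 3. if ?t - 4 * i = e then \<alpha> i else 0) = 0"
        by (intro sum.neutral) auto
      then show ?thesis using support[of e] False unfolding lookup_A_pow_sum by auto
    qed
  qed
  moreover have "\<alpha> 0 = a 0" "\<alpha> 1 = a 1" "\<alpha> (int c - 3) = b 0" "\<alpha> (int c - 4) = b 1"
    using \<alpha>_a[of 0] \<alpha>_a[of 1] \<alpha>_b[of 0] \<alpha>_b[of 1] a(1) b(1) by simp_all
  ultimately show ?thesis
    unfolding a(3,4)[symmetric] b(3,4)[symmetric] by (intro exI[of _ \<alpha>]) simp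
qed

end
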